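(* Let $\Lambda_0,\Lambda_1\subseteq\mathbb{C}$ be lattices and $\mathcal{E}_i:=\mathbb{C}/\Lambda_i$. Suppose $F:\mathcal{E}_0\rightsquigarrow\mathcal{E}_0$ is a correspondence such that $\mathcal{E}_1:=\mathcal{C}_F$ is irreducible of genus one, and that the projections $f_1,g_1:\mathcal{E}_1\to\mathcal{E}_0$ lift to $z\mapsto\alpha z+\gamma$ and $z\mapsto\beta z+\delta$ on $\mathbb{C}$. (1) Suppose $\mathcal{E}_0$ does not have complex multiplication. (a) If $\mathcal{E}_1\not\cong\mathcal{E}_0$, then $\mathcal{C}_{F^n}$ is reducible for all $n\ge 2$. (b) If $\mathcal{E}_1\cong\mathcal{E}_0$, then one may take $\Lambda_0=\Lambda_1$, in which case $\alpha,\beta\in\mathbb{Z}$; then $F$ is stable and $\mathcal{C}_{F^n}$ has genus one for all $n\ge0$ if and only if $\gcd(\alpha,\beta)=1$. (2) Suppose $\mathcal{E}_i$ ($i=0,1$) has complex multiplication by an order $\mathcal{O}_i$ (the multiplier ring $\{\lambda\in\mathbb{C}:\lambda\Lambda_i\subseteq\Lambda_i\}$) in an imaginary quadratic field $K$. Then $\mathcal{C}_{F^n}$ is irreducible of genus one for all $n\ge 0$ if and only if $\alpha\Lambda_1+\beta\Lambda_1=\Lambda_0$ and $\alpha\mathcal{O}_1+\beta\mathcal{O}_1$ is an invertible fractional $\mathcal{O}_1$-ideal. In particular, $F$ is stable if and only if $\mathcal{C}_{F^3}$ is irreducible.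
   Context: Curves are smooth projective complex curves of pure dimension one (possibly reducible); the fiber product of maps $f:\mathcal{C}_1\to\mathcal{D}$, $g:\mathcal{C}_2\to\mathcal{D}$ is the normalization of $\{(p,q):f(p)=g(q)\}$. A correspondence $F:\mathcal{D}\rightsquigarrow\mathcal{D}$ is a (normalized) curve $\mathcal{C}_F\subseteq\mathcal{D}\times\mathcal{D}$ whose coordinate projections $f_1,g_1:\mathcal{C}_F\to\mathcal{D}$ are finite and surjective. Set $\mathcal{C}_{F^0}=\mathcal{D}$, $\mathcal{C}_{F^1}=\mathcal{C}_F$ and recursively let $\mathcal{C}_{F^{n+1}}$ be the fiber product of $g_n:\mathcal{C}_{F^n}\to\mathcal{C}_{F^{n-1}}$ and $f_n:\mathcal{C}_{F^n}\to\mathcal{C}_{F^{n-1}}$, with projections $f_{n+1},g_{n+1}$ satisfying $g_nf_{n+1}=f_ng_{n+1}$. $F$ is stable if $\mathcal{C}_{F^n}$ is irreducible for all $n\ge 0$. A fractional ideal $J$ of a domain $\mathcal{O}$ with fraction field $K$ is invertible if $JJ^{-1}=\mathcal{O}$, where $J^{-1}=\{a\in K: aJ\subseteq\mathcal{O}\}$.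
   Formalization: In (2), for α, β outside K the module αO_1+βO_1 is not a fractional ideal (e.g. Λ_1=Z[i], Λ_0=πZ[i], α=π, β=iπ), so invertibility is asked of c(αO_1+βO_1) for some c≠0; the literal condition is proved when α, β lie in K. *)

theory Defs
  imports "HOL-Complex_Analysis.Complex_Analysis" "HOL-Library.Function_Algebras"
begin

section \<open>Curves as compact Riemann surfaces\<close>

text \<open>
  A smooth projective complex curve of pure dimension one (possibly reducible) is represented by
  the compact Riemann surface (possibly disconnected) of its points, and a morphism of curves by a
  holomorphic map. The points form the carrier of an abstract topology. A chart is a pair
  \<open>(U, \<phi>)\<close> of an open set and a coordinate function that matters only on \<open>U\<close>. The atlas need not
  be maximal.
\<close>

type_synonym 'a chart = "'a set \<times> ('a \<Rightarrow> complex)"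

record 'a surface =
  top_of :: "'a topology"
  atlas :: "'a chart set"

abbreviation points :: "'a surface \<Rightarrow> 'a set" where
  "points X \<equiv> topspace (top_of X)"

definition curve :: "'a surface \<Rightarrow> bool" where
  "curve X \<longleftrightarrow>
     compact_space (top_of X) \<and> Hausdorff_space (top_of X) \<and>
     points X = (\<Union>(U, \<phi>) \<in> atlas X. U) \<and>
     (\<forall>(U, \<phi>) \<in> atlas X.
        openin (top_of X) U \<and> open (\<phi> ` U) \<and>
        homeomorphic_map (subtopology (top_of X) U) (top_of_set (\<phi> ` U)) \<phi>) \<and>
     (\<forall>(U, \<phi>) \<in> atlas X. \<forall>(V, \<psi>) \<in> atlas X.
        (\<lambda>z. \<psi> (inv_into U \<phi> z)) holomorphic_on \<phi> ` (U \<inter> V))"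

definition holomorphic_map :: "'a surface \<Rightarrow> 'b surface \<Rightarrow> ('a \<Rightarrow> 'b) \<Rightarrow> bool" where
  "holomorphic_map X Y f \<longleftrightarrow>
     continuous_map (top_of X) (top_of Y) f \<and>
     (\<forall>(U, \<phi>) \<in> atlas X. \<forall>(V, \<psi>) \<in> atlas Y.
        (\<lambda>z. \<psi> (f (inv_into U \<phi> z))) holomorphic_on \<phi> ` {x \<in> U. f x \<in> V})"

definition isomorphic_curves :: "'a surface \<Rightarrow> 'b surface \<Rightarrow> bool" where
  "isomorphic_curves X Y \<longleftrightarrow>
     (\<exists>h k. holomorphic_map X Y h \<and> holomorphic_map Y X k \<and>
            (\<forall>x \<in> points X. k (h x) = x) \<and> (\<forall>y \<in> points Y. h (k y) = y))"

definition finite_surjective_map :: "'a surface \<Rightarrow> 'b surface \<Rightarrow> ('a \<Rightarrow> 'b) \<Rightarrow> bool" where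
  "finite_surjective_map X Y f \<longleftrightarrow>
     holomorphic_map X Y f \<and> f ` points X = points Y \<and>
     (\<forall>y \<in> points Y. finite {x \<in> points X. f x = y})"

definition holomorphic_function_on :: "'a surface \<Rightarrow> 'a set \<Rightarrow> ('a \<Rightarrow> complex) \<Rightarrow> bool" where
  "holomorphic_function_on X W h \<longleftrightarrow>
     (\<forall>(U, \<phi>) \<in> atlas X. (\<lambda>z. h (inv_into U \<phi> z)) holomorphic_on \<phi> ` (U \<inter> W))"

text \<open>
  By Chow's theorem the closed analytic subsets of a projective curve are its Zariski closed
  subsets, so that \<open>irreducible_curve\<close> is irreducibility in the usual sense.
\<close>

definition analytic_subset :: "'a surface \<Rightarrow> 'a set \<Rightarrow> bool" where
  "analytic_subset X A \<longleftrightarrow>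
     A \<subseteq> points X \<and>
     (\<forall>x \<in> points X. \<exists>W H. openin (top_of X) W \<and> x \<in> W \<and> finite H \<and>
        (\<forall>h \<in> H. holomorphic_function_on X W h) \<and>
        A \<inter> W = {y \<in> W. \<forall>h \<in> H. h y = 0})"

definition irreducible_curve :: "'a surface \<Rightarrow> bool" where
  "irreducible_curve X \<longleftrightarrow>
     points X \<noteq> {} \<and>
     (\<forall>A B. analytic_subset X A \<and> analytic_subset X B \<and> A \<union> B = points X \<longrightarrow>
            A = points X \<or> B = points X)"

text \<open>
  A holomorphic 1-form \<open>\<omega>\<close> is given by its coefficient functions: it is \<open>\<omega> (U, \<phi>) z dz\<close> in the
  coordinate \<open>z = \<phi> x\<close>. Coefficients are set to 0 outside the charts, so that equal forms are
  equal functions. The genus is the complex dimension of the space of holomorphic 1-forms.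
\<close>

definition holomorphic_forms :: "'a surface \<Rightarrow> ('a chart \<Rightarrow> complex \<Rightarrow> complex) set" where
  "holomorphic_forms X =
     {\<omega>. (\<forall>(U, \<phi>) \<in> atlas X. \<omega> (U, \<phi>) holomorphic_on \<phi> ` U) \<and>
         (\<forall>(U, \<phi>) \<in> atlas X. \<forall>(V, \<psi>) \<in> atlas X. \<forall>x \<in> U \<inter> V.
            \<omega> (U, \<phi>) (\<phi> x) =
            \<omega> (V, \<psi>) (\<psi> x) * deriv (\<lambda>z. \<psi> (inv_into U \<phi> z)) (\<phi> x)) \<and>
         (\<forall>U \<phi> z. \<not> ((U, \<phi>) \<in> atlas X \<and> z \<in> \<phi> ` U) \<longrightarrow> \<omega> (U, \<phi>) z = 0)}"

definition scale_form ::
  "complex \<Rightarrow> ('a chart \<Rightarrow> complex \<Rightarrow> complex) \<Rightarrow> 'a chart \<Rightarrow> complex \<Rightarrow> complex" where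
  "scale_form c \<omega> = (\<lambda>k z. c * \<omega> k z)"

lemma vector_space_scale_form: "vector_space scale_form"
  by unfold_locales (auto simp: scale_form_def fun_eq_iff algebra_simps)

definition genus :: "'a surface \<Rightarrow> nat" where
  "genus X = vector_space.dim scale_form (holomorphic_forms X)"


section \<open>Fiber products and iterated correspondences\<close>

text \<open>
  \<open>(p, q)\<close> exhibits \<open>Y\<close> as the normalization of the curve \<open>Z \<subseteq> X\<^sub>1 \<times> X\<^sub>2\<close>: it maps the smooth
  curve \<open>Y\<close> onto \<open>Z\<close>, and one-to-one outside the preimage of a finite set \<open>S\<close> (containing the
  singular points of \<open>Z\<close>), this preimage being finite.
\<close>

definition normalization_of ::
  "'a surface \<Rightarrow> 'b surface \<Rightarrow> ('a \<times> 'b) set \<Rightarrow> 'c surface \<Rightarrow> ('c \<Rightarrow> 'a) \<Rightarrow> ('c \<Rightarrow> 'b) \<Rightarrow> bool" where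
  "normalization_of X1 X2 Z Y p q \<longleftrightarrow>
     curve Y \<and> holomorphic_map Y X1 p \<and> holomorphic_map Y X2 q \<and>
     (\<lambda>y. (p y, q y)) ` points Y = Z \<and>
     (\<exists>S. finite S \<and> S \<subseteq> Z \<and> finite {y \<in> points Y. (p y, q y) \<in> S} \<and>
          inj_on (\<lambda>y. (p y, q y)) {y \<in> points Y. (p y, q y) \<notin> S})"

definition fiber_product ::
  "'a surface \<Rightarrow> ('a \<Rightarrow> 'd) \<Rightarrow> 'b surface \<Rightarrow> ('b \<Rightarrow> 'd) \<Rightarrow>
   'c surface \<Rightarrow> ('c \<Rightarrow> 'a) \<Rightarrow> ('c \<Rightarrow> 'b) \<Rightarrow> bool" where
  "fiber_product X1 f X2 g Y p q \<longleftrightarrow>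
     normalization_of X1 X2 {(x1, x2). x1 \<in> points X1 \<and> x2 \<in> points X2 \<and> f x1 = g x2} Y p q"

text \<open>
  A correspondence from \<open>D\<close> to itself is a curve \<open>E\<close> with two finite surjective maps to \<open>D\<close>. The
  map \<open>(f, g)\<close> to \<open>D \<times> D\<close> is not required to be generically injective: besides normalizations of
  curves in \<open>D \<times> D\<close> this admits correspondences with multiplicities.
\<close>

definition correspondence :: "'a surface \<Rightarrow> 'b surface \<Rightarrow> ('b \<Rightarrow> 'a) \<Rightarrow> ('b \<Rightarrow> 'a) \<Rightarrow> bool" where
  "correspondence D E f g \<longleftrightarrow>
     curve D \<and> curve E \<and> finite_surjective_map E D f \<and> finite_surjective_map E D g"

text \<open>
  \<open>C n\<close> is the curve of the \<open>n\<close>-th iterate, with projections \<open>f n, g n\<close> to \<open>C (n - 1)\<close> for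
  \<open>n \<ge> 1\<close>; \<open>f 0\<close> and \<open>g 0\<close> play no role. Fiber products being determined up to isomorphism only,
  this is a predicate on such sequences.
\<close>

definition iterates :: "(nat \<Rightarrow> 'a surface) \<Rightarrow> (nat \<Rightarrow> 'a \<Rightarrow> 'a) \<Rightarrow> (nat \<Rightarrow> 'a \<Rightarrow> 'a) \<Rightarrow> bool" where
  "iterates C f g \<longleftrightarrow>
     correspondence (C 0) (C 1) (f 1) (g 1) \<and>
     (\<forall>n\<ge>1. fiber_product (C n) (g n) (C n) (f n) (C (n + 1)) (f (n + 1)) (g (n + 1)))"

definition stable_correspondence :: "(nat \<Rightarrow> 'a surface) \<Rightarrow> bool" where
  "stable_correspondence C \<longleftrightarrow> (\<forall>n. irreducible_curve (C n))"


section \<open>Complex tori\<close>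

definition complex_lattice :: "complex set \<Rightarrow> bool" where
  "complex_lattice \<Lambda> \<longleftrightarrow>
     (\<exists>w1 w2. w1 \<noteq> w2 \<and> independent {w1, w2} \<and>
              \<Lambda> = {of_int m * w1 + of_int n * w2 |m n. True})"

definition coset :: "complex set \<Rightarrow> complex \<Rightarrow> complex set" where
  "coset \<Lambda> z = (\<lambda>l. z + l) ` \<Lambda>"

text \<open>
  The quotient topology on the cosets; the charts are the local inverses of the projection.
\<close>

definition complex_torus :: "complex set \<Rightarrow> complex set surface" where
  "complex_torus \<Lambda> =
     \<lparr>top_of = topology (\<lambda>U. U \<subseteq> range (coset \<Lambda>) \<and> open (coset \<Lambda> -` U)),
      atlas = {(coset \<Lambda> ` V, inv_into V (coset \<Lambda>)) |V. open V \<and> inj_on (coset \<Lambda>) V}\<rparr>"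

lemma openin_complex_torus:
  "openin (top_of (complex_torus \<Lambda>)) U \<longleftrightarrow> U \<subseteq> range (coset \<Lambda>) \<and> open (coset \<Lambda> -` U)"
proof -
  have "istopology (\<lambda>U. U \<subseteq> range (coset \<Lambda>) \<and> open (coset \<Lambda> -` U))"
    unfolding istopology_def by (auto simp: vimage_Union)
  then show ?thesis
    by (simp add: complex_torus_def)
qed


section \<open>Orders, fractional ideals and complex multiplication\<close>

definition multiplier_ring :: "complex set \<Rightarrow> complex set" where
  "multiplier_ring \<Lambda> = {c. \<forall>l \<in> \<Lambda>. c * l \<in> \<Lambda>}"

definition has_CM :: "complex set \<Rightarrow> bool" where
  "has_CM \<Lambda> \<longleftrightarrow> multiplier_ring \<Lambda> \<noteq> \<int>"

definition imaginary_quadratic_field :: "complex set \<Rightarrow> bool" where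
  "imaginary_quadratic_field K \<longleftrightarrow>
     (\<exists>d::nat. d > 0 \<and> K = {of_rat a + of_rat b * (\<i> * of_real (sqrt (real d))) |a b. True})"

definition order_in :: "complex set \<Rightarrow> complex set \<Rightarrow> bool" where
  "order_in K R \<longleftrightarrow>
     R \<subseteq> K \<and> 1 \<in> R \<and> (\<forall>x \<in> R. \<forall>y \<in> R. x - y \<in> R \<and> x * y \<in> R) \<and>
     (\<exists>B. finite B \<and> R = {\<Sum>b\<in>B. of_int (c b) * b |c. True}) \<and>
     (\<forall>x \<in> K. \<exists>n::int. n \<noteq> 0 \<and> of_int n * x \<in> R)"

definition fraction_field :: "complex set \<Rightarrow> complex set" where
  "fraction_field R = {a / b |a b. a \<in> R \<and> b \<in> R \<and> b \<noteq> 0}"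

definition fractional_ideal :: "complex set \<Rightarrow> complex set \<Rightarrow> bool" where
  "fractional_ideal R J \<longleftrightarrow>
     J \<subseteq> fraction_field R \<and> 0 \<in> J \<and> J \<noteq> {0} \<and>
     (\<forall>x \<in> J. \<forall>y \<in> J. x + y \<in> J) \<and> (\<forall>r \<in> R. \<forall>x \<in> J. r * x \<in> J) \<and>
     (\<exists>d \<in> R. d \<noteq> 0 \<and> (\<forall>x \<in> J. d * x \<in> R))"

definition ideal_inverse :: "complex set \<Rightarrow> complex set \<Rightarrow> complex set" where
  "ideal_inverse R J = {a \<in> fraction_field R. \<forall>x \<in> J. a * x \<in> R}"

definition ideal_product :: "complex set \<Rightarrow> complex set \<Rightarrow> complex set" where
  "ideal_product I J =
     {(\<Sum>i<n. a i * b i) |(n::nat) a b. \<forall>i<n. a i \<in> I \<and> b i \<in> J}"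

definition invertible_fractional_ideal :: "complex set \<Rightarrow> complex set \<Rightarrow> bool" where
  "invertible_fractional_ideal R J \<longleftrightarrow>
     fractional_ideal R J \<and> ideal_product J (ideal_inverse R J) = R"

text \<open>The module \<open>\<alpha>M + \<beta>M\<close>.\<close>

definition two_span :: "complex \<Rightarrow> complex \<Rightarrow> complex set \<Rightarrow> complex set" where
  "two_span \<alpha> \<beta> M = {\<alpha> * x + \<beta> * y |x y. x \<in> M \<and> y \<in> M}"

end

theory Submission
  imports Defs
begin

text \<open>
  A curve \<open>X\<close> isomorphic to \<open>\<complex>/L\<close> is handled through its uniformization \<open>\<pi> : \<complex> \<rightarrow> X\<close>. If
  \<open>X = \<complex>/L \<rightarrow> X' = \<complex>/L'\<close> are two maps with slopes \<open>\<alpha>, \<beta>\<close>, a pair \<open>(\<pi> s, \<pi> t)\<close> of the fiber product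
  has the offset \<open>\<beta> s - \<alpha> t + const\<close> in \<open>L'\<close>, whose class modulo \<open>\<alpha>L + \<beta>L\<close> is well defined and locally
  constant. Hence the fiber product is connected if and only if \<open>\<alpha>L + \<beta>L = L'\<close>, and then it is
  \<open>\<complex>/L''\<close> for \<open>L'' = \<alpha>\<^sup>-\<^sup>1L \<inter> \<beta>\<^sup>-\<^sup>1L\<close>. So stability says that the lattices with \<open>L\<^sub>0 = \<Lambda>\<^sub>0\<close>, \<open>L\<^sub>1 = \<Lambda>\<^sub>1\<close>,
  \<open>L\<^sub>n\<^sub>+\<^sub>1 = \<alpha>\<^sup>-\<^sup>1L\<^sub>n \<inter> \<beta>\<^sup>-\<^sup>1L\<^sub>n\<close> satisfy \<open>\<alpha>L\<^sub>n\<^sub>+\<^sub>1 + \<beta>L\<^sub>n\<^sub>+\<^sub>1 = L\<^sub>n\<close> for all \<open>n\<close>. The case \<open>n = 1\<close> forces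
  \<open>\<alpha>\<O>\<^sub>1 + \<beta>\<O>\<^sub>1\<close> to be invertible, because \<open>\<Lambda>\<^sub>1\<close> is invertible over its multiplier ring; conversely, an
  identity \<open>1 = \<alpha>x + \<beta>y\<close> with \<open>x, y\<close> in the inverse ideal gives all the cases \<open>n \<ge> 1\<close>.
\<close>

section \<open>Uniformized curves\<close>

text \<open>A fiber product is given only up to isomorphism and nothing is known of its charts, so
  from the second iterate on there is no explicit quotient to work with; a map \<pi> from the plane
  has to be rebuilt at every step. The main obstacle is that a normalization is injective only off a
  finite set. Here the two projections are unramified, so the set of pairs has no singular branches
  of its own, but it must be excluded that the given curve has several points over one pair or
  contracts a component. From irreducibility only connectedness is extracted: it descends along the
  surjective projections, whereas nothing is known beforehand about the shape of a late iterate.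
  Thus one irreducible curve yields the lattice equations of all smaller indices. Without complex
  multiplication the argument by invertible modules has no counterpart, since a lattice of rank two
  is not invertible over the integers. Instead, finite index makes \<open>\<beta> / \<alpha>\<close>
  rational, and the first lattice equation then makes the two lattices homothetic by a factor
  \<open>c\<close> of which \<alpha> and \<beta> are coprime integer multiples.\<close>

lemma curve_chart:
  assumes "curve X" "(U, \<phi>) \<in> atlas X"
  shows "openin (top_of X) U" "open (\<phi> ` U)" "inj_on \<phi> U" "U \<subseteq> points X"
    and "homeomorphic_map (subtopology (top_of X) U) (top_of_set (\<phi> ` U)) \<phi>"
proof -
  show U: "openin (top_of X) U" and "open (\<phi> ` U)"
    and h: "homeomorphic_map (subtopology (top_of X) U) (top_of_set (\<phi> ` U)) \<phi>"
    using assms unfolding curve_def by auto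
  show sub: "U \<subseteq> points X" using openin_subset[OF U] .
  then show "inj_on \<phi> U"
    using homeomorphic_imp_injective_map[OF h] by (simp add: Int_absorb1)
qed

lemma curve_chart_at:
  assumes "curve X" "x \<in> points X"
  obtains U \<phi> where "(U, \<phi>) \<in> atlas X" "x \<in> U"
proof -
  have "x \<in> (\<Union>(U, \<phi>) \<in> atlas X. U)" using assms unfolding curve_def by auto
  then show ?thesis using that by auto
qed

lemma curve_transition:
  assumes "curve X" "(U, \<phi>) \<in> atlas X" "(V, \<psi>) \<in> atlas X"
  shows "(\<lambda>z. \<psi> (inv_into U \<phi> z)) holomorphic_on \<phi> ` (U \<inter> V)"
  using assms unfolding curve_def by fast

lemma open_chart_image:
  assumes "curve X" "(U, \<phi>) \<in> atlas X" "openin (top_of X) W" "W \<subseteq> U"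
  shows "open (\<phi> ` W)"
proof -
  note c = curve_chart[OF assms(1,2)]
  have "openin (subtopology (top_of X) U) W"
    using assms c by (simp add: openin_open_subtopology)
  then have "openin (top_of_set (\<phi> ` U)) (\<phi> ` W)"
    using homeomorphic_imp_open_map[OF c(5)] unfolding open_map_def by blast
  then show ?thesis using c(2) openin_open_eq by blast
qed

lemma openin_chart_vimage:
  assumes "curve X" "(U, \<phi>) \<in> atlas X" "open B"
  shows "openin (top_of X) {x \<in> U. \<phi> x \<in> B}"
proof -
  note c = curve_chart[OF assms(1,2)]
  have "continuous_map (subtopology (top_of X) U) (top_of_set (\<phi> ` U)) \<phi>"
    using homeomorphic_imp_continuous_map[OF c(5)] .
  moreover have "openin (top_of_set (\<phi> ` U)) (\<phi> ` U \<inter> B)"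
    using assms(3) by auto
  ultimately have "openin (subtopology (top_of X) U)
      {x \<in> topspace (subtopology (top_of X) U). \<phi> x \<in> \<phi> ` U \<inter> B}"
    using openin_continuous_map_preimage by blast
  moreover have "{x \<in> topspace (subtopology (top_of X) U). \<phi> x \<in> \<phi> ` U \<inter> B} = {x \<in> U. \<phi> x \<in> B}"
    using c(4) by auto
  ultimately have "openin (subtopology (top_of X) U) {x \<in> U. \<phi> x \<in> B}" by simp
  then show ?thesis using openin_trans_full[OF _ c(1)] by auto
qed

lemma holomorphic_map_id:
  assumes "curve X"
  shows "holomorphic_map X X (\<lambda>x. x)"
  unfolding holomorphic_map_def
  using curve_transition[OF assms] by (auto simp: Int_def id_def continuous_map_id[unfolded id_def])

section \<open>Discrete period groups and uniformizations\<close>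

text \<open>The rank is left out: discreteness alone passes at once to common preimages, and where
  full rank would be used, compactness of the curve takes its place.\<close>

definition discrete_subgroup :: "complex set \<Rightarrow> bool" where
  "discrete_subgroup L \<longleftrightarrow> 0 \<in> L \<and> (\<forall>x \<in> L. \<forall>y \<in> L. x - y \<in> L) \<and>
     (\<exists>e>0. \<forall>x \<in> L. norm x < e \<longrightarrow> x = 0)"

lemma discrete_subgroup_minus: "discrete_subgroup L \<Longrightarrow> x \<in> L \<Longrightarrow> - x \<in> L"
  unfolding discrete_subgroup_def by (metis diff_0)

lemma discrete_subgroup_add: "discrete_subgroup L \<Longrightarrow> x \<in> L \<Longrightarrow> y \<in> L \<Longrightarrow> x + y \<in> L"
  using discrete_subgroup_minus[of L y] unfolding discrete_subgroup_def
  by (metis diff_minus_eq_add)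

text \<open>Distinct elements of \<open>L\<close> keep a positive distance, so a continuous function
  into \<open>L\<close> cannot jump on a connected set. This makes offsets and differences of lifts
  rigid.\<close>

lemma discrete_subgroup_constant:
  assumes "discrete_subgroup L" "continuous_on S h" "connected S" "\<And>x. x \<in> S \<Longrightarrow> h x \<in> L"
    "x \<in> S" "y \<in> S"
  shows "h x = h y"
proof -
  obtain e where e: "e > 0" "\<And>x. x \<in> L \<Longrightarrow> norm x < e \<Longrightarrow> x = 0"
    using assms(1) unfolding discrete_subgroup_def by auto
  have "h constant_on S"
  proof (rule continuous_discrete_range_constant[OF assms(3,2)])
    fix x assume x: "x \<in> S"
    have "e \<le> norm (h y - h x)" if "y \<in> S" "h y \<noteq> h x" for y
      using e(2)[of "h y - h x"] that x assms(1,4) unfolding discrete_subgroup_def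
      by (metis linorder_not_le right_minus_eq)
    then show "\<exists>e>0. \<forall>y. y \<in> S \<and> h y \<noteq> h x \<longrightarrow> e \<le> norm (h y - h x)"
      using e(1) by auto
  qed
  then show ?thesis using assms(5,6) unfolding constant_on_def by auto
qed

text \<open>The quotient of the plane by \<open>L\<close>, presented by its projection because the
  iterates are not literally sets of cosets. That \<pi> is open and locally biholomorphic is derived
  from the discreteness of its fibres.\<close>

locale uniformized =
  fixes X :: "'a surface" and L :: "complex set" and \<pi> :: "complex \<Rightarrow> 'a"
  assumes curve: "curve X"
    and discrete: "discrete_subgroup L"
    and range: "range \<pi> = points X"
    and continuous: "continuous_map euclidean (top_of X) \<pi>"
    and fibre: "\<pi> z = \<pi> w \<longleftrightarrow> z - w \<in> L"
    and holomorphic: "(U, \<phi>) \<in> atlas X \<Longrightarrow> (\<lambda>z. \<phi> (\<pi> z)) holomorphic_on \<pi> -` U"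
begin

lemma in_points [simp]: "\<pi> z \<in> points X"
  using range by auto

lemma open_vimage: "openin (top_of X) W \<Longrightarrow> open (\<pi> -` W)"
  using openin_continuous_map_preimage[OF continuous, of W] by (simp add: vimage_def)

lemma chart_local_injective:
  assumes "(U, \<phi>) \<in> atlas X" "\<pi> s \<in> U"
  obtains r where "r > 0" "ball s r \<subseteq> \<pi> -` U" "inj_on (\<lambda>z. \<phi> (\<pi> z)) (ball s r)"
proof -
  note c = curve_chart[OF curve assms(1)]
  obtain e where e: "e > 0" "\<And>x. x \<in> L \<Longrightarrow> norm x < e \<Longrightarrow> x = 0"
    using discrete unfolding discrete_subgroup_def by auto
  obtain r where r: "r > 0" "ball s r \<subseteq> \<pi> -` U"
    using open_vimage[OF c(1)] assms(2) open_contains_ball by (metis vimageI)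
  \<comment> \<open>Points of a ball of radius \<open>e / 2\<close> differ by less than
    \<open>e\<close>, so a period between two of them is zero.\<close>
  define t where "t = min r (e / 2)"
  have "inj_on (\<lambda>z. \<phi> (\<pi> z)) (ball s t)"
  proof (rule inj_onI)
    fix z w assume zw: "z \<in> ball s t" "w \<in> ball s t" "\<phi> (\<pi> z) = \<phi> (\<pi> w)"
    then have "\<pi> z \<in> U" "\<pi> w \<in> U" using r unfolding t_def by auto
    then have "\<pi> z = \<pi> w" using zw(3) c(3) by (auto dest: inj_onD)
    then have "z - w \<in> L" using fibre by simp
    moreover have "dist s z < e / 2" "dist s w < e / 2" using zw by (auto simp: t_def)
    then have "dist z w < e" using dist_triangle_half_r[of s z e w] by simp
    ultimately show "z = w" using e(2)[of "z - w"] by (simp add: dist_norm)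
  qed
  moreover have "t > 0" "ball s t \<subseteq> \<pi> -` U" using r e(1) by (auto simp: t_def)
  ultimately show ?thesis using that by blast
qed

lemma deriv_chart_nonzero:
  assumes "(U, \<phi>) \<in> atlas X" "\<pi> s \<in> U"
  shows "deriv (\<lambda>z. \<phi> (\<pi> z)) s \<noteq> 0"
proof -
  obtain r where r: "r > 0" "ball s r \<subseteq> \<pi> -` U" "inj_on (\<lambda>z. \<phi> (\<pi> z)) (ball s r)"
    using chart_local_injective[OF assms] .
  have "(\<lambda>z. \<phi> (\<pi> z)) holomorphic_on ball s r"
    using holomorphic[OF assms(1)] r(2) holomorphic_on_subset by blast
  from holomorphic_injective_imp_regular[OF this open_ball r(3)] r(1) show ?thesis by simp
qed

text \<open>Near \<open>s\<close> the coordinate form \<open>G\<close> of \<pi> is injective and has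
  a holomorphic inverse \<open>k\<close>; the lift is \<open>k\<close> after the coordinate form
  \<open>P\<close> of \<open>p\<close>. The value \<open>s\<close> at the base point is prescribed
  because the offset of a pair depends on the lifts chosen.\<close>

lemma lift:
  assumes Y: "curve Y" "holomorphic_map Y X p" "(U, \<phi>) \<in> atlas Y" "y \<in> U" and s: "p y = \<pi> s"
  obtains r \<sigma> where "r > 0" "ball (\<phi> y) r \<subseteq> \<phi> ` U" "\<sigma> holomorphic_on ball (\<phi> y) r"
    "\<sigma> (\<phi> y) = s" "\<And>\<zeta>. \<zeta> \<in> ball (\<phi> y) r \<Longrightarrow> \<pi> (\<sigma> \<zeta>) = p (inv_into U \<phi> \<zeta>)"
proof -
  note cY = curve_chart[OF Y(1,3)]
  have yY: "y \<in> points Y" using cY Y by auto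
  obtain V \<psi> where V: "(V, \<psi>) \<in> atlas X" "\<pi> s \<in> V" using curve_chart_at[OF curve in_points] .
  note cX = curve_chart[OF curve V(1)]
  obtain r where r: "r > 0" "ball s r \<subseteq> \<pi> -` V" "inj_on (\<lambda>z. \<psi> (\<pi> z)) (ball s r)"
    using chart_local_injective[OF V] .
  define G where "G = (\<lambda>z. \<psi> (\<pi> z))"
  have G: "G holomorphic_on ball s r"
    using holomorphic[OF V(1)] r(2) holomorphic_on_subset unfolding G_def by blast
  have Ginj: "inj_on G (ball s r)" using r(3) unfolding G_def .
  obtain k where k: "k holomorphic_on G ` ball s r" "\<And>z. z \<in> ball s r \<Longrightarrow> k (G z) = z"
    using holomorphic_has_inverse[OF G open_ball Ginj] by metis
  have oG: "open (G ` ball s r)" using open_mapping_thm3[OF G open_ball Ginj] .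
  define D where "D = \<phi> ` {x \<in> U. p x \<in> V}"
  define P where "P = (\<lambda>\<zeta>. \<psi> (p (inv_into U \<phi> \<zeta>)))"
  have contp: "continuous_map (top_of Y) (top_of X) p"
    using Y(2) unfolding holomorphic_map_def by auto
  have "openin (top_of Y) {x \<in> points Y. p x \<in> V}"
    using openin_continuous_map_preimage[OF contp cX(1)] .
  then have "openin (top_of Y) (U \<inter> {x \<in> points Y. p x \<in> V})" using cY(1) by blast
  moreover have "U \<inter> {x \<in> points Y. p x \<in> V} = {x \<in> U. p x \<in> V}" using cY(4) by auto
  ultimately have oD: "open D"
    unfolding D_def using open_chart_image[OF Y(1,3)] by simp
  have P: "P holomorphic_on D"
    using Y(2,3) V(1) unfolding holomorphic_map_def P_def D_def by fast
  have yD: "\<phi> y \<in> D" unfolding D_def using Y(4) s V(2) by auto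
  have invy: "inv_into U \<phi> (\<phi> y) = y" using cY(3) Y(4) by simp
  have "open (D \<inter> P -` (G ` ball s r))"
    using continuous_open_preimage[OF holomorphic_on_imp_continuous_on[OF P] oD oG] .
  moreover have "\<phi> y \<in> D \<inter> P -` (G ` ball s r)"
    using yD invy s r(1) by (auto simp: P_def G_def)
  ultimately obtain t where t: "t > 0" "ball (\<phi> y) t \<subseteq> D \<inter> P -` (G ` ball s r)"
    using open_contains_ball by blast
  define \<sigma> where "\<sigma> = k \<circ> P"
  have "\<sigma> holomorphic_on ball (\<phi> y) t"
    unfolding \<sigma>_def
    by (rule holomorphic_on_compose_gen[of _ _ _ "G ` ball s r"])
      (use t(2) P k(1) holomorphic_on_subset in auto)
  moreover have "\<sigma> (\<phi> y) = s"
    using k(2)[of s] r(1) by (simp add: \<sigma>_def P_def invy s G_def)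
  moreover have "\<pi> (\<sigma> \<zeta>) = p (inv_into U \<phi> \<zeta>)" if "\<zeta> \<in> ball (\<phi> y) t" for \<zeta>
  proof -
    have z: "\<zeta> \<in> D" "P \<zeta> \<in> G ` ball s r" using that t(2) by auto
    then obtain w where w: "w \<in> ball s r" "P \<zeta> = G w" by auto
    have "\<sigma> \<zeta> = w" using w k(2) by (simp add: \<sigma>_def)
    moreover have "p (inv_into U \<phi> \<zeta>) \<in> V" using z(1) cY(3) unfolding D_def by auto
    moreover have "\<pi> w \<in> V" using w(1) r(2) by auto
    ultimately show ?thesis using w(2) cX(3) unfolding P_def G_def by (auto dest: inj_onD)
  qed
  moreover have "ball (\<phi> y) t \<subseteq> \<phi> ` U" using t(2) unfolding D_def by auto
  ultimately show ?thesis using that t(1) by blast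
qed

text \<open>A section of \<pi> is a lift of the identity of \<open>X\<close>.\<close>

lemma local_section:
  assumes "(U, \<phi>) \<in> atlas X" "\<pi> s \<in> U"
  obtains r \<sigma> where "r > 0" "ball (\<phi> (\<pi> s)) r \<subseteq> \<phi> ` U" "\<sigma> holomorphic_on ball (\<phi> (\<pi> s)) r"
    "\<sigma> (\<phi> (\<pi> s)) = s" "\<And>\<zeta>. \<zeta> \<in> ball (\<phi> (\<pi> s)) r \<Longrightarrow> \<pi> (\<sigma> \<zeta>) = inv_into U \<phi> \<zeta>"
  by (rule lift[OF curve holomorphic_map_id[OF curve] assms refl]) (rule that)

text \<open>The coordinates that a local section sends into \<open>T\<close> form an open set, and
  the points with these coordinates lie in the image.\<close>

lemma openin_image:
  assumes "open T"
  shows "openin (top_of X) (\<pi> ` T)"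
proof (subst openin_subopen, intro ballI)
  fix x assume "x \<in> \<pi> ` T"
  then obtain s where s: "s \<in> T" "x = \<pi> s" by auto
  obtain U \<phi> where U: "(U, \<phi>) \<in> atlas X" "\<pi> s \<in> U" using curve_chart_at[OF curve in_points] .
  obtain r \<sigma> where r: "r > 0" "\<sigma> holomorphic_on ball (\<phi> (\<pi> s)) r"
    "\<sigma> (\<phi> (\<pi> s)) = s" "\<And>\<zeta>. \<zeta> \<in> ball (\<phi> (\<pi> s)) r \<Longrightarrow> \<pi> (\<sigma> \<zeta>) = inv_into U \<phi> \<zeta>"
    using local_section[OF U] by metis
  define B where "B = ball (\<phi> (\<pi> s)) r \<inter> \<sigma> -` T"
  have "open B"
    unfolding B_def
    using continuous_open_preimage[OF holomorphic_on_imp_continuous_on[OF r(2)] open_ball assms] .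
  then have "openin (top_of X) {x \<in> U. \<phi> x \<in> B}" using openin_chart_vimage[OF curve U(1)] by simp
  moreover have "x \<in> {x \<in> U. \<phi> x \<in> B}" using s U r unfolding B_def by auto
  moreover have "{x \<in> U. \<phi> x \<in> B} \<subseteq> \<pi> ` T"
  proof
    fix x' assume x': "x' \<in> {x \<in> U. \<phi> x \<in> B}"
    then have "\<pi> (\<sigma> (\<phi> x')) = x'"
      using r(4)[of "\<phi> x'"] curve_chart(3)[OF curve U(1)] unfolding B_def by simp
    then show "x' \<in> \<pi> ` T" using x' unfolding B_def by force
  qed
  ultimately show "\<exists>T'. openin (top_of X) T' \<and> x \<in> T' \<and> T' \<subseteq> \<pi> ` T" by blast
qed

text \<open>Compactness of \<open>X\<close> replaces a fundamental parallelogram: the images of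
  finitely many unit discs cover \<open>X\<close>, so \<open>h\<close> takes all its values on a
  compact set and Liouville's theorem applies.\<close>

lemma periodic_entire_constant:
  assumes "h holomorphic_on UNIV" "\<And>z w. \<pi> z = \<pi> w \<Longrightarrow> h z = h w"
  obtains c where "\<And>z. h z = c"
proof -
  have comp: "compact_space (top_of X)" using curve unfolding curve_def by auto
  have "\<exists>\<F>. finite \<F> \<and> \<F> \<subseteq> (\<lambda>z. \<pi> ` ball z 1) ` UNIV \<and> points X \<subseteq> \<Union>\<F>"
  proof (rule compactinD[of "top_of X"])
    show "compactin (top_of X) (points X)" using comp unfolding compact_space_def .
    show "points X \<subseteq> \<Union> (range (\<lambda>z. \<pi> ` ball z 1))"
      using range by (auto simp flip: range)
  qed (auto intro: openin_image)
  then obtain F where F: "finite F" "points X \<subseteq> (\<Union>z\<in>F. \<pi> ` ball z 1)"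
    by (metis finite_subset_image)
  have "bounded (h ` (\<Union>z\<in>F. cball z 1))"
    by (intro compact_imp_bounded compact_continuous_image compact_UN F(1) compact_cball
        holomorphic_on_imp_continuous_on holomorphic_on_subset[OF assms(1)]) auto
  moreover have "range h \<subseteq> h ` (\<Union>z\<in>F. cball z 1)"
  proof
    fix v assume "v \<in> range h"
    then obtain z where z: "v = h z" by auto
    have "\<pi> z \<in> (\<Union>z\<in>F. \<pi> ` ball z 1)" using F(2) in_points by blast
    then obtain a w where "a \<in> F" "w \<in> ball a 1" "\<pi> z = \<pi> w" by blast
    moreover have "v = h w" using z assms(2)[OF \<open>\<pi> z = \<pi> w\<close>] by simp
    moreover have "w \<in> (\<Union>z\<in>F. cball z 1)" using \<open>a \<in> F\<close> \<open>w \<in> ball a 1\<close> ball_subset_cball by blast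
    ultimately show "v \<in> h ` (\<Union>z\<in>F. cball z 1)" by blast
  qed
  ultimately have "bounded (range h)" using bounded_subset by blast
  then have "h constant_on UNIV" by (rule Liouville_theorem[OF assms(1)])
  then show ?thesis using that unfolding constant_on_def by blast
qed

end

section \<open>Holomorphic forms, genus and irreducibility of a uniformized curve\<close>

context uniformized
begin

lemma chart_point:
  assumes "(U, \<phi>) \<in> atlas X" "x \<in> U"
  obtains z where "x = \<pi> z"
  using curve_chart(4)[OF curve assms(1)] assms(2) range by blast

definition pullback :: "('a chart \<Rightarrow> complex \<Rightarrow> complex) \<Rightarrow> 'a chart \<Rightarrow> complex \<Rightarrow> complex" where
  "pullback \<omega> k z = \<omega> k (snd k (\<pi> z)) * deriv (\<lambda>z. snd k (\<pi> z)) z"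

lemma chart_differentiable:
  assumes "(U, \<phi>) \<in> atlas X" "\<pi> z \<in> U"
  shows "(\<lambda>z. \<phi> (\<pi> z)) field_differentiable at z"
proof -
  have "open (\<pi> -` U)" using open_vimage curve_chart(1)[OF curve assms(1)] by blast
  then show ?thesis
    using holomorphic[OF assms(1)] assms(2) holomorphic_on_imp_differentiable_at by blast
qed

lemma deriv_chart_periodic:
  assumes "\<pi> z = \<pi> w"
  shows "deriv (\<lambda>z. \<phi> (\<pi> z)) z = deriv (\<lambda>z. \<phi> (\<pi> z)) w"
proof -
  have "\<pi> (u + (z - w)) = \<pi> u" for u using assms fibre by simp
  then have *: "(\<lambda>u. \<phi> (\<pi> (u + (z - w)))) = (\<lambda>u. \<phi> (\<pi> u))" by simp
  show ?thesis
    using DERIV_shift[of "\<lambda>u. \<phi> (\<pi> u)" _ w "z - w"] unfolding * deriv_def by simp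
qed

lemma deriv_chart_change:
  assumes "(U, \<phi>) \<in> atlas X" "\<pi> z \<in> U" "(V, \<psi>) \<in> atlas X" "\<pi> z \<in> V"
  shows "deriv (\<lambda>z. \<psi> (\<pi> z)) z =
    deriv (\<lambda>z. \<psi> (inv_into U \<phi> z)) (\<phi> (\<pi> z)) * deriv (\<lambda>z. \<phi> (\<pi> z)) z"
proof -
  note cU = curve_chart[OF curve assms(1)] and cV = curve_chart[OF curve assms(3)]
  have o: "open (\<phi> ` (U \<inter> V))"
    using open_chart_image[OF curve assms(1)] cU(1) cV(1) by blast
  have "(\<lambda>z. \<psi> (inv_into U \<phi> z)) field_differentiable at (\<phi> (\<pi> z))"
    using curve_transition[OF curve assms(1,3)] o assms
    by (auto intro: holomorphic_on_imp_differentiable_at)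
  from deriv_chain[OF chart_differentiable[OF assms(1,2)] this]
  have "deriv ((\<lambda>z. \<psi> (inv_into U \<phi> z)) \<circ> (\<lambda>z. \<phi> (\<pi> z))) z =
    deriv (\<lambda>z. \<psi> (inv_into U \<phi> z)) (\<phi> (\<pi> z)) * deriv (\<lambda>z. \<phi> (\<pi> z)) z" .
  moreover have "deriv ((\<lambda>z. \<psi> (inv_into U \<phi> z)) \<circ> (\<lambda>z. \<phi> (\<pi> z))) z = deriv (\<lambda>z. \<psi> (\<pi> z)) z"
  proof (rule deriv_cong_ev)
    have "\<forall>\<^sub>F w in nhds z. w \<in> \<pi> -` U"
      using open_vimage[OF cU(1)] assms(2) by (intro eventually_nhds_in_open) auto
    then show "\<forall>\<^sub>F w in nhds z. ((\<lambda>z. \<psi> (inv_into U \<phi> z)) \<circ> (\<lambda>z. \<phi> (\<pi> z))) w = \<psi> (\<pi> w)"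
      by eventually_elim (use cU(3) in auto)
  qed simp
  ultimately show ?thesis by simp
qed

text \<open>The form \<open>dz\<close> of the plane, descended to \<open>X\<close>. Its coefficient
  in the coordinate \<open>\<zeta> = \<phi> (\<pi> z)\<close> is \<open>dz/d\<zeta>\<close>; by
  periodicity any \<open>z\<close> above the point gives the same value.\<close>

definition invariant_form :: "'a chart \<Rightarrow> complex \<Rightarrow> complex" where
  "invariant_form k \<zeta> =
    (if k \<in> atlas X \<and> \<zeta> \<in> snd k ` fst k
     then 1 / deriv (\<lambda>z. snd k (\<pi> z)) (SOME z. \<pi> z = inv_into (fst k) (snd k) \<zeta>) else 0)"

lemma invariant_form_chart:
  assumes "(U, \<phi>) \<in> atlas X" "\<pi> z \<in> U"
  shows "invariant_form (U, \<phi>) (\<phi> (\<pi> z)) = 1 / deriv (\<lambda>z. \<phi> (\<pi> z)) z"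
proof -
  have "inv_into U \<phi> (\<phi> (\<pi> z)) = \<pi> z" using curve_chart(3)[OF curve assms(1)] assms(2) by simp
  moreover have "\<pi> (SOME w. \<pi> w = \<pi> z) = \<pi> z" by (rule someI) (rule refl)
  ultimately show ?thesis
    using assms deriv_chart_periodic[of "SOME w. \<pi> w = \<pi> z" z] by (simp add: invariant_form_def)
qed

text \<open>By the chain rule the coefficient is the derivative of a local section of \<pi>.\<close>

lemma invariant_form_holomorphic:
  assumes "(U, \<phi>) \<in> atlas X"
  shows "invariant_form (U, \<phi>) holomorphic_on \<phi> ` U"
proof -
  note cU = curve_chart[OF curve assms(1)]
  have "invariant_form (U, \<phi>) field_differentiable at \<zeta>" if \<zeta>: "\<zeta> \<in> \<phi> ` U" for \<zeta>
  proof -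
    obtain x where x: "x \<in> U" "\<zeta> = \<phi> x" using \<zeta> by auto
    then obtain s where s: "x = \<pi> s" using chart_point[OF assms] by blast
    obtain r \<sigma> where r: "r > 0" "ball (\<phi> (\<pi> s)) r \<subseteq> \<phi> ` U" "\<sigma> holomorphic_on ball (\<phi> (\<pi> s)) r"
      "\<sigma> (\<phi> (\<pi> s)) = s" "\<And>\<zeta>. \<zeta> \<in> ball (\<phi> (\<pi> s)) r \<Longrightarrow> \<pi> (\<sigma> \<zeta>) = inv_into U \<phi> \<zeta>"
      using local_section[OF assms] x s by metis
    define B where "B = ball (\<phi> (\<pi> s)) r"
    have eq: "invariant_form (U, \<phi>) \<eta> = deriv \<sigma> \<eta>" if \<eta>: "\<eta> \<in> B" for \<eta>
    proof -
      have "\<pi> (\<sigma> \<eta>) = inv_into U \<phi> \<eta>" "\<eta> \<in> \<phi> ` U" using r(2,5) \<eta> unfolding B_def by auto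
      then have U: "\<pi> (\<sigma> \<eta>) \<in> U" "\<phi> (\<pi> (\<sigma> \<eta>)) = \<eta>"
        by (auto simp: inv_into_into f_inv_into_f)
      have "deriv ((\<lambda>z. \<phi> (\<pi> z)) \<circ> \<sigma>) \<eta> = deriv (\<lambda>z. \<phi> (\<pi> z)) (\<sigma> \<eta>) * deriv \<sigma> \<eta>"
        using r(3) \<eta> unfolding B_def
        by (intro deriv_chain chart_differentiable[OF assms U(1)])
          (auto intro: holomorphic_on_imp_differentiable_at)
      moreover have "deriv ((\<lambda>z. \<phi> (\<pi> z)) \<circ> \<sigma>) \<eta> = deriv (\<lambda>\<eta>. \<eta>) \<eta>"
      proof (rule deriv_cong_ev)
        have "\<forall>\<^sub>F w in nhds \<eta>. w \<in> B"
          using \<eta> unfolding B_def by (intro eventually_nhds_in_open) auto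
        then show "\<forall>\<^sub>F w in nhds \<eta>. ((\<lambda>z. \<phi> (\<pi> z)) \<circ> \<sigma>) w = w"
          by eventually_elim (use r(2,5) in \<open>auto simp: B_def f_inv_into_f subset_iff\<close>)
      qed simp
      ultimately have "deriv (\<lambda>z. \<phi> (\<pi> z)) (\<sigma> \<eta>) * deriv \<sigma> \<eta> = 1" by simp
      moreover have "invariant_form (U, \<phi>) \<eta> = 1 / deriv (\<lambda>z. \<phi> (\<pi> z)) (\<sigma> \<eta>)"
        using invariant_form_chart[OF assms U(1)] U(2) by simp
      ultimately show ?thesis by (metis nonzero_mult_div_cancel_left mult_zero_left zero_neq_one)
    qed
    have "deriv \<sigma> holomorphic_on B" using r(3) unfolding B_def by (intro holomorphic_deriv) auto
    then have "invariant_form (U, \<phi>) holomorphic_on B" using eq holomorphic_cong by metis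
    then show ?thesis
      using x s r(1) unfolding B_def by (auto intro: holomorphic_on_imp_differentiable_at)
  qed
  then show ?thesis
    by (auto simp: holomorphic_on_def intro: field_differentiable_at_within)
qed

lemma invariant_form_in_forms: "invariant_form \<in> holomorphic_forms X"
proof -
  have "invariant_form (U, \<phi>) (\<phi> x) =
      invariant_form (V, \<psi>) (\<psi> x) * deriv (\<lambda>z. \<psi> (inv_into U \<phi> z)) (\<phi> x)"
    if U: "(U, \<phi>) \<in> atlas X" and V: "(V, \<psi>) \<in> atlas X" and x: "x \<in> U \<inter> V" for U \<phi> V \<psi> x
  proof -
    obtain z where z: "x = \<pi> z" using x chart_point[OF U] by blast
    then have zz: "\<pi> z \<in> U" "\<pi> z \<in> V" using x by auto
    show ?thesis
      unfolding z invariant_form_chart[OF U zz(1)] invariant_form_chart[OF V zz(2)]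
        deriv_chart_change[OF U zz(1) V zz(2)]
      using deriv_chart_change[OF U zz(1) V zz(2)] deriv_chart_nonzero[OF V zz(2)] by simp
  qed
  moreover have "invariant_form (U, \<phi>) z = 0"
    if "\<not> ((U, \<phi>) \<in> atlas X \<and> z \<in> \<phi> ` U)" for U \<phi> z
    using that by (auto simp: invariant_form_def)
  ultimately show ?thesis
    using invariant_form_holomorphic unfolding holomorphic_forms_def by blast
qed

text \<open>The coefficient \<open>h\<close> of \<open>dz\<close> in the pullback of \<omega> is
  entire and has the periods \<open>L\<close>, so it is constant.\<close>

lemma form_eq_scale_invariant_form:
  assumes "\<omega> \<in> holomorphic_forms X"
  obtains c where "\<omega> = scale_form c invariant_form"
proof -
  note forms = assms[unfolded holomorphic_forms_def mem_Collect_eq]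
  have hol: "\<omega> (U, \<phi>) holomorphic_on \<phi> ` U" if "(U, \<phi>) \<in> atlas X" for U \<phi>
    using bspec[OF conjunct1[OF forms] that] by simp
  have comp: "\<omega> (U, \<phi>) (\<phi> x) = \<omega> (V, \<psi>) (\<psi> x) * deriv (\<lambda>z. \<psi> (inv_into U \<phi> z)) (\<phi> x)"
    if "(U, \<phi>) \<in> atlas X" "(V, \<psi>) \<in> atlas X" "x \<in> U \<inter> V" for U \<phi> V \<psi> x
    using bspec[OF conjunct1[OF conjunct2[OF forms]] that(1)] that(2,3) by fast
  have zero: "\<omega> (U, \<phi>) z = 0" if "\<not> ((U, \<phi>) \<in> atlas X \<and> z \<in> \<phi> ` U)" for U \<phi> z
    using conjunct2[OF conjunct2[OF forms]] that by blast
  \<comment> \<open>An arbitrary chart is chosen at each point; the next claim shows that the value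
    does not depend on it.\<close>
  define h where "h z = pullback \<omega> (SOME k. k \<in> atlas X \<and> \<pi> z \<in> fst k) z" for z
  have h: "h z = \<omega> (U, \<phi>) (\<phi> (\<pi> z)) * deriv (\<lambda>z. \<phi> (\<pi> z)) z"
    if U: "(U, \<phi>) \<in> atlas X" "\<pi> z \<in> U" for z U \<phi>
  proof -
    define k where "k = (SOME k. k \<in> atlas X \<and> \<pi> z \<in> fst k)"
    have "k \<in> atlas X \<and> \<pi> z \<in> fst k" unfolding k_def by (rule someI[of _ "(U, \<phi>)"]) (use U in simp)
    then obtain V \<psi> where V: "k = (V, \<psi>)" "(V, \<psi>) \<in> atlas X" "\<pi> z \<in> V" by (cases k) auto
    have "h z = \<omega> (V, \<psi>) (\<psi> (\<pi> z)) * deriv (\<lambda>z. \<psi> (\<pi> z)) z"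
      unfolding h_def k_def[symmetric] V(1) pullback_def by simp
    also have "\<dots> = \<omega> (U, \<phi>) (\<phi> (\<pi> z)) * deriv (\<lambda>z. \<phi> (\<pi> z)) z"
      using comp[OF U(1) V(2), of "\<pi> z"] deriv_chart_change[OF U V(2,3)] U V by simp
    finally show ?thesis .
  qed
  have "h field_differentiable at z" for z
  proof -
    obtain U \<phi> where U: "(U, \<phi>) \<in> atlas X" "\<pi> z \<in> U" using curve_chart_at[OF curve in_points] .
    have o: "open (\<pi> -` U)" using open_vimage curve_chart(1)[OF curve U(1)] by blast
    have "(\<lambda>z. \<omega> (U, \<phi>) (\<phi> (\<pi> z))) holomorphic_on \<pi> -` U"
      by (rule holomorphic_on_compose_gen[OF holomorphic[OF U(1)] hol[OF U(1)], unfolded o_def]) auto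
    then have "(\<lambda>z. \<omega> (U, \<phi>) (\<phi> (\<pi> z)) * deriv (\<lambda>z. \<phi> (\<pi> z)) z) holomorphic_on \<pi> -` U"
      using holomorphic_deriv[OF holomorphic[OF U(1)] o] by (intro holomorphic_on_mult)
    then have "h holomorphic_on \<pi> -` U" 
      by (rule holomorphic_transform) (simp add: h[OF U(1)])
    then show ?thesis using o U(2) by (auto intro: holomorphic_on_imp_differentiable_at)
  qed
  then have hh: "h holomorphic_on UNIV" by (auto simp: holomorphic_on_def)
  have "h z = h w" if "\<pi> z = \<pi> w" for z w
  proof -
    obtain U \<phi> where U: "(U, \<phi>) \<in> atlas X" "\<pi> z \<in> U" using curve_chart_at[OF curve in_points] .
    then show ?thesis using h[of U \<phi>] that deriv_chart_periodic[OF that] by simp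
  qed
  then obtain c where c: "\<And>z. h z = c" using periodic_entire_constant[OF hh] by metis
  have "\<omega> (U, \<phi>) \<zeta> = c * invariant_form (U, \<phi>) \<zeta>" for U \<phi> \<zeta>
  proof (cases "(U, \<phi>) \<in> atlas X \<and> \<zeta> \<in> \<phi> ` U")
    case True
    then obtain x where x: "x \<in> U" "\<zeta> = \<phi> x" by auto
    obtain z where z: "x = \<pi> z" using x chart_point True by blast
    have U: "(U, \<phi>) \<in> atlas X" "\<pi> z \<in> U" using True x z by auto
    show ?thesis
      using h[OF U] invariant_form_chart[OF U] deriv_chart_nonzero[OF U] c[of z] x z by simp
  next
    case False
    then show ?thesis using zero[OF False] unfolding invariant_form_def by auto
  qed
  then have "\<omega> = scale_form c invariant_form" by (auto simp: scale_form_def fun_eq_iff)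
  then show ?thesis using that by blast
qed

lemma invariant_form_nonzero: "invariant_form \<noteq> 0"
proof -
  obtain U \<phi> where U: "(U, \<phi>) \<in> atlas X" "\<pi> 0 \<in> U" using curve_chart_at[OF curve in_points] .
  have "invariant_form (U, \<phi>) (\<phi> (\<pi> 0)) \<noteq> 0"
    using invariant_form_chart[OF U] deriv_chart_nonzero[OF U] by simp
  then show ?thesis by (auto simp: fun_eq_iff)
qed

lemma genus_eq_1: "genus X = 1"
proof -
  interpret V: vector_space "scale_form :: complex \<Rightarrow> ('a chart \<Rightarrow> complex \<Rightarrow> complex) \<Rightarrow> _"
    by (rule vector_space_scale_form)
  have "holomorphic_forms X \<subseteq> V.span {invariant_form}"
    using form_eq_scale_invariant_form by (metis V.span_base V.span_scale singletonI subsetI)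
  then show ?thesis
    unfolding genus_def
    by (intro V.dim_unique[of "{invariant_form}"])
      (use invariant_form_in_forms invariant_form_nonzero in auto)
qed

text \<open>In the plane, the interior of the preimage of \<open>A\<close> is closed by the identity
  theorem, hence empty or everything. It is nonempty as soon as \<open>B\<close> misses a point,
  because the preimage of \<open>B\<close> is closed.\<close>

lemma irreducible: "irreducible_curve X"
  unfolding irreducible_curve_def
proof (intro conjI allI impI)
  show "points X \<noteq> {}" using in_points by blast
next
  fix A B assume AB: "analytic_subset X A \<and> analytic_subset X B \<and> A \<union> B = points X"
  have local_zero_set: "\<exists>r>0. \<exists>H. finite H \<and> (\<forall>h\<in>H. h holomorphic_on ball z r) \<and>
      \<pi> -` B \<inter> ball z r = {w \<in> ball z r. \<forall>h\<in>H. h w = 0}" if B: "analytic_subset X B" for B z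
  proof -
    from bspec[OF conjunct2[OF B[unfolded analytic_subset_def]] in_points[of z]]
    obtain W H where W: "openin (top_of X) W" "\<pi> z \<in> W" "finite H"
      "\<forall>h \<in> H. holomorphic_function_on X W h" "B \<inter> W = {y \<in> W. \<forall>h \<in> H. h y = 0}"
      by (elim exE conjE)
    obtain U \<phi> where U: "(U, \<phi>) \<in> atlas X" "\<pi> z \<in> U" using curve_chart_at[OF curve in_points] .
    note cU = curve_chart[OF curve U(1)]
    have "open (\<pi> -` (U \<inter> W))" using open_vimage cU(1) W(1) by blast
    moreover have "z \<in> \<pi> -` (U \<inter> W)" using U W by auto
    ultimately obtain r where r: "r > 0" "ball z r \<subseteq> \<pi> -` (U \<inter> W)"
      using open_contains_ball by blast
    have "(\<lambda>w. h (\<pi> w)) holomorphic_on ball z r" if "h \<in> H" for h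
    proof -
      have "(\<lambda>z. h (inv_into U \<phi> z)) holomorphic_on \<phi> ` (U \<inter> W)"
        using W(4) that U(1) unfolding holomorphic_function_on_def by fast
      moreover have "(\<lambda>z. \<phi> (\<pi> z)) holomorphic_on ball z r"
        using holomorphic[OF U(1)] r(2) holomorphic_on_subset by blast
      ultimately have "(\<lambda>w. h (inv_into U \<phi> (\<phi> (\<pi> w)))) holomorphic_on ball z r"
        using holomorphic_on_compose_gen[of "\<lambda>z. \<phi> (\<pi> z)" "ball z r"
            "\<lambda>z. h (inv_into U \<phi> z)" "\<phi> ` (U \<inter> W)"] r(2)
        by (auto simp: o_def)
      then show ?thesis
        by (rule holomorphic_transform) (use r(2) cU(3) in auto)
    qed
    moreover have "\<pi> -` B \<inter> ball z r = {w \<in> ball z r. \<forall>h\<in>H. h (\<pi> w) = 0}"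
      using W(5) r(2) by blast
    ultimately show ?thesis
      using W(3) r(1) by (intro exI[of _ r] conjI exI[of _ "(\<lambda>h w. h (\<pi> w)) ` H"]) auto
  qed
  have closed: "closed (\<pi> -` A)" if A: "analytic_subset X A" for A
    unfolding closed_def
  proof (subst open_subopen, intro ballI)
    fix z assume z: "z \<in> - \<pi> -` A"
    from local_zero_set[OF A, of z]
    obtain r H where r: "r > 0" "finite H" "\<forall>h\<in>H. h holomorphic_on ball z r"
      "\<pi> -` A \<inter> ball z r = {w \<in> ball z r. \<forall>h\<in>H. h w = 0}"
      by (elim exE conjE)
    have "z \<notin> {w \<in> ball z r. \<forall>h\<in>H. h w = 0}" using z r(4) by auto
    then obtain h where h: "h \<in> H" "h z \<noteq> 0" using r(1) by auto
    have "open (ball z r \<inter> h -` (- {0}))"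
      using r(3) h(1) by (intro continuous_open_preimage holomorphic_on_imp_continuous_on) auto
    then show "\<exists>T. open T \<and> z \<in> T \<and> T \<subseteq> - \<pi> -` A"
      using h r(1,4) by (intro exI[of _ "ball z r \<inter> h -` (- {0})"]) auto
  qed
  show "A = points X \<or> B = points X"
  proof (rule disjCI)
    assume "B \<noteq> points X"
    then obtain x where "x \<in> points X" "x \<notin> B" using AB unfolding analytic_subset_def by blast
    then have "- \<pi> -` B \<noteq> {}" unfolding range[symmetric] by blast
    moreover have "- \<pi> -` B \<subseteq> \<pi> -` A" using AB in_points by blast
    then have "- \<pi> -` B \<subseteq> interior (\<pi> -` A)"
      using closed[of B] AB by (intro interior_maximal) (simp_all add: closed_def)
    ultimately have ne: "interior (\<pi> -` A) \<noteq> {}" by blast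
    have "closure (interior (\<pi> -` A)) \<subseteq> interior (\<pi> -` A)"
    proof
      fix z assume z: "z \<in> closure (interior (\<pi> -` A))"
      from local_zero_set[OF conjunct1[OF AB], of z]
      obtain r H where r: "r > 0" "finite H" "\<forall>h\<in>H. h holomorphic_on ball z r"
        "\<pi> -` A \<inter> ball z r = {w \<in> ball z r. \<forall>h\<in>H. h w = 0}"
        by (elim exE conjE)
      \<comment> \<open>Near a boundary point the local equations of \<open>A\<close> vanish on the
        nonempty open set \<open>T\<close>, hence on the whole ball.\<close>
      define T where "T = interior (\<pi> -` A) \<inter> ball z r"
      have T: "open T" "T \<noteq> {}" "T \<subseteq> ball z r"
        using z centre_in_ball[of z r] r(1)
          open_Int_closure_eq_empty[OF open_ball, of z r "interior (\<pi> -` A)"]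
        unfolding T_def by blast+
      have "h w = 0" if "h \<in> H" "w \<in> ball z r" for h w
      proof -
        obtain t where t: "t \<in> T" using T(2) by auto
        have "t islimpt T" using T(1) t by (simp add: interior_limit_point interior_open)
        moreover have "h u = 0" if "u \<in> T" for u
          using that \<open>h \<in> H\<close> r(4) interior_subset[of "\<pi> -` A"] unfolding T_def by blast
        ultimately show ?thesis
          using analytic_continuation[of h "ball z r" T t w] r(3) that T t by auto
      qed
      then have "ball z r \<subseteq> \<pi> -` A" using r(4) by blast
      then show "z \<in> interior (\<pi> -` A)" using r(1) by (meson centre_in_ball interiorI open_ball)
    qed
    then have "closed (interior (\<pi> -` A))" by (simp add: closure_subset_eq)
    then have "interior (\<pi> -` A) = UNIV" using ne open_interior clopen by metis
    then have "\<pi> -` A = UNIV" using interior_subset by blast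
    then have "points X \<subseteq> A" unfolding range[symmetric] by blast
    then show "A = points X" using AB by blast
  qed
qed

end

text \<open>A clopen set is analytic: it is given by no equation near its own points and by the
  equation \<open>1 = 0\<close> near the others. So a separation is a decomposition into analytic
  subsets.\<close>

lemma irreducible_curve_imp_connected:
  assumes "irreducible_curve X"
  shows "connected_space (top_of X)"
  unfolding connected_space_def
proof (rule notI, elim exE conjE)
  fix A B assume AB: "openin (top_of X) A" "openin (top_of X) B" "points X \<subseteq> A \<union> B"
    "A \<inter> B = {}" "A \<noteq> {}" "B \<noteq> {}"
  have "analytic_subset X A" if "openin (top_of X) A" "openin (top_of X) B" "points X \<subseteq> A \<union> B"
    "A \<inter> B = {}" for A B
    unfolding analytic_subset_def
  proof (intro conjI ballI)
    show "A \<subseteq> points X" using openin_subset[OF that(1)] .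
    fix x assume x: "x \<in> points X"
    show "\<exists>W H. openin (top_of X) W \<and> x \<in> W \<and> finite H \<and>
        (\<forall>h \<in> H. holomorphic_function_on X W h) \<and> A \<inter> W = {y \<in> W. \<forall>h \<in> H. h y = 0}"
    proof (cases "x \<in> A")
      case True
      then show ?thesis using that by (intro exI[of _ A] exI[of _ "{}"]) auto
    next
      case False
      then show ?thesis
        using that x
        by (intro exI[of _ B] exI[of _ "{\<lambda>_. 1}"]) (auto simp: holomorphic_function_on_def)
    qed
  qed
  then have "analytic_subset X A" "analytic_subset X B" using AB by (auto simp: Un_commute Int_commute)
  moreover have "A \<union> B = points X" using AB openin_subset by blast
  ultimately have "A = points X \<or> B = points X" using assms unfolding irreducible_curve_def by blast
  then show False using AB openin_subset by blast
qed

section \<open>Holomorphic maps between uniformized curves\<close>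

lemma affine_lift_holomorphic_map:
  assumes "uniformized X L \<pi>" "uniformized X' L' \<pi>'" "\<And>z. h (\<pi> z) = \<pi>' (c * z + d)"
  shows "holomorphic_map X X' h"
proof -
  interpret X: uniformized X L \<pi> by fact
  interpret X': uniformized X' L' \<pi>' by fact
  have "openin (top_of X) {x \<in> points X. h x \<in> W}" if W: "openin (top_of X') W" for W
  proof -
    \<comment> \<open>The preimage is formed in the plane and brought back to \<open>X\<close> by
      \<pi>, which is open.\<close>
    have "{x \<in> points X. h x \<in> W} = \<pi> ` ((\<lambda>z. c * z + d) -` (\<pi>' -` W))"
      using assms(3) by (auto simp flip: X.range)
    moreover have "open ((\<lambda>z. c * z + d) -` (\<pi>' -` W))"
      by (intro open_vimage X'.open_vimage W continuous_intros)
    ultimately show ?thesis using X.openin_image by simp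
  qed
  moreover have "h ` points X \<subseteq> points X'" using assms(3) by (auto simp flip: X.range)
  ultimately have cont: "continuous_map (top_of X) (top_of X') h"
    unfolding continuous_map_def by blast
  have "(\<lambda>z. \<psi> (h (inv_into U \<phi> z))) holomorphic_on \<phi> ` {x \<in> U. h x \<in> V}"
    if U: "(U, \<phi>) \<in> atlas X" and V: "(V, \<psi>) \<in> atlas X'" for U \<phi> V \<psi>
  proof -
    note cU = curve_chart[OF X.curve U] and cV = curve_chart[OF X'.curve V]
    have "(\<lambda>z. \<psi> (h (inv_into U \<phi> z))) field_differentiable at \<zeta>"
      if \<zeta>: "\<zeta> \<in> \<phi> ` {x \<in> U. h x \<in> V}" for \<zeta>
    proof -
      obtain x where x: "x \<in> U" "h x \<in> V" "\<zeta> = \<phi> x" using \<zeta> by auto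
      then obtain s where s: "x = \<pi> s" using X.chart_point[OF U] by blast
      then obtain r \<sigma> where r: "r > 0" "ball \<zeta> r \<subseteq> \<phi> ` U" "\<sigma> holomorphic_on ball \<zeta> r"
        "\<sigma> \<zeta> = s" "\<And>\<zeta>'. \<zeta>' \<in> ball \<zeta> r \<Longrightarrow> \<pi> (\<sigma> \<zeta>') = inv_into U \<phi> \<zeta>'"
        using X.local_section[OF U] x by metis
      have "open (ball \<zeta> r \<inter> (\<lambda>z. c * \<sigma> z + d) -` (\<pi>' -` V))"
        using r(3)
        by (intro continuous_open_preimage X'.open_vimage cV(1) continuous_intros
            holomorphic_on_imp_continuous_on) auto
      moreover have hol: "(\<lambda>z. \<psi> (\<pi>' (c * \<sigma> z + d))) holomorphic_on
          (ball \<zeta> r \<inter> (\<lambda>z. c * \<sigma> z + d) -` (\<pi>' -` V))"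
        by (rule holomorphic_on_compose_gen[OF _ X'.holomorphic[OF V], unfolded o_def])
          (auto intro!: holomorphic_intros holomorphic_on_subset[OF r(3)])
      have "(\<lambda>z. \<psi> (h (inv_into U \<phi> z))) holomorphic_on
          (ball \<zeta> r \<inter> (\<lambda>z. c * \<sigma> z + d) -` (\<pi>' -` V))"
        by (rule holomorphic_transform[OF hol]) (simp flip: r(5) assms(3))
      moreover have "\<zeta> \<in> ball \<zeta> r \<inter> (\<lambda>z. c * \<sigma> z + d) -` (\<pi>' -` V)"
        using r(1,4) x s assms(3) by simp
      ultimately show ?thesis by (meson holomorphic_on_imp_differentiable_at)
    qed
    then show ?thesis by (auto simp: holomorphic_on_def intro: field_differentiable_at_within)
  qed
  then show ?thesis using cont unfolding holomorphic_map_def by blast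
qed

text \<open>
  The local lifts of \<open>h \<circ> \<pi>\<close> to the plane differ by constants, so their derivatives glue to a
  periodic entire function.
\<close>

lemma holomorphic_map_affine_lift:
  assumes "uniformized X L \<pi>" "uniformized X' L' \<pi>'" "holomorphic_map X X' h"
  obtains c d where "\<And>z. h (\<pi> z) = \<pi>' (c * z + d)"
proof -
  interpret X: uniformized X L \<pi> by fact
  interpret X': uniformized X' L' \<pi>' by fact
  have hp: "h (\<pi> z) \<in> points X'" for z
    using assms(3) unfolding holomorphic_map_def continuous_map_def by auto
  then have hp': "\<exists>t. h (\<pi> z) = \<pi>' t" for z by (auto simp: image_iff simp flip: X'.range)
  have local_lift: "\<exists>r>0. \<exists>\<tau>. \<tau> holomorphic_on ball z r \<and> (\<forall>w\<in>ball z r. \<pi>' (\<tau> w) = h (\<pi> w)) \<and> \<tau> z = t"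
    if t: "h (\<pi> z) = \<pi>' t" for z t
  proof -
    obtain U \<phi> where U: "(U, \<phi>) \<in> atlas X" "\<pi> z \<in> U" using curve_chart_at[OF X.curve X.in_points] .
    note cU = curve_chart[OF X.curve U(1)]
    obtain r \<sigma> where r: "r > 0" "ball (\<phi> (\<pi> z)) r \<subseteq> \<phi> ` U" "\<sigma> holomorphic_on ball (\<phi> (\<pi> z)) r"
      "\<sigma> (\<phi> (\<pi> z)) = t" "\<And>\<zeta>. \<zeta> \<in> ball (\<phi> (\<pi> z)) r \<Longrightarrow> \<pi>' (\<sigma> \<zeta>) = h (inv_into U \<phi> \<zeta>)"
      using X'.lift[OF X.curve assms(3) U t] by blast
    have "open (\<pi> -` U \<inter> (\<lambda>w. \<phi> (\<pi> w)) -` ball (\<phi> (\<pi> z)) r)"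
      by (intro continuous_open_preimage X.open_vimage cU(1)
          holomorphic_on_imp_continuous_on X.holomorphic[OF U(1)]) auto
    moreover have "z \<in> \<pi> -` U \<inter> (\<lambda>w. \<phi> (\<pi> w)) -` ball (\<phi> (\<pi> z)) r" using U(2) r(1) by simp
    ultimately obtain e where e: "e > 0" "ball z e \<subseteq> \<pi> -` U \<inter> (\<lambda>w. \<phi> (\<pi> w)) -` ball (\<phi> (\<pi> z)) r"
      using open_contains_ball by blast
    have 1: "(\<lambda>w. \<phi> (\<pi> w)) holomorphic_on ball z e"
      using X.holomorphic[OF U(1)] e(2) holomorphic_on_subset by blast
    have "(\<lambda>w. \<sigma> (\<phi> (\<pi> w))) holomorphic_on ball z e"
      by (rule holomorphic_on_compose_gen[OF 1 r(3), unfolded o_def]) (use e(2) in auto)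
    moreover have "\<pi>' (\<sigma> (\<phi> (\<pi> w))) = h (\<pi> w)" if "w \<in> ball z e" for w
    proof -
      have "\<pi> w \<in> U" "\<phi> (\<pi> w) \<in> ball (\<phi> (\<pi> z)) r" using that e(2) by auto
      then show ?thesis using r(5)[of "\<phi> (\<pi> w)"] cU(3) by simp
    qed
    ultimately show ?thesis
      using e(1) r(4) by (intro exI[of _ e] conjI exI[of _ "\<lambda>w. \<sigma> (\<phi> (\<pi> w))"]) auto
  qed
  have ex: "\<exists>r>0. \<exists>\<tau>. \<tau> holomorphic_on ball z r \<and> (\<forall>w\<in>ball z r. \<pi>' (\<tau> w) = h (\<pi> w))" for z
    using hp'[of z] local_lift by blast
  have unique: "deriv \<tau> z = deriv \<tau>' z"
    if "r > 0" "\<tau> holomorphic_on ball z r" "\<forall>w\<in>ball z r. \<pi>' (\<tau> w) = h (\<pi> w)"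
      and "\<tau>' holomorphic_on ball z r" "\<forall>w\<in>ball z r. \<pi>' (\<tau>' w) = h (\<pi> w)" for z r \<tau> \<tau>'
  proof -
    have cont: "continuous_on (ball z r) (\<lambda>w. \<tau> w - \<tau>' w)"
      using \<open>\<tau> holomorphic_on _\<close> \<open>\<tau>' holomorphic_on _\<close>
      by (intro continuous_intros holomorphic_on_imp_continuous_on)
    have mem: "\<tau> w - \<tau>' w \<in> L'" if "w \<in> ball z r" for w
    proof -
      have "\<pi>' (\<tau> w) = \<pi>' (\<tau>' w)"
        using that \<open>\<forall>w\<in>ball z r. \<pi>' (\<tau> w) = h (\<pi> w)\<close> \<open>\<forall>w\<in>ball z r. \<pi>' (\<tau>' w) = h (\<pi> w)\<close>
        by simp
      then show ?thesis by (simp only: X'.fibre)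
    qed
    have "\<tau> w - \<tau>' w = \<tau> z - \<tau>' z" if "w \<in> ball z r" for w
      using discrete_subgroup_constant[OF X'.discrete cont connected_ball mem that, of z] \<open>r > 0\<close> by simp
    then have eq: "\<tau> w = \<tau>' w + (\<tau> z - \<tau>' z)" if "w \<in> ball z r" for w
      using that by (simp add: algebra_simps)
    have "deriv \<tau> z = deriv (\<lambda>w. \<tau>' w + (\<tau> z - \<tau>' z)) z"
    proof (rule deriv_cong_ev)
      have "\<forall>\<^sub>F w in nhds z. w \<in> ball z r" using \<open>r > 0\<close> by (intro eventually_nhds_in_open) auto
      then show "\<forall>\<^sub>F w in nhds z. \<tau> w = \<tau>' w + (\<tau> z - \<tau>' z)" by eventually_elim (rule eq)
    qed simp
    also have "\<dots> = deriv \<tau>' z"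
      using \<open>\<tau>' holomorphic_on _\<close> \<open>r > 0\<close>
      by (subst deriv_add) (auto intro: holomorphic_on_imp_differentiable_at)
    finally show ?thesis .
  qed
  define D where "D z = (SOME v. \<exists>r>0. \<exists>\<tau>. \<tau> holomorphic_on ball z r \<and>
    (\<forall>w\<in>ball z r. \<pi>' (\<tau> w) = h (\<pi> w)) \<and> v = deriv \<tau> z)" for z
  have D: "D z = deriv \<tau> z" if \<tau>: "\<tau> holomorphic_on ball z0 r"
    "\<forall>w\<in>ball z0 r. \<pi>' (\<tau> w) = h (\<pi> w)" "z \<in> ball z0 r" for z z0 r \<tau>
  proof -
    have "\<exists>r>0. \<exists>\<tau>. \<tau> holomorphic_on ball z r \<and>
      (\<forall>w\<in>ball z r. \<pi>' (\<tau> w) = h (\<pi> w)) \<and> D z = deriv \<tau> z"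
      unfolding D_def by (rule someI_ex) (use ex[of z] in blast)
    then obtain r' \<tau>' where \<tau>': "r' > 0" "\<tau>' holomorphic_on ball z r'"
      "\<forall>w\<in>ball z r'. \<pi>' (\<tau>' w) = h (\<pi> w)" "D z = deriv \<tau>' z" by blast
    obtain e where e: "e > 0" "ball z e \<subseteq> ball z0 r" using \<tau>(3) openE[OF open_ball] by metis
    have m: "ball z (min e r') \<subseteq> ball z0 r" "ball z (min e r') \<subseteq> ball z r'" using e(2) by auto
    have "deriv \<tau>' z = deriv \<tau> z"
    proof (rule unique)
      show "min e r' > 0" using e(1) \<tau>'(1) by simp
      show "\<tau>' holomorphic_on ball z (min e r')" using \<tau>'(2) m(2) by (rule holomorphic_on_subset)
      show "\<tau> holomorphic_on ball z (min e r')" using \<tau>(1) m(1) by (rule holomorphic_on_subset)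
      show "\<forall>w\<in>ball z (min e r'). \<pi>' (\<tau>' w) = h (\<pi> w)" using \<tau>'(3) m(2) by blast
      show "\<forall>w\<in>ball z (min e r'). \<pi>' (\<tau> w) = h (\<pi> w)" using \<tau>(2) m(1) by blast
    qed
    then show ?thesis using \<tau>'(4) by simp
  qed
  have "D field_differentiable at z" for z
  proof -
    obtain r \<tau> where r: "r > 0" "\<tau> holomorphic_on ball z r" "\<forall>w\<in>ball z r. \<pi>' (\<tau> w) = h (\<pi> w)"
      using ex by blast
    have "deriv \<tau> holomorphic_on ball z r" using r(2) by (intro holomorphic_deriv) auto
    then have "D holomorphic_on ball z r"
      by (rule holomorphic_transform) (simp add: D[OF r(2,3)])
    then show ?thesis using r(1) by (auto intro: holomorphic_on_imp_differentiable_at)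
  qed
  then have holD: "D holomorphic_on UNIV" by (auto simp: holomorphic_on_def)
  have "D z = D w" if zw: "\<pi> z = \<pi> w" for z w
  proof -
    obtain r \<tau> where r: "r > 0" "\<tau> holomorphic_on ball z r" "\<forall>w\<in>ball z r. \<pi>' (\<tau> w) = h (\<pi> w)"
      using ex by blast
    have per: "\<pi> (u + (z - w)) = \<pi> u" for u using zw X.fibre by simp
    have sh: "u + (z - w) \<in> ball z r" if "u \<in> ball w r" for u
      using that by (simp add: dist_norm algebra_simps)
    have "(\<lambda>u. \<tau> (u + (z - w))) holomorphic_on ball w r"
      by (rule holomorphic_on_compose_gen[OF _ r(2), unfolded o_def])
        (auto intro!: holomorphic_intros sh simp del: mem_ball)
    moreover have "\<forall>u\<in>ball w r. \<pi>' (\<tau> (u + (z - w))) = h (\<pi> u)"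
      using r(3) sh per by metis
    ultimately have "D w = deriv (\<lambda>u. \<tau> (u + (z - w))) w"
      by (rule D) (use r(1) in simp)
    also have "\<dots> = deriv \<tau> z"
      using DERIV_shift[of \<tau> _ w "z - w"] unfolding deriv_def by simp
    also have "\<dots> = D z" using D[OF r(2,3)] r(1) by simp
    finally show ?thesis by simp
  qed
  then obtain c where c: "\<And>z. D z = c" using X.periodic_entire_constant[OF holD] by metis
  have affine: "\<exists>r>0. \<forall>w\<in>ball z r. h (\<pi> w) = \<pi>' (c * w + (t - c * z))" if t: "h (\<pi> z) = \<pi>' t" for z t
  proof -
    obtain r \<tau> where r: "r > 0" "\<tau> holomorphic_on ball z r" "\<forall>w\<in>ball z r. \<pi>' (\<tau> w) = h (\<pi> w)" "\<tau> z = t"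
      using local_lift[OF t] by blast
    have "((\<lambda>w. \<tau> w - c * w) has_field_derivative 0) (at w within ball z r)" if "w \<in> ball z r" for w
    proof -
      have "(\<tau> has_field_derivative deriv \<tau> w) (at w)"
        using r(2) that by (intro holomorphic_derivI) auto
      then have "(\<tau> has_field_derivative c) (at w)" using D[OF r(2,3) that] c by simp
      then have "((\<lambda>w. \<tau> w - c * w) has_field_derivative (c - c)) (at w)"
        by (intro derivative_eq_intros) auto
      then show ?thesis by (simp add: has_field_derivative_at_within)
    qed
    then obtain k where k: "\<And>w. w \<in> ball z r \<Longrightarrow> \<tau> w - c * w = k"
      using has_field_derivative_zero_constant[of "ball z r" "\<lambda>w. \<tau> w - c * w"] by auto
    have "\<tau> w = c * w + (t - c * z)" if "w \<in> ball z r" for w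
      using k[OF that] k[of z] r(1,4) by (simp add: algebra_simps)
    then show ?thesis using r(1,3) by (intro exI[of _ r]) auto
  qed
  obtain d where d: "h (\<pi> 0) = \<pi>' d" using hp'[of 0] by blast
  \<comment> \<open>The slope \<open>c\<close> is already global, but the translation is known only
    locally and modulo \<open>L'\<close>. Its discrepancy from \<open>d\<close> is locally constant,
    so agreement and disagreement are both open conditions.\<close>
  define S where "S = {z. h (\<pi> z) = \<pi>' (c * z + d)}"
  have "open S"
  proof (subst open_subopen, intro ballI)
    fix z assume "z \<in> S"
    then obtain r where "r > 0" "\<forall>w\<in>ball z r. h (\<pi> w) = \<pi>' (c * w + d)"
      using affine[of z "c * z + d"] by (auto simp: S_def)
    then show "\<exists>T. open T \<and> z \<in> T \<and> T \<subseteq> S" by (intro exI[of _ "ball z r"]) (auto simp: S_def)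
  qed
  moreover have "open (- S)"
  proof (subst open_subopen, intro ballI)
    fix z assume z: "z \<in> - S"
    obtain t where t: "h (\<pi> z) = \<pi>' t" using hp'[of z] by blast
    then obtain r where r: "r > 0" "\<forall>w\<in>ball z r. h (\<pi> w) = \<pi>' (c * w + (t - c * z))"
      using affine by blast
    have "t - (c * z + d) \<notin> L'" using z t X'.fibre by (simp add: S_def)
    moreover have "c * w + (t - c * z) - (c * w + d) = t - (c * z + d)" for w by simp
    ultimately have "\<pi>' (c * w + (t - c * z)) \<noteq> \<pi>' (c * w + d)" for w using X'.fibre by metis
    then have "ball z r \<subseteq> - S" using r(2) unfolding S_def by auto
    then show "\<exists>T. open T \<and> z \<in> T \<and> T \<subseteq> - S" using r(1) by (intro exI[of _ "ball z r"]) auto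
  qed
  moreover have "0 \<in> S" using d by (simp add: S_def)
  ultimately have "S = UNIV" using clopen[of S] by (auto simp: closed_def)
  then show ?thesis using that[of c d] by (auto simp: S_def)
qed

text \<open>An isomorphism and its inverse lift to affine maps whose slopes are inverse to each
  other and carry each period group into the other. Conversely, multiplication by \<open>c\<close>
  descends.\<close>

lemma isomorphic_curves_iff_homothetic:
  assumes "uniformized X L \<pi>" "uniformized X' L' \<pi>'"
  shows "isomorphic_curves X X' \<longleftrightarrow> (\<exists>c. c \<noteq> 0 \<and> L' = (\<lambda>z. c * z) ` L)"
proof
  interpret X: uniformized X L \<pi> by fact
  interpret X': uniformized X' L' \<pi>' by fact
  \<comment> \<open>An affine function with all values in a discrete set is constant. This is
    applied to the difference between the composed lift and the identity, which takes values in
    \<open>L\<close>.\<close>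
  have zero: "a = 0" if a: "\<And>z. a * z + b \<in> L" for a b
  proof -
    have "a * 1 + b = a * 0 + b"
      by (rule discrete_subgroup_constant[OF X.discrete, where S = UNIV and h = "\<lambda>z. a * z + b"])
        (use a in \<open>auto intro!: continuous_intros\<close>)
    then show ?thesis by simp
  qed
  {
    assume "isomorphic_curves X X'"
    then obtain h k where hk: "holomorphic_map X X' h" "holomorphic_map X' X k"
      "\<And>x. x \<in> points X \<Longrightarrow> k (h x) = x" unfolding isomorphic_curves_def by blast
    obtain c d where c: "\<And>z. h (\<pi> z) = \<pi>' (c * z + d)"
      using holomorphic_map_affine_lift[OF assms hk(1)] by blast
    obtain c' d' where c': "\<And>z. k (\<pi>' z) = \<pi> (c' * z + d')"
      using holomorphic_map_affine_lift[OF assms(2,1) hk(2)] by blast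
    have "(c' * c - 1) * z + (c' * d + d') \<in> L" for z
    proof -
      have "\<pi> (c' * (c * z + d) + d') = \<pi> z" using hk(3)[of "\<pi> z"] c c' by simp
      then show ?thesis by (simp add: X.fibre algebra_simps)
    qed
    then have cc: "c' * c = 1" using zero by fastforce
    have 1: "c * l \<in> L'" if "l \<in> L" for l
    proof -
      have "\<pi> l = \<pi> 0" using that X.fibre by simp
      then show ?thesis using c[of l] c[of 0] X'.fibre[of "c * l + d" d] by simp
    qed
    have 2: "c' * l \<in> L" if "l \<in> L'" for l
    proof -
      have "\<pi>' l = \<pi>' 0" using that X'.fibre by simp
      then show ?thesis using c'[of l] c'[of 0] X.fibre[of "c' * l + d'" d'] by simp
    qed
    have "l \<in> (\<lambda>z. c * z) ` L" if "l \<in> L'" for l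
    proof -
      have "l = c * (c' * l)" using cc by (simp add: mult.assoc[symmetric] mult.commute[of c])
      then show ?thesis using 2[OF that] by blast
    qed
    then have "L' = (\<lambda>z. c * z) ` L" using 1 by blast
    moreover have "c \<noteq> 0" using cc by auto
    ultimately show "\<exists>c. c \<noteq> 0 \<and> L' = (\<lambda>z. c * z) ` L" by blast
  }
  assume "\<exists>c. c \<noteq> 0 \<and> L' = (\<lambda>z. c * z) ` L"
  then obtain c where c: "c \<noteq> 0" "L' = (\<lambda>z. c * z) ` L" by blast
  have mem: "c * z \<in> L' \<longleftrightarrow> z \<in> L" for z using c by auto
  \<comment> \<open>Representatives in the plane are chosen arbitrarily; since multiplication by
    \<open>c\<close> carries \<open>L\<close> onto \<open>L'\<close>, the results do not depend on
    the choice.\<close>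
  define h where "h x = \<pi>' (c * (SOME z. \<pi> z = x))" for x
  define k where "k x = \<pi> ((SOME z. \<pi>' z = x) / c)" for x
  have h: "h (\<pi> z) = \<pi>' (c * z + 0)" for z
  proof -
    have "\<pi> (SOME w. \<pi> w = \<pi> z) = \<pi> z" by (rule someI) (rule refl)
    then show ?thesis
      using mem[of "(SOME w. \<pi> w = \<pi> z) - z"] unfolding h_def X'.fibre X.fibre
      by (simp add: right_diff_distrib)
  qed
  have k: "k (\<pi>' z) = \<pi> (inverse c * z + 0)" for z
  proof -
    define w where "w = (SOME w. \<pi>' w = \<pi>' z)"
    have "\<pi>' w = \<pi>' z" unfolding w_def by (rule someI) (rule refl)
    moreover have "c * (w / c - inverse c * z) = w - z"
      using c(1) by (simp add: right_diff_distrib mult.assoc[symmetric])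
    ultimately have "c * (w / c - inverse c * z) \<in> L'" by (simp add: X'.fibre)
    then have "w / c - inverse c * z \<in> L" using mem by blast
    then show ?thesis by (simp add: k_def w_def X.fibre)
  qed
  have "k (h x) = x" if "x \<in> points X" for x
    using that h k c(1) by (auto simp: mult.assoc[symmetric] simp flip: X.range)
  moreover have "h (k x) = x" if "x \<in> points X'" for x
    using that h k c(1) by (auto simp: mult.assoc[symmetric] simp flip: X'.range)
  ultimately show "isomorphic_curves X X'"
    using affine_lift_holomorphic_map[OF assms h] affine_lift_holomorphic_map[OF assms(2,1) k]
    unfolding isomorphic_curves_def by blast
qed

section \<open>Fiber products of affine maps\<close>

lemma two_span_iff: "z \<in> two_span \<alpha> \<beta> M \<longleftrightarrow> (\<exists>x\<in>M. \<exists>y\<in>M. z = \<alpha> * x + \<beta> * y)"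
  unfolding two_span_def by blast

lemma two_span_add:
  assumes "\<And>x y. x \<in> M \<Longrightarrow> y \<in> M \<Longrightarrow> x + y \<in> M" "z \<in> two_span \<alpha> \<beta> M" "w \<in> two_span \<alpha> \<beta> M"
  shows "z + w \<in> two_span \<alpha> \<beta> M"
proof -
  obtain a b a' b' where "a \<in> M" "b \<in> M" "a' \<in> M" "b' \<in> M"
    "z = \<alpha> * a + \<beta> * b" "w = \<alpha> * a' + \<beta> * b'"
    using assms(2,3) unfolding two_span_def by blast
  moreover have "(\<alpha> * a + \<beta> * b) + (\<alpha> * a' + \<beta> * b') = \<alpha> * (a + a') + \<beta> * (b + b')"
    by (simp add: algebra_simps)
  ultimately show ?thesis using assms(1) unfolding two_span_def by blast
qed

text \<open>The common periods of \<open>w \<mapsto> \<pi> (\<alpha> * w)\<close> and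
  \<open>w \<mapsto> \<pi> (\<beta> * w)\<close> when \<open>M\<close> is the period group of
  \<pi>.\<close>

definition common_preimage :: "complex \<Rightarrow> complex \<Rightarrow> complex set \<Rightarrow> complex set" where
  "common_preimage \<alpha> \<beta> M = {w. \<alpha> * w \<in> M \<and> \<beta> * w \<in> M}"

lemma discrete_common_preimage:
  assumes "discrete_subgroup L" "\<alpha> \<noteq> 0"
  shows "discrete_subgroup (common_preimage \<alpha> \<beta> L)"
proof -
  obtain e where e: "e > 0" "\<And>x. x \<in> L \<Longrightarrow> norm x < e \<Longrightarrow> x = 0"
    using assms(1) unfolding discrete_subgroup_def by auto
  have "x = 0" if "x \<in> common_preimage \<alpha> \<beta> L" "norm x < e / norm \<alpha>" for x
    using e(2)[of "\<alpha> * x"] that assms(2)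
    by (auto simp: common_preimage_def norm_mult field_simps)
  moreover have "e / norm \<alpha> > 0" using e(1) assms(2) by simp
  ultimately show ?thesis
    using assms(1) unfolding discrete_subgroup_def
    by (auto simp: common_preimage_def right_diff_distrib)
qed

text \<open>One step of the iteration: \<open>X\<close> and \<open>X'\<close> are consecutive curves
  and \<open>Y\<close> is the next one. The pairs satisfy \<open>g (p y) = f (q y)\<close>, so for
  connected \<open>Y\<close> the projection \<open>p\<close> inherits the slope of \<open>f\<close>,
  and \<open>q\<close> that of \<open>g\<close>.\<close>

locale affine_fiber_product =
  X: uniformized X L \<pi> + X': uniformized X' L' \<pi>'
  for X :: "'a surface" and L \<pi> and X' :: "'b surface" and L' \<pi>' +
  fixes f g :: "'a \<Rightarrow> 'b" and \<alpha> \<beta> c d :: complex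
    and Y :: "'c surface" and p q :: "'c \<Rightarrow> 'a"
  assumes f: "f (\<pi> z) = \<pi>' (\<alpha> * z + c)" and g: "g (\<pi> z) = \<pi>' (\<beta> * z + d)"
    and nonzero: "\<alpha> \<noteq> 0" "\<beta> \<noteq> 0"
    and fiber_product: "fiber_product X g X f Y p q"
begin

definition offset :: "complex \<Rightarrow> complex \<Rightarrow> complex" where
  "offset s t = (\<beta> * s + d) - (\<alpha> * t + c)"

lemma
  shows curve_Y: "curve Y" and holomorphic_p: "holomorphic_map Y X p"
    and holomorphic_q: "holomorphic_map Y X q"
    and image: "(\<lambda>y. (p y, q y)) ` points Y = {(x1, x2). x1 \<in> points X \<and> x2 \<in> points X \<and> g x1 = f x2}"
  using fiber_product unfolding fiber_product_def normalization_of_def by blast+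

lemma offset_in:
  assumes "y \<in> points Y" "p y = \<pi> s" "q y = \<pi> t"
  shows "offset s t \<in> L'"
proof -
  have "(p y, q y) \<in> {(x1, x2). x1 \<in> points X \<and> x2 \<in> points X \<and> g x1 = f x2}"
    using assms(1) image by blast
  then show ?thesis using assms(2,3) f g by (simp add: offset_def X'.fibre)
qed

lemma point_exists:
  assumes "offset s t \<in> L'"
  obtains y where "y \<in> points Y" "p y = \<pi> s" "q y = \<pi> t"
proof -
  have "g (\<pi> s) = f (\<pi> t)" using assms f g by (simp add: offset_def X'.fibre)
  then have "(\<pi> s, \<pi> t) \<in> {(x1, x2). x1 \<in> points X \<and> x2 \<in> points X \<and> g x1 = f x2}" by simp
  then show ?thesis using that unfolding image[symmetric] by auto
qed

lemma lifts_exist: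
  assumes "y \<in> points Y"
  obtains s t where "p y = \<pi> s" "q y = \<pi> t"
proof -
  have "(p y, q y) \<in> {(x1, x2). x1 \<in> points X \<and> x2 \<in> points X \<and> g x1 = f x2}"
    using assms image by blast
  then have "p y \<in> range \<pi>" "q y \<in> range \<pi>" using X.range by auto
  then show ?thesis using that by blast
qed

lemma exceptional_set:
  obtains S where "finite S" "finite {y \<in> points Y. (p y, q y) \<in> S}"
    "inj_on (\<lambda>y. (p y, q y)) {y \<in> points Y. (p y, q y) \<notin> S}"
  using fiber_product unfolding fiber_product_def normalization_of_def by blast

text \<open>Excludes components of \<open>Y\<close> that are contracted to a single pair.\<close>

lemma finite_fibre: "finite {y \<in> points Y. p y = a \<and> q y = b}"
proof -
  obtain S where S: "finite S" "finite {y \<in> points Y. (p y, q y) \<in> S}"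
    "inj_on (\<lambda>y. (p y, q y)) {y \<in> points Y. (p y, q y) \<notin> S}" using exceptional_set .
  show ?thesis
  proof (cases "(a, b) \<in> S")
    case True
    then show ?thesis by (intro finite_subset[OF _ S(2)]) auto
  next
    case False
    have "inj_on (\<lambda>y. (p y, q y)) {y \<in> points Y. p y = a \<and> q y = b}"
      using False by (intro inj_on_subset[OF S(3)]) auto
    then show ?thesis by (rule inj_on_finite[of _ _ "{(a, b)}"]) auto
  qed
qed

text \<open>The offset of the two lifts takes values in the discrete group \<open>L'\<close>, so it
  is constant near \<open>y\<close>. If \<sigma> were constant, so would be \<tau>, because \<alpha>
  is nonzero, and a disc of \<open>Y\<close> would lie over one pair, against
  \<open>finite_fibre\<close>; hence \<sigma> is open. The bound \<open>r \<le> e\<close> allows the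
  disc to be fitted into a given neighbourhood.\<close>

lemma joint_lift:
  assumes U: "(U, \<phi>) \<in> atlas Y" "y \<in> U" and st: "p y = \<pi> s" "q y = \<pi> t" and e: "e > 0"
  obtains r \<sigma> \<tau> where "r > 0" "r \<le> e" "ball (\<phi> y) r \<subseteq> \<phi> ` U"
    "\<sigma> holomorphic_on ball (\<phi> y) r" "\<tau> holomorphic_on ball (\<phi> y) r" "\<sigma> (\<phi> y) = s" "\<tau> (\<phi> y) = t"
    "\<And>\<zeta>. \<zeta> \<in> ball (\<phi> y) r \<Longrightarrow> \<pi> (\<sigma> \<zeta>) = p (inv_into U \<phi> \<zeta>)"
    "\<And>\<zeta>. \<zeta> \<in> ball (\<phi> y) r \<Longrightarrow> \<pi> (\<tau> \<zeta>) = q (inv_into U \<phi> \<zeta>)"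
    "\<And>\<zeta>. \<zeta> \<in> ball (\<phi> y) r \<Longrightarrow> offset (\<sigma> \<zeta>) (\<tau> \<zeta>) = offset s t"
    "open (\<sigma> ` ball (\<phi> y) r)"
proof -
  note cU = curve_chart[OF curve_Y U(1)]
  obtain r1 \<sigma> where \<sigma>: "r1 > 0" "ball (\<phi> y) r1 \<subseteq> \<phi> ` U" "\<sigma> holomorphic_on ball (\<phi> y) r1"
    "\<sigma> (\<phi> y) = s" "\<And>\<zeta>. \<zeta> \<in> ball (\<phi> y) r1 \<Longrightarrow> \<pi> (\<sigma> \<zeta>) = p (inv_into U \<phi> \<zeta>)"
    using X.lift[OF curve_Y holomorphic_p U st(1)] by blast
  obtain r2 \<tau> where \<tau>: "r2 > 0" "ball (\<phi> y) r2 \<subseteq> \<phi> ` U" "\<tau> holomorphic_on ball (\<phi> y) r2"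
    "\<tau> (\<phi> y) = t" "\<And>\<zeta>. \<zeta> \<in> ball (\<phi> y) r2 \<Longrightarrow> \<pi> (\<tau> \<zeta>) = q (inv_into U \<phi> \<zeta>)"
    using X.lift[OF curve_Y holomorphic_q U st(2)] by blast
  define r where "r = min e (min r1 r2)"
  define B where "B = ball (\<phi> y) r"
  have r: "r > 0" "r \<le> e" using e \<sigma>(1) \<tau>(1) by (auto simp: r_def)
  have B: "B \<subseteq> ball (\<phi> y) r1" "B \<subseteq> ball (\<phi> y) r2" by (auto simp: B_def r_def)
  have BU: "B \<subseteq> \<phi> ` U" using B(1) \<sigma>(2) by blast
  have hol: "\<sigma> holomorphic_on B" "\<tau> holomorphic_on B"
    using holomorphic_on_subset[OF \<sigma>(3) B(1)] holomorphic_on_subset[OF \<tau>(3) B(2)] by auto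
  have lift: "\<pi> (\<sigma> \<zeta>) = p (inv_into U \<phi> \<zeta>)" "\<pi> (\<tau> \<zeta>) = q (inv_into U \<phi> \<zeta>)" if "\<zeta> \<in> B" for \<zeta>
    using that B \<sigma>(5) \<tau>(5) by blast+
  have inY: "inv_into U \<phi> \<zeta> \<in> points Y" if "\<zeta> \<in> B" for \<zeta>
    using that BU cU(4) by (meson inv_into_into subset_iff)
  have off: "offset (\<sigma> \<zeta>) (\<tau> \<zeta>) = offset (\<sigma> \<eta>) (\<tau> \<eta>)" if \<zeta>\<eta>: "\<zeta> \<in> B" "\<eta> \<in> B" for \<zeta> \<eta>
  proof (rule discrete_subgroup_constant[OF X'.discrete, where S = B and h = "\<lambda>\<zeta>. offset (\<sigma> \<zeta>) (\<tau> \<zeta>)"])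
    show "continuous_on B (\<lambda>\<zeta>. offset (\<sigma> \<zeta>) (\<tau> \<zeta>))"
      using hol unfolding offset_def by (intro continuous_intros holomorphic_on_imp_continuous_on)
    show "offset (\<sigma> \<zeta>) (\<tau> \<zeta>) \<in> L'" if "\<zeta> \<in> B" for \<zeta>
      using offset_in[OF inY[OF that]] lift[OF that] by simp
  qed (use \<zeta>\<eta> in \<open>auto simp: B_def\<close>)
  have "\<not> \<sigma> constant_on B"
  proof
    assume "\<sigma> constant_on B"
    then obtain a where a: "\<And>\<zeta>. \<zeta> \<in> B \<Longrightarrow> \<sigma> \<zeta> = a" unfolding constant_on_def by blast
    have y: "\<phi> y \<in> B" using r(1) by (simp add: B_def)
    have b: "\<tau> \<zeta> = \<tau> (\<phi> y)" if "\<zeta> \<in> B" for \<zeta>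
      using off[OF that y] a[OF that] a[OF y] nonzero(1) by (simp add: offset_def)
    have "inv_into U \<phi> ` B \<subseteq> {x \<in> points Y. p x = \<pi> a \<and> q x = \<pi> (\<tau> (\<phi> y))}"
    proof
      fix x assume "x \<in> inv_into U \<phi> ` B"
      then obtain \<zeta> where \<zeta>: "\<zeta> \<in> B" "x = inv_into U \<phi> \<zeta>" by blast
      show "x \<in> {x \<in> points Y. p x = \<pi> a \<and> q x = \<pi> (\<tau> (\<phi> y))}"
        using lift[OF \<zeta>(1)] inY[OF \<zeta>(1)] \<zeta>(2) a[OF \<zeta>(1)] b[OF \<zeta>(1)] by simp
    qed
    then have "finite (inv_into U \<phi> ` B)" using finite_fibre finite_subset by blast
    moreover have "inj_on (inv_into U \<phi>) B" using inj_on_inv_into[OF BU] .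
    ultimately have "finite B" using finite_imageD by blast
    then show False using finite_imp_not_open[of B] r(1) unfolding B_def by auto
  qed
  then have "open (\<sigma> ` B)"
    using hol(1) unfolding B_def by (intro open_mapping_thm[of \<sigma> "ball (\<phi> y) r"]) auto
  moreover have "offset (\<sigma> \<zeta>) (\<tau> \<zeta>) = offset s t" if "\<zeta> \<in> B" for \<zeta>
    using off[OF that, of "\<phi> y"] r(1) \<sigma>(4) \<tau>(4) by (simp add: B_def)
  ultimately show ?thesis
    using that[of r \<sigma> \<tau>] r BU hol \<sigma>(4) \<tau>(4) lift unfolding B_def by blast
qed

text \<open>
  The branches at two points with the same image would both cover a neighbourhood of it, so the
  map would fail to be injective on an infinite set.
\<close>

lemma inj: "inj_on (\<lambda>y. (p y, q y)) (points Y)"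
proof (rule inj_onI, rule ccontr)
  fix y1 y2 assume y: "y1 \<in> points Y" "y2 \<in> points Y" "(p y1, q y1) = (p y2, q y2)" "y1 \<noteq> y2"
  obtain s t where st: "p y1 = \<pi> s" "q y1 = \<pi> t" using lifts_exist[OF y(1)] .
  then have st2: "p y2 = \<pi> s" "q y2 = \<pi> t" using y(3) by auto
  have "Hausdorff_space (top_of Y)" using curve_Y unfolding curve_def by blast
  then obtain W1 W2 where W: "openin (top_of Y) W1" "openin (top_of Y) W2" "y1 \<in> W1" "y2 \<in> W2"
    "disjnt W1 W2" using y unfolding Hausdorff_space_def by metis
  \<comment> \<open>With the offset fixed, the first lift \<open>v\<close> determines the second,
    whence the quotient by \<alpha>. Two branches starting at the same \<open>s\<close> and
    \<open>t\<close> therefore pass through the same pairs.\<close>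
  have branch: "\<exists>V. open V \<and> s \<in> V \<and> (\<forall>v\<in>V. \<exists>x\<in>W. x \<in> points Y \<and> p x = \<pi> v \<and>
      q x = \<pi> ((\<beta> * v + d - offset s t - c) / \<alpha>))"
    if W: "openin (top_of Y) W" "y \<in> W" and p: "p y = \<pi> s" "q y = \<pi> t" for y W
  proof -
    have yY: "y \<in> points Y" using W openin_subset by blast
    obtain U \<phi> where U: "(U, \<phi>) \<in> atlas Y" "y \<in> U" using curve_chart_at[OF curve_Y yY] .
    note cU = curve_chart[OF curve_Y U(1)]
    have "open (\<phi> ` (U \<inter> W))" using open_chart_image[OF curve_Y U(1)] cU(1) W(1) by blast
    moreover have "\<phi> y \<in> \<phi> ` (U \<inter> W)" using U W by blast
    ultimately obtain e where e: "e > 0" "ball (\<phi> y) e \<subseteq> \<phi> ` (U \<inter> W)"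
      using open_contains_ball by blast
    obtain r \<sigma> \<tau> where r: "r > 0" "r \<le> e" "ball (\<phi> y) r \<subseteq> \<phi> ` U"
      "\<sigma> (\<phi> y) = s"
      "\<And>\<zeta>. \<zeta> \<in> ball (\<phi> y) r \<Longrightarrow> \<pi> (\<sigma> \<zeta>) = p (inv_into U \<phi> \<zeta>)"
      "\<And>\<zeta>. \<zeta> \<in> ball (\<phi> y) r \<Longrightarrow> \<pi> (\<tau> \<zeta>) = q (inv_into U \<phi> \<zeta>)"
      "\<And>\<zeta>. \<zeta> \<in> ball (\<phi> y) r \<Longrightarrow> offset (\<sigma> \<zeta>) (\<tau> \<zeta>) = offset s t"
      "open (\<sigma> ` ball (\<phi> y) r)"
      using joint_lift[OF U p e(1)] by metis
    have "\<exists>x\<in>W. x \<in> points Y \<and> p x = \<pi> v \<and> q x = \<pi> ((\<beta> * v + d - offset s t - c) / \<alpha>)"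
      if "v \<in> \<sigma> ` ball (\<phi> y) r" for v
    proof -
      obtain \<zeta> where \<zeta>: "\<zeta> \<in> ball (\<phi> y) r" "v = \<sigma> \<zeta>" using \<open>v \<in> _\<close> by blast
      have "\<zeta> \<in> \<phi> ` (U \<inter> W)" using \<zeta>(1) e(2) r(2) by auto
      then obtain x where x: "x \<in> U" "x \<in> W" "\<zeta> = \<phi> x" by blast
      then have x': "inv_into U \<phi> \<zeta> = x" using cU(3) by simp
      have "\<tau> \<zeta> = (\<beta> * v + d - offset s t - c) / \<alpha>"
        using r(7)[OF \<zeta>(1)] nonzero(1) \<zeta>(2) by (auto simp: offset_def field_simps)
      then show ?thesis
        using r(5,6)[OF \<zeta>(1)] x x' \<zeta>(2) cU(4) by (intro bexI[of _ x]) auto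
    qed
    moreover have "s \<in> \<sigma> ` ball (\<phi> y) r" using r(1,4) by (metis centre_in_ball imageI)
    ultimately show ?thesis using r(8) by blast
  qed
  from branch[OF W(1,3) st] obtain V1 where V1: "open V1" "s \<in> V1" "\<forall>v\<in>V1. \<exists>x\<in>W1. x \<in> points Y \<and> p x = \<pi> v \<and>
      q x = \<pi> ((\<beta> * v + d - offset s t - c) / \<alpha>)" 
    by (elim exE conjE)
  from branch[OF W(2,4) st2] obtain V2 where V2: "open V2" "s \<in> V2" "\<forall>v\<in>V2. \<exists>x\<in>W2. x \<in> points Y \<and> p x = \<pi> v \<and>
      q x = \<pi> ((\<beta> * v + d - offset s t - c) / \<alpha>)" 
    by (elim exE conjE)
  obtain S where S: "finite S" "finite {y \<in> points Y. (p y, q y) \<in> S}"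
    "inj_on (\<lambda>y. (p y, q y)) {y \<in> points Y. (p y, q y) \<notin> S}" using exceptional_set .
  have "\<pi> v \<in> fst ` S" if v: "v \<in> V1 \<inter> V2" for v
  proof -
    obtain x1 where x1: "x1 \<in> W1" "x1 \<in> points Y" "p x1 = \<pi> v"
      "q x1 = \<pi> ((\<beta> * v + d - offset s t - c) / \<alpha>)" using V1(3) v by blast
    obtain x2 where x2: "x2 \<in> W2" "x2 \<in> points Y" "p x2 = \<pi> v"
      "q x2 = \<pi> ((\<beta> * v + d - offset s t - c) / \<alpha>)" using V2(3) v by blast
    have "x1 \<noteq> x2" using x1(1) x2(1) W(5) unfolding disjnt_def by blast
    then have "(p x1, q x1) \<in> S" using x1 x2 inj_onD[OF S(3), of x1 x2] by auto
    then show ?thesis using x1(3) by (metis fst_conv imageI)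
  qed
  then have "\<pi> ` (V1 \<inter> V2) \<subseteq> fst ` S" by blast
  then have fin: "finite (\<pi> ` (V1 \<inter> V2))" using S(1) finite_surj by blast
  \<comment> \<open>On a small ball around \<open>s\<close> the map \<pi> is injective, so a
    nonempty open set cannot have a finite image there.\<close>
  obtain U \<phi> where U: "(U, \<phi>) \<in> atlas X" "\<pi> s \<in> U" using curve_chart_at[OF X.curve X.in_points] .
  obtain e where e: "e > 0" "inj_on (\<lambda>z. \<phi> (\<pi> z)) (ball s e)"
    using X.chart_local_injective[OF U] by metis
  have "inj_on \<pi> (ball s e)" using e(2) unfolding inj_on_def by metis
  then have "inj_on \<pi> (ball s e \<inter> (V1 \<inter> V2))" by (rule inj_on_subset) blast
  moreover have "finite (\<pi> ` (ball s e \<inter> (V1 \<inter> V2)))" using fin by (rule finite_subset[rotated]) blast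
  ultimately have "finite (ball s e \<inter> (V1 \<inter> V2))" using finite_imageD by blast
  moreover have "open (ball s e \<inter> (V1 \<inter> V2))" using V1(1) V2(1) by blast
  ultimately show False using e(1) V1(2) V2(2) by (metis IntI centre_in_ball empty_iff finite_imp_not_open)
qed

lemma offset_class:
  assumes "\<pi> s = \<pi> s'" "\<pi> t = \<pi> t'" "offset s t \<in> two_span \<alpha> \<beta> L"
  shows "offset s' t' \<in> two_span \<alpha> \<beta> L"
proof -
  have "t - t' \<in> L" "s' - s \<in> L" using assms(1,2) X.fibre[of t t'] X.fibre[of s' s] by auto
  then have "\<alpha> * (t - t') + \<beta> * (s' - s) \<in> two_span \<alpha> \<beta> L" unfolding two_span_iff by blast
  then have "offset s t + (\<alpha> * (t - t') + \<beta> * (s' - s)) \<in> two_span \<alpha> \<beta> L"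
    using two_span_add[OF _ assms(3)] discrete_subgroup_add[OF X.discrete] by blast
  then show ?thesis by (simp add: offset_def algebra_simps)
qed

text \<open>Every period \<open>l\<close> of \<open>L'\<close> is an offset, realized by
  \<open>t = 0\<close> and \<open>s = (c - d + l) / \<beta>\<close>. If only one class of offsets
  occurs, it is the class of \<open>l = 0\<close>, so all periods lie in the span.\<close>

lemma connected_imp_span:
  assumes "connected_space (top_of Y)"
  shows "L' \<subseteq> two_span \<alpha> \<beta> L"
proof -
  define A where "A = {y \<in> points Y. \<exists>s t. p y = \<pi> s \<and> q y = \<pi> t \<and> offset s t \<in> two_span \<alpha> \<beta> L}"
  define B where "B = {y \<in> points Y. \<exists>s t. p y = \<pi> s \<and> q y = \<pi> t \<and> offset s t \<notin> two_span \<alpha> \<beta> L}"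
  \<comment> \<open>An arbitrary predicate \<open>P\<close> lets one argument serve for both
    \<open>A\<close> and \<open>B\<close>; all that matters is that offsets are locally
    constant.\<close>
  have clopen: "openin (top_of Y) {y \<in> points Y. \<exists>s t. p y = \<pi> s \<and> q y = \<pi> t \<and> P (offset s t)}" (is "openin _ ?S") for P :: "complex \<Rightarrow> bool"
  proof (subst openin_subopen, intro ballI)
    fix y assume "y \<in> ?S"
    then obtain s t where y: "y \<in> points Y" "p y = \<pi> s" "q y = \<pi> t" "P (offset s t)" by blast
    obtain U \<phi> where U: "(U, \<phi>) \<in> atlas Y" "y \<in> U" using curve_chart_at[OF curve_Y y(1)] .
    note cU = curve_chart[OF curve_Y U(1)]
    obtain r \<sigma> \<tau> where r: "r > 0"
      "\<And>\<zeta>. \<zeta> \<in> ball (\<phi> y) r \<Longrightarrow> \<pi> (\<sigma> \<zeta>) = p (inv_into U \<phi> \<zeta>)"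
      "\<And>\<zeta>. \<zeta> \<in> ball (\<phi> y) r \<Longrightarrow> \<pi> (\<tau> \<zeta>) = q (inv_into U \<phi> \<zeta>)"
      "\<And>\<zeta>. \<zeta> \<in> ball (\<phi> y) r \<Longrightarrow> offset (\<sigma> \<zeta>) (\<tau> \<zeta>) = offset s t"
      using joint_lift[OF U y(2,3) zero_less_one] by metis
    have "{x \<in> U. \<phi> x \<in> ball (\<phi> y) r} \<subseteq> ?S"
    proof
      fix x assume x: "x \<in> {x \<in> U. \<phi> x \<in> ball (\<phi> y) r}"
      then have x': "inv_into U \<phi> (\<phi> x) = x" "\<phi> x \<in> ball (\<phi> y) r" "x \<in> points Y" using cU(3,4) by auto
      show "x \<in> ?S"
        using r(2-4)[OF x'(2)] x'(1,3) y(4) by (intro CollectI conjI exI[of _ "\<sigma> (\<phi> x)"] exI[of _ "\<tau> (\<phi> x)"]) auto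
    qed
    moreover have "openin (top_of Y) {x \<in> U. \<phi> x \<in> ball (\<phi> y) r}"
      using openin_chart_vimage[OF curve_Y U(1)] by blast
    moreover have "y \<in> {x \<in> U. \<phi> x \<in> ball (\<phi> y) r}" using U(2) r(1) by simp
    ultimately show "\<exists>T. openin (top_of Y) T \<and> y \<in> T \<and> T \<subseteq> ?S" by blast
  qed
  have "openin (top_of Y) A" unfolding A_def by (rule clopen)
  moreover have "openin (top_of Y) B"
    unfolding B_def using clopen[of "\<lambda>x. x \<notin> two_span \<alpha> \<beta> L"] .
  moreover have "points Y \<subseteq> A \<union> B"
  proof
    fix y assume y: "y \<in> points Y"
    obtain s t where "p y = \<pi> s" "q y = \<pi> t" using lifts_exist[OF y] .
    then show "y \<in> A \<union> B" using y unfolding A_def B_def by (cases "offset s t \<in> two_span \<alpha> \<beta> L") auto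
  qed
  moreover have "A \<inter> B = {}"
  proof (rule equals0I)
    fix y assume "y \<in> A \<inter> B"
    then have y: "y \<in> A" "y \<in> B" by auto
    from y(1) obtain s t where 1: "p y = \<pi> s" "q y = \<pi> t" "offset s t \<in> two_span \<alpha> \<beta> L"
      unfolding A_def by blast
    from y(2) obtain s' t' where 2: "p y = \<pi> s'" "q y = \<pi> t'" "offset s' t' \<notin> two_span \<alpha> \<beta> L"
      unfolding B_def by blast
    show False using offset_class[of s s' t t'] 1 2 by simp
  qed
  moreover have "A \<noteq> {}"
  proof -
    have 0: "offset ((c - d) / \<beta>) 0 = 0" using nonzero by (simp add: offset_def)
    have "0 \<in> L'" "0 \<in> L" using X.discrete X'.discrete unfolding discrete_subgroup_def by auto
    moreover from \<open>0 \<in> L\<close> have "0 \<in> two_span \<alpha> \<beta> L" unfolding two_span_iff by force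
    moreover obtain y where "y \<in> points Y" "p y = \<pi> ((c - d) / \<beta>)" "q y = \<pi> 0"
      using point_exists[of "(c - d) / \<beta>" 0] 0 \<open>0 \<in> L'\<close> by metis
    ultimately show ?thesis using 0 unfolding A_def by force
  qed
  ultimately have B: "B = {}" using assms unfolding connected_space_def by blast
  show ?thesis
  proof
    fix l assume l: "l \<in> L'"
    have 0: "offset ((c - d + l) / \<beta>) 0 = l" using nonzero by (simp add: offset_def)
    obtain y where "y \<in> points Y" "p y = \<pi> ((c - d + l) / \<beta>)" "q y = \<pi> 0"
      using point_exists[of "(c - d + l) / \<beta>" 0] 0 l by metis
    then show "l \<in> two_span \<alpha> \<beta> L" using B 0 unfolding B_def by force
  qed
qed

text \<open>The point \<open>\<rho> w\<close> is the one over the pair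
  \<open>(\<pi> (\<alpha> * w + e), \<pi> (\<beta> * w))\<close>, unique by \<open>inj\<close>. It
  is obtained by choice for each \<open>w\<close>, so continuity and holomorphy have to be recovered
  from local lifts.\<close>

lemma uniformized_fiber_product:
  assumes span: "L' \<subseteq> two_span \<alpha> \<beta> L"
  obtains \<rho> e where "uniformized Y (common_preimage \<alpha> \<beta> L) \<rho>"
    "\<And>w. p (\<rho> w) = \<pi> (\<alpha> * w + e)" "\<And>w. q (\<rho> w) = \<pi> (\<beta> * w)"
proof -
  \<comment> \<open>Makes the offset of \<open>\<alpha> * w + e\<close> and
    \<open>\<beta> * w\<close> vanish identically in \<open>w\<close>.\<close>
  define e where "e = (c - d) / \<beta>"
  have "\<beta> * e = c - d" using nonzero by (simp add: e_def)
  then have off0: "offset (\<alpha> * w + e) (\<beta> * w) = 0" for w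
    by (simp add: offset_def distrib_left)
  have "0 \<in> L'" using X'.discrete unfolding discrete_subgroup_def by auto
  then have "\<exists>y. y \<in> points Y \<and> p y = \<pi> (\<alpha> * w + e) \<and> q y = \<pi> (\<beta> * w)" for w
    using point_exists[of "\<alpha> * w + e" "\<beta> * w"] off0 by metis
  then obtain \<rho> where \<rho>: "\<And>w. \<rho> w \<in> points Y" "\<And>w. p (\<rho> w) = \<pi> (\<alpha> * w + e)"
    "\<And>w. q (\<rho> w) = \<pi> (\<beta> * w)" by metis
  have \<rho>_eq: "\<rho> w = y" if "y \<in> points Y" "p y = \<pi> (\<alpha> * w + e)" "q y = \<pi> (\<beta> * w)" for y w
    using inj_onD[OF inj, of "\<rho> w" y] \<rho> that by simp
  have fibre: "\<rho> z = \<rho> w \<longleftrightarrow> z - w \<in> common_preimage \<alpha> \<beta> L" for z w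
  proof -
    have "\<rho> z = \<rho> w \<longleftrightarrow> \<pi> (\<alpha> * z + e) = \<pi> (\<alpha> * w + e) \<and> \<pi> (\<beta> * z) = \<pi> (\<beta> * w)"
      using \<rho> \<rho>_eq by metis
    then show ?thesis by (simp add: X.fibre common_preimage_def right_diff_distrib)
  qed
  have "y \<in> range \<rho>" if y: "y \<in> points Y" for y
  proof -
    obtain s t where st: "p y = \<pi> s" "q y = \<pi> t" using lifts_exist[OF y] .
    obtain a b where ab: "a \<in> L" "b \<in> L" "offset s t = \<alpha> * a + \<beta> * b"
      using offset_in[OF y st] span unfolding two_span_def by blast
    \<comment> \<open>The offset \<open>\<alpha> * a + \<beta> * b\<close> is absorbed by moving
      \<open>t\<close> by \<open>a\<close> and \<open>s\<close> by \<open>- b\<close>; the shifted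
      lifts have offset zero and come from one \<open>w\<close>.\<close>
    define w where "w = (t + a) / \<beta>"
    have w: "\<beta> * w = t + a" using nonzero by (simp add: w_def)
    have "\<beta> * (\<alpha> * w + e) = \<alpha> * (\<beta> * w) + \<beta> * e" by (simp add: algebra_simps)
    also have "\<dots> = \<alpha> * (t + a) + (c - d)" using w nonzero by (simp add: e_def)
    also have "\<dots> = \<beta> * (s - b)" using ab(3) by (simp add: offset_def algebra_simps)
    finally have "\<alpha> * w + e = s - b" using nonzero by simp
    then have "\<pi> (\<alpha> * w + e) = p y" "\<pi> (\<beta> * w) = q y"
      using st ab w discrete_subgroup_minus[OF X.discrete] by (auto simp: X.fibre)
    then have "\<rho> w = y" using \<rho>_eq[OF y] by simp
    then show ?thesis by blast
  qed
  then have range: "range \<rho> = points Y" using \<rho>(1) by auto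
  \<comment> \<open>Near \<open>w\<close> the coordinate of \<open>\<rho> z\<close> is
    \<open>k (\<alpha> * z + e)\<close>, where \<open>k\<close> inverts the local lift \<sigma> of
    \<open>p\<close>.\<close>
  have local: "\<exists>V. open V \<and> w \<in> V \<and> V \<subseteq> \<rho> -` U \<and> (\<lambda>z. \<phi> (\<rho> z)) holomorphic_on V"
    if U: "(U, \<phi>) \<in> atlas Y" "\<rho> w \<in> U" for U \<phi> w
  proof -
    note cU = curve_chart[OF curve_Y U(1)]
    obtain r \<sigma> \<tau> where r: "r > 0" "ball (\<phi> (\<rho> w)) r \<subseteq> \<phi> ` U"
      "\<sigma> holomorphic_on ball (\<phi> (\<rho> w)) r" "\<sigma> (\<phi> (\<rho> w)) = \<alpha> * w + e"
      "\<And>\<zeta>. \<zeta> \<in> ball (\<phi> (\<rho> w)) r \<Longrightarrow> \<pi> (\<sigma> \<zeta>) = p (inv_into U \<phi> \<zeta>)"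
      "\<And>\<zeta>. \<zeta> \<in> ball (\<phi> (\<rho> w)) r \<Longrightarrow> \<pi> (\<tau> \<zeta>) = q (inv_into U \<phi> \<zeta>)"
      "\<And>\<zeta>. \<zeta> \<in> ball (\<phi> (\<rho> w)) r \<Longrightarrow> offset (\<sigma> \<zeta>) (\<tau> \<zeta>) = 0"
      using joint_lift[OF U \<rho>(2,3) zero_less_one] off0 by metis
    define B where "B = ball (\<phi> (\<rho> w)) r"
    have B: "\<sigma> holomorphic_on B" "open B" "\<phi> (\<rho> w) \<in> B" using r(1,3) by (auto simp: B_def)
    have \<rho>\<sigma>: "\<rho> z = inv_into U \<phi> \<zeta>" if "\<zeta> \<in> B" "\<sigma> \<zeta> = \<alpha> * z + e" for z \<zeta>
    proof (rule \<rho>_eq)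
      show "inv_into U \<phi> \<zeta> \<in> points Y"
        using that(1) r(2) cU(4) unfolding B_def by (meson inv_into_into subset_iff)
      show "p (inv_into U \<phi> \<zeta>) = \<pi> (\<alpha> * z + e)" using r(5)[of \<zeta>] that unfolding B_def by simp
      have "\<alpha> * \<tau> \<zeta> = \<alpha> * (\<beta> * z)"
        using r(7)[of \<zeta>] that off0[of z] unfolding B_def offset_def by simp
      then show "q (inv_into U \<phi> \<zeta>) = \<pi> (\<beta> * z)"
        using r(6)[of \<zeta>] that(1) nonzero unfolding B_def by simp
    qed
    have inj\<sigma>: "inj_on \<sigma> B"
    proof (rule inj_onI)
      fix \<zeta> \<eta> assume *: "\<zeta> \<in> B" "\<eta> \<in> B" "\<sigma> \<zeta> = \<sigma> \<eta>"
      have "\<sigma> \<zeta> = \<alpha> * ((\<sigma> \<zeta> - e) / \<alpha>) + e" using nonzero by simp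
      then have "inv_into U \<phi> \<zeta> = inv_into U \<phi> \<eta>" using \<rho>\<sigma> * by metis
      then show "\<zeta> = \<eta>" using * r(2) unfolding B_def by (metis f_inv_into_f subset_iff)
    qed
    obtain k where k: "k holomorphic_on \<sigma> ` B" "\<And>z. z \<in> B \<Longrightarrow> k (\<sigma> z) = z"
      using holomorphic_has_inverse[OF B(1,2) inj\<sigma>] by metis
    have o: "open (\<sigma> ` B)" using open_mapping_thm3[OF B(1,2) inj\<sigma>] .
    define V where "V = (\<lambda>z. \<alpha> * z + e) -` (\<sigma> ` B)"
    have "open V" unfolding V_def by (intro open_vimage o continuous_intros)
    moreover have "w \<in> V" using B(3) r(4) unfolding V_def by (metis imageI vimage_eq)
    moreover have V: "\<rho> z \<in> U \<and> \<phi> (\<rho> z) = k (\<alpha> * z + e)" if z: "z \<in> V" for z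
    proof -
      obtain \<zeta> where \<zeta>: "\<zeta> \<in> B" "\<alpha> * z + e = \<sigma> \<zeta>" using z unfolding V_def by blast
      have "\<rho> z = inv_into U \<phi> \<zeta>" using \<rho>\<sigma>[of \<zeta> z] \<zeta> by simp
      moreover have "\<zeta> \<in> \<phi> ` U" using \<zeta>(1) r(2) unfolding B_def by blast
      ultimately show ?thesis using \<zeta> k(2) by (simp add: inv_into_into f_inv_into_f)
    qed
    moreover have "(\<lambda>z. k (\<alpha> * z + e)) holomorphic_on V"
      by (rule holomorphic_on_compose_gen[OF _ k(1), unfolded o_def])
        (auto simp: V_def intro!: holomorphic_intros)
    then have "(\<lambda>z. \<phi> (\<rho> z)) holomorphic_on V" by (rule holomorphic_transform) (simp add: V)
    ultimately show ?thesis by blast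
  qed
  have "open (\<rho> -` W)" if W: "openin (top_of Y) W" for W
  proof (subst open_subopen, intro ballI)
    fix w assume w: "w \<in> \<rho> -` W"
    obtain U \<phi> where U: "(U, \<phi>) \<in> atlas Y" "\<rho> w \<in> U" using curve_chart_at[OF curve_Y \<rho>(1)] .
    note cU = curve_chart[OF curve_Y U(1)]
    obtain V where V: "open V" "w \<in> V" "V \<subseteq> \<rho> -` U" "(\<lambda>z. \<phi> (\<rho> z)) holomorphic_on V"
      using local[OF U] by blast
    have "open (\<phi> ` (U \<inter> W))" using open_chart_image[OF curve_Y U(1)] cU(1) W by blast
    then have "open (V \<inter> (\<lambda>z. \<phi> (\<rho> z)) -` (\<phi> ` (U \<inter> W)))"
      using V by (intro continuous_open_preimage holomorphic_on_imp_continuous_on)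
    moreover have "V \<inter> (\<lambda>z. \<phi> (\<rho> z)) -` (\<phi> ` (U \<inter> W)) \<subseteq> \<rho> -` W"
      using V(3) cU(3) by (auto dest: inj_onD)
    moreover have "w \<in> V \<inter> (\<lambda>z. \<phi> (\<rho> z)) -` (\<phi> ` (U \<inter> W))" using V(2) w U(2) by blast
    ultimately show "\<exists>T. open T \<and> w \<in> T \<and> T \<subseteq> \<rho> -` W" by blast
  qed
  then have cont: "continuous_map euclidean (top_of Y) \<rho>"
    unfolding continuous_map_def using \<rho>(1) by (auto simp: vimage_def)
  have "(\<lambda>z. \<phi> (\<rho> z)) holomorphic_on \<rho> -` U" if U: "(U, \<phi>) \<in> atlas Y" for U \<phi>
  proof -
    have "(\<lambda>z. \<phi> (\<rho> z)) field_differentiable at w" if "\<rho> w \<in> U" for w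
      using local[OF U that] by (meson holomorphic_on_imp_differentiable_at)
    then show ?thesis by (auto simp: holomorphic_on_def intro: field_differentiable_at_within)
  qed
  then have "uniformized Y (common_preimage \<alpha> \<beta> L) \<rho>"
    using curve_Y discrete_common_preimage[OF X.discrete nonzero(1)] range cont fibre
    by unfold_locales
  then show ?thesis using that \<rho>(2,3) by blast
qed

end

section \<open>Iterates of a correspondence of tori\<close>

lemma complex_lattice_basis:
  assumes "complex_lattice \<Lambda>"
  obtains w1 w2 where "\<Lambda> = {of_int m * w1 + of_int n * w2 |m n. True}" "Im (w2 * cnj w1) \<noteq> 0"
proof -
  obtain w1 w2 where w: "w1 \<noteq> w2" "independent {w1, w2}"
    "\<Lambda> = {of_int m * w1 + of_int n * w2 |m n. True}"
    using assms unfolding complex_lattice_def by blast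
  have "Im (w2 * cnj w1) \<noteq> 0"
  proof
    assume "Im (w2 * cnj w1) = 0"
    then have "Im (w2 / w1) = 0" by (subst complex_div_cnj) (simp add: Im_divide_of_real)
    then have "w2 / w1 = of_real (Re (w2 / w1))" by (simp add: complex_eq_iff)
    moreover have "w1 \<noteq> 0" using w(2) dependent_zero by blast
    ultimately have "w2 = Re (w2 / w1) *\<^sub>R w1" by (metis nonzero_divide_eq_eq scaleR_conv_of_real)
    then have "w2 \<in> span {w1}" by (metis span_base span_scale singletonI)
    moreover have "independent (insert w2 {w1})" using w(2) by (simp add: insert_commute)
    ultimately show False using w(1) by (simp add: independent_insert)
  qed
  then show ?thesis using that w(3) by blast
qed

text \<open>Cramer's rule: \<open>Im (w2 * cnj w1)\<close> is the determinant of the basis over the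
  reals.\<close>

lemma basis_coefficients:
  assumes "l = of_int m * w1 + of_int n * w2"
  shows "Im (l * cnj w1) = of_int n * Im (w2 * cnj w1)" "Im (l * cnj w2) = - of_int m * Im (w2 * cnj w1)"
  unfolding assms by (simp_all add: algebra_simps)

lemma basis_combination_zero:
  assumes "of_int m * w1 + of_int n * w2 = 0" "Im (w2 * cnj w1) \<noteq> 0"
  shows "m = 0" "n = 0"
  using basis_coefficients[OF assms(1)[symmetric]] assms(2) by auto

text \<open>Cramer's rule bounds the coefficients of \<open>l\<close>: up to sign, each is at most
  \<open>norm l * M / D\<close>. For \<open>norm l < D / M\<close> they are integers of absolute
  value below 1.\<close>

lemma complex_lattice_discrete:
  assumes "complex_lattice \<Lambda>"
  shows "discrete_subgroup \<Lambda>"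
proof -
  obtain w1 w2 where w: "\<Lambda> = {of_int m * w1 + of_int n * w2 |m n. True}" "Im (w2 * cnj w1) \<noteq> 0"
    using complex_lattice_basis[OF assms] .
  define D where "D = \<bar>Im (w2 * cnj w1)\<bar>"
  define M where "M = norm w1 + norm w2"
  have "w1 \<noteq> 0" using w(2) by auto
  then have M: "M > 0" unfolding M_def by (simp add: add_pos_nonneg)
  have D: "D > 0" using w(2) by (simp add: D_def)
  have small: "k = 0" if "\<bar>of_int k\<bar> * D \<le> norm l * norm v" "norm v \<le> M" "norm l < D / M" for k :: int and l v :: complex
  proof -
    have "norm l * norm v \<le> norm l * M" using that(2) by (simp add: mult_left_mono)
    also have "\<dots> < D" using that(3) M by (simp add: field_simps)
    finally have "\<bar>of_int k\<bar> * D < 1 * D" using that(1) by simp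
    then have "\<bar>of_int k :: real\<bar> < 1" using D by (simp only: mult_less_cancel_right_pos)
    then show ?thesis by linarith
  qed
  have "l = 0" if l: "l \<in> \<Lambda>" "norm l < D / M" for l
  proof -
    obtain m n where mn: "l = of_int m * w1 + of_int n * w2" using l(1) w(1) by blast
    note c = basis_coefficients[OF mn]
    have "\<bar>Im (l * cnj w1)\<bar> \<le> norm (l * cnj w1)" "\<bar>Im (l * cnj w2)\<bar> \<le> norm (l * cnj w2)"
      by (rule abs_Im_le_cmod)+
    then have "\<bar>of_int n\<bar> * D \<le> norm l * norm w1" "\<bar>of_int m\<bar> * D \<le> norm l * norm w2"
      unfolding c by (simp_all add: D_def abs_mult norm_mult)
    moreover have "norm w1 \<le> M" "norm w2 \<le> M" by (simp_all add: M_def)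
    ultimately have "n = 0" "m = 0" using small l(2) by blast+
    then show ?thesis using mn by simp
  qed
  moreover have "D / M > 0" using D M by simp
  moreover have "0 \<in> \<Lambda>" unfolding w(1) by (auto intro!: exI[of _ 0])
  moreover have "x - y \<in> \<Lambda>" if xy: "x \<in> \<Lambda>" "y \<in> \<Lambda>" for x y
  proof -
    obtain m n m' n' where "x = of_int m * w1 + of_int n * w2" "y = of_int m' * w1 + of_int n' * w2"
      using xy w(1) by blast
    then have "x - y = of_int (m - m') * w1 + of_int (n - n') * w2" by (simp add: algebra_simps)
    then show ?thesis unfolding w(1) by blast
  qed
  ultimately show ?thesis unfolding discrete_subgroup_def by blast
qed

lemma coset_eq_iff:
  assumes "discrete_subgroup \<Lambda>"
  shows "coset \<Lambda> z = coset \<Lambda> w \<longleftrightarrow> z - w \<in> \<Lambda>"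
proof
  assume "coset \<Lambda> z = coset \<Lambda> w"
  moreover have "z \<in> coset \<Lambda> z"
    using assms unfolding coset_def discrete_subgroup_def by (auto intro!: image_eqI[of _ _ 0])
  ultimately obtain l where "l \<in> \<Lambda>" "z = w + l" unfolding coset_def by blast
  then show "z - w \<in> \<Lambda>" by simp
next
  have sub: "coset \<Lambda> z \<subseteq> coset \<Lambda> w" if "z - w \<in> \<Lambda>" for z w
  proof
    fix x assume "x \<in> coset \<Lambda> z"
    then obtain l where l: "l \<in> \<Lambda>" "x = z + l" unfolding coset_def by blast
    then have "x = w + ((z - w) + l)" "(z - w) + l \<in> \<Lambda>"
      using that discrete_subgroup_add[OF assms] by auto
    then show "x \<in> coset \<Lambda> w" unfolding coset_def by blast
  qed
  assume zw: "z - w \<in> \<Lambda>"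
  then have "w - z \<in> \<Lambda>" using discrete_subgroup_minus[OF assms zw] by simp
  then show "coset \<Lambda> z = coset \<Lambda> w" using sub zw by blast
qed

text \<open>In a chart of the torus the projection is locally a translation by a period. That the
  torus is a curve is assumed here because every correspondence asserts it of its two
  curves.\<close>

lemma complex_torus_uniformized:
  assumes "discrete_subgroup \<Lambda>" "curve (complex_torus \<Lambda>)"
  shows "uniformized (complex_torus \<Lambda>) \<Lambda> (coset \<Lambda>)"
proof
  have "openin (top_of (complex_torus \<Lambda>)) (range (coset \<Lambda>))"
    unfolding openin_complex_torus by (auto simp: vimage_def)
  then have "range (coset \<Lambda>) \<subseteq> points (complex_torus \<Lambda>)" by (rule openin_subset)
  moreover have "points (complex_torus \<Lambda>) \<subseteq> range (coset \<Lambda>)"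
    using openin_topspace[of "top_of (complex_torus \<Lambda>)"] unfolding openin_complex_torus by blast
  ultimately show range: "range (coset \<Lambda>) = points (complex_torus \<Lambda>)" by blast
  show "continuous_map euclidean (top_of (complex_torus \<Lambda>)) (coset \<Lambda>)"
    unfolding continuous_map_def using range
    by (auto simp: openin_complex_torus vimage_def simp flip: range)
  show "coset \<Lambda> z = coset \<Lambda> w \<longleftrightarrow> z - w \<in> \<Lambda>" for z w by (rule coset_eq_iff[OF assms(1)])
  fix U \<phi> assume "(U, \<phi>) \<in> atlas (complex_torus \<Lambda>)"
  then obtain V where V: "U = coset \<Lambda> ` V" "\<phi> = inv_into V (coset \<Lambda>)" "open V" "inj_on (coset \<Lambda>) V"
    unfolding complex_torus_def by auto
  have "(\<lambda>z. \<phi> (coset \<Lambda> z)) field_differentiable at z" if "coset \<Lambda> z \<in> U" for z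
  proof -
    obtain v where v: "v \<in> V" "coset \<Lambda> z = coset \<Lambda> v" using \<open>coset \<Lambda> z \<in> U\<close> V(1) by blast
    define T where "T = (\<lambda>u. u + (v - z)) -` V"
    have "v - z \<in> \<Lambda>" using v(2) coset_eq_iff[OF assms(1)] by metis
    then have "coset \<Lambda> (u + (v - z)) = coset \<Lambda> u" for u
      using coset_eq_iff[OF assms(1), of "u + (v - z)" u] by simp
    then have eq: "\<phi> (coset \<Lambda> u) = u + (v - z)" if "u \<in> T" for u
      using that V(2) inv_into_f_f[OF V(4), of "u + (v - z)"] unfolding T_def by simp
    have "open T" unfolding T_def by (intro open_vimage V(3) continuous_intros)
    moreover have "z \<in> T" using v(1) by (simp add: T_def)
    moreover have "(\<lambda>u. u + (v - z)) holomorphic_on T" by (intro holomorphic_intros)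
    then have "(\<lambda>z. \<phi> (coset \<Lambda> z)) holomorphic_on T"
      by (rule holomorphic_transform) (simp add: eq)
    ultimately show ?thesis by (meson holomorphic_on_imp_differentiable_at)
  qed
  then show "(\<lambda>z. \<phi> (coset \<Lambda> z)) holomorphic_on coset \<Lambda> -` U"
    by (auto simp: holomorphic_on_def intro: field_differentiable_at_within)
qed (use assms in auto)

section \<open>The iterates and their period lattices\<close>

text \<open>The recursion starts at \<open>\<Lambda>1\<close>: the first curve is given and is not a
  fiber product, so a priori \<open>\<Lambda>1\<close> is only contained in the common preimage of
  \<open>\<Lambda>0\<close>.\<close>

fun iterate_lattice :: "complex \<Rightarrow> complex \<Rightarrow> complex set \<Rightarrow> complex set \<Rightarrow> nat \<Rightarrow> complex set" where
  "iterate_lattice \<alpha> \<beta> \<Lambda>0 \<Lambda>1 0 = \<Lambda>0"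
| "iterate_lattice \<alpha> \<beta> \<Lambda>0 \<Lambda>1 (Suc 0) = \<Lambda>1"
| "iterate_lattice \<alpha> \<beta> \<Lambda>0 \<Lambda>1 (Suc (Suc n)) = common_preimage \<alpha> \<beta> (iterate_lattice \<alpha> \<beta> \<Lambda>0 \<Lambda>1 (Suc n))"

locale torus_correspondence =
  fixes \<Lambda>0 \<Lambda>1 :: "complex set" and C :: "nat \<Rightarrow> complex set surface"
    and f g :: "nat \<Rightarrow> complex set \<Rightarrow> complex set" and \<alpha> \<beta> \<gamma> \<delta> :: complex
  assumes lattice: "complex_lattice \<Lambda>0" "complex_lattice \<Lambda>1"
    and iterates: "iterates C f g"
    and C0: "C 0 = complex_torus \<Lambda>0" and C1: "C 1 = complex_torus \<Lambda>1"
    and f1: "f 1 (coset \<Lambda>1 z) = coset \<Lambda>0 (\<alpha> * z + \<gamma>)"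
    and g1: "g 1 (coset \<Lambda>1 z) = coset \<Lambda>0 (\<beta> * z + \<delta>)"
begin

abbreviation "L \<equiv> iterate_lattice \<alpha> \<beta> \<Lambda>0 \<Lambda>1"

lemma correspondence: "correspondence (C 0) (C 1) (f 1) (g 1)"
  and fiber_product: "fiber_product (C (Suc n)) (g (Suc n)) (C (Suc n)) (f (Suc n))
    (C (Suc (Suc n))) (f (Suc (Suc n))) (g (Suc (Suc n)))"
  using iterates unfolding iterates_def by simp_all

lemma discrete0: "discrete_subgroup \<Lambda>0" and discrete1: "discrete_subgroup \<Lambda>1"
  using lattice complex_lattice_discrete by auto

sublocale T0: uniformized "C 0" \<Lambda>0 "coset \<Lambda>0"
  using complex_torus_uniformized[OF discrete0] correspondence unfolding correspondence_def C0 by blast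

sublocale T1: uniformized "C 1" \<Lambda>1 "coset \<Lambda>1"
  using complex_torus_uniformized[OF discrete1] correspondence unfolding correspondence_def C1 by blast

text \<open>Slope zero would make a surjective map constant; the torus would be one point and
  \<open>\<Lambda>0\<close> the whole plane, which is not discrete.\<close>

lemma slope_nonzero:
  assumes "h ` points (C 1) = points (C 0)" "\<And>z. h (coset \<Lambda>1 z) = coset \<Lambda>0 (a * z + b)"
  shows "a \<noteq> 0"
proof
  assume "a = 0"
  then have "points (C 0) \<subseteq> {coset \<Lambda>0 b}"
    unfolding assms(1)[symmetric] T1.range[symmetric] using assms(2) by auto
  then have "coset \<Lambda>0 z = coset \<Lambda>0 0" for z using T0.in_points by (metis singletonD subset_iff)
  then have all: "z \<in> \<Lambda>0" for z using T0.fibre[of z 0] by simp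
  obtain e where e: "e > 0" "\<And>x. x \<in> \<Lambda>0 \<Longrightarrow> norm x < e \<Longrightarrow> x = 0"
    using discrete0 unfolding discrete_subgroup_def by auto
  from e(2)[OF all, of "of_real (e / 2)"] e(1) show False by (simp add: norm_divide)
qed

lemma slopes_nonzero: "\<alpha> \<noteq> 0" "\<beta> \<noteq> 0"
  using correspondence slope_nonzero[of "f 1" \<alpha> \<gamma>, OF _ f1] slope_nonzero[of "g 1" \<beta> \<delta>, OF _ g1]
  unfolding correspondence_def finite_surjective_map_def by auto

lemma slopes_lattice:
  assumes "l \<in> \<Lambda>1"
  shows "\<alpha> * l \<in> \<Lambda>0" "\<beta> * l \<in> \<Lambda>0"
proof -
  have l: "coset \<Lambda>1 l = coset \<Lambda>1 0" using assms T1.fibre by simp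
  show "\<alpha> * l \<in> \<Lambda>0" using f1[of l] f1[of 0] l T0.fibre[of "\<alpha> * l + \<gamma>" \<gamma>] by simp
  show "\<beta> * l \<in> \<Lambda>0" using g1[of l] g1[of 0] l T0.fibre[of "\<beta> * l + \<delta>" \<delta>] by simp
qed

lemma two_span_subset: "two_span \<alpha> \<beta> (L (Suc n)) \<subseteq> L n"
proof -
  have "discrete_subgroup (L n) \<and> (\<forall>l\<in>L (Suc n). \<alpha> * l \<in> L n \<and> \<beta> * l \<in> L n)"
    using discrete0 discrete1 slopes_lattice discrete_common_preimage slopes_nonzero(1)
    by (induction \<alpha> \<beta> \<Lambda>0 \<Lambda>1 n rule: iterate_lattice.induct) (auto simp: common_preimage_def[of _ _ "_ :: complex set"])
  then show ?thesis unfolding two_span_def using discrete_subgroup_add by blast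
qed

text \<open>Two consecutive curves are carried along because the next fiber product is taken over
  the earlier one. The slopes persist, while the translations become \<open>e\<close> and 0 at each
  step; hence \<open>c\<close> and \<open>d\<close> are existentially bound.\<close>

lemma uniformized_iterates:
  assumes "\<forall>k<n. two_span \<alpha> \<beta> (L (Suc k)) = L k"
  shows "\<exists>\<pi> \<pi>' c d. uniformized (C n) (L n) \<pi> \<and> uniformized (C (Suc n)) (L (Suc n)) \<pi>' \<and>
    (\<forall>z. f (Suc n) (\<pi>' z) = \<pi> (\<alpha> * z + c)) \<and> (\<forall>z. g (Suc n) (\<pi>' z) = \<pi> (\<beta> * z + d))"
  using assms
proof (induction n)
  case 0
  show ?case
    using T0.uniformized_axioms T1.uniformized_axioms f1 g1 by auto
next
  case (Suc n)
  then obtain \<pi> \<pi>' c d where u: "uniformized (C n) (L n) \<pi>" "uniformized (C (Suc n)) (L (Suc n)) \<pi>'"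
    "\<And>z. f (Suc n) (\<pi>' z) = \<pi> (\<alpha> * z + c)" "\<And>z. g (Suc n) (\<pi>' z) = \<pi> (\<beta> * z + d)"
    by (metis less_SucI)
  interpret affine_fiber_product "C (Suc n)" "L (Suc n)" \<pi>' "C n" "L n" \<pi> "f (Suc n)" "g (Suc n)"
    \<alpha> \<beta> c d "C (Suc (Suc n))" "f (Suc (Suc n))" "g (Suc (Suc n))"
    using u slopes_nonzero fiber_product
    by (intro affine_fiber_product.intro affine_fiber_product_axioms.intro)
  have "L n \<subseteq> two_span \<alpha> \<beta> (L (Suc n))" using Suc.prems by simp
  then obtain \<rho> e where "uniformized (C (Suc (Suc n))) (common_preimage \<alpha> \<beta> (L (Suc n))) \<rho>"
    "\<And>w. f (Suc (Suc n)) (\<rho> w) = \<pi>' (\<alpha> * w + e)" "\<And>w. g (Suc (Suc n)) (\<rho> w) = \<pi>' (\<beta> * w)"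
    using uniformized_fiber_product by blast
  then show ?case
    using u(2) by (intro exI[of _ \<pi>'] exI[of _ \<rho>] exI[of _ e] exI[of _ 0]) simp
qed

text \<open>To reach \<open>x\<close>, choose by induction a point \<open>x'\<close> whose image
  under \<open>f\<close> is the image of \<open>x\<close> under \<open>g\<close>; the pair lies in
  the fiber product. Surjectivity lets connectedness descend to the preceding curve.\<close>

lemma projection_surjective: "f (Suc n) ` points (C (Suc n)) = points (C n)"
proof (induction n)
  case 0
  then show ?case using correspondence unfolding correspondence_def finite_surjective_map_def by simp
next
  case (Suc n)
  have im: "(\<lambda>y. (f (Suc (Suc n)) y, g (Suc (Suc n)) y)) ` points (C (Suc (Suc n))) =
    {(x1, x2). x1 \<in> points (C (Suc n)) \<and> x2 \<in> points (C (Suc n)) \<and> g (Suc n) x1 = f (Suc n) x2}"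
    using fiber_product[of n] unfolding fiber_product_def normalization_of_def by blast
  have g: "g (Suc n) x \<in> points (C n)" if x: "x \<in> points (C (Suc n))" for x
  proof (cases n)
    case 0
    then show ?thesis
      using x correspondence unfolding correspondence_def finite_surjective_map_def by auto
  next
    case (Suc m)
    then show ?thesis
      using x fiber_product[of m]
      unfolding fiber_product_def normalization_of_def holomorphic_map_def continuous_map_def by auto
  qed
  show ?case
  proof
    show "f (Suc (Suc n)) ` points (C (Suc (Suc n))) \<subseteq> points (C (Suc n))" using im by blast
    show "points (C (Suc n)) \<subseteq> f (Suc (Suc n)) ` points (C (Suc (Suc n)))"
    proof
      fix x assume x: "x \<in> points (C (Suc n))"
      obtain x' where x': "x' \<in> points (C (Suc n))" "g (Suc n) x = f (Suc n) x'"
        using g[OF x] Suc by (metis imageE)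
      then have "(x, x') \<in> (\<lambda>y. (f (Suc (Suc n)) y, g (Suc (Suc n)) y)) ` points (C (Suc (Suc n)))"
        unfolding im using x by simp
      then show "x \<in> f (Suc (Suc n)) ` points (C (Suc (Suc n)))" by auto
    qed
  qed
qed

lemma connected_predecessor:
  assumes "connected_space (top_of (C (Suc n)))"
  shows "connected_space (top_of (C n))"
proof -
  have "continuous_map (top_of (C (Suc n))) (top_of (C n)) (f (Suc n))"
  proof (cases n)
    case 0
    then show ?thesis
      using correspondence unfolding correspondence_def finite_surjective_map_def holomorphic_map_def by simp
  next
    case (Suc m)
    then show ?thesis
      using fiber_product[of m]
      unfolding fiber_product_def normalization_of_def holomorphic_map_def by simp
  qed
  then have "connectedin (top_of (C n)) (f (Suc n) ` points (C (Suc n)))"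
    by (rule connectedin_continuous_map_image) (use assms in \<open>simp add: connectedin_topspace\<close>)
  then show ?thesis by (simp add: projection_surjective connectedin_topspace)
qed

text \<open>Given the earlier equations, the one with index \<open>k\<close> concerns
  \<open>C (k + 2)\<close>, so connectedness of \<open>C (n + 1)\<close> covers the indices below
  \<open>n\<close>. Smaller indices come first, by descent: only they make the fiber product one of
  uniformized curves, to which \<open>connected_imp_span\<close> applies.\<close>

lemma connected_imp_two_span:
  assumes "connected_space (top_of (C (Suc n)))"
  shows "\<forall>k<n. two_span \<alpha> \<beta> (L (Suc k)) = L k"
  using assms
proof (induction n)
  case (Suc n)
  then have IH: "\<forall>k<n. two_span \<alpha> \<beta> (L (Suc k)) = L k" using connected_predecessor by blast
  then obtain \<pi> \<pi>' c d where u: "uniformized (C n) (L n) \<pi>" "uniformized (C (Suc n)) (L (Suc n)) \<pi>'"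
    "\<And>z. f (Suc n) (\<pi>' z) = \<pi> (\<alpha> * z + c)" "\<And>z. g (Suc n) (\<pi>' z) = \<pi> (\<beta> * z + d)"
    using uniformized_iterates by metis
  interpret affine_fiber_product "C (Suc n)" "L (Suc n)" \<pi>' "C n" "L n" \<pi> "f (Suc n)" "g (Suc n)"
    \<alpha> \<beta> c d "C (Suc (Suc n))" "f (Suc (Suc n))" "g (Suc (Suc n))"
    using u slopes_nonzero fiber_product
    by (intro affine_fiber_product.intro affine_fiber_product_axioms.intro)
  have "two_span \<alpha> \<beta> (L (Suc n)) = L n"
    using connected_imp_span[OF Suc.prems] two_span_subset by blast
  then show ?case using IH less_Suc_eq by auto
qed simp

lemma irreducible_iff_two_span:
  "irreducible_curve (C (Suc n)) \<longleftrightarrow> (\<forall>k<n. two_span \<alpha> \<beta> (L (Suc k)) = L k)"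
proof
  assume "irreducible_curve (C (Suc n))"
  then show "\<forall>k<n. two_span \<alpha> \<beta> (L (Suc k)) = L k"
    using connected_imp_two_span irreducible_curve_imp_connected by blast
next
  assume "\<forall>k<n. two_span \<alpha> \<beta> (L (Suc k)) = L k"
  then show "irreducible_curve (C (Suc n))"
    using uniformized_iterates uniformized.irreducible by blast
qed

lemma stable_iff_two_span:
  "stable_correspondence C \<longleftrightarrow> (\<forall>n. two_span \<alpha> \<beta> (L (Suc n)) = L n)"
  unfolding stable_correspondence_def
proof (intro iffI allI)
  show "two_span \<alpha> \<beta> (L (Suc n)) = L n" if "\<forall>n. irreducible_curve (C n)" for n
    using that irreducible_iff_two_span[of "Suc n"] by blast
  show "irreducible_curve (C n)" if "\<forall>n. two_span \<alpha> \<beta> (L (Suc n)) = L n" for n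
    using that irreducible_iff_two_span T0.irreducible by (cases n) auto
qed

lemma stable_imp_genus:
  assumes "stable_correspondence C"
  shows "genus (C n) = 1"
proof -
  have "\<forall>k<n. two_span \<alpha> \<beta> (L (Suc k)) = L k" using assms stable_iff_two_span by blast
  then show ?thesis using uniformized_iterates uniformized.genus_eq_1 by blast
qed

end

section \<open>Lattices and their multiplier rings\<close>

definition unital_subring :: "complex set \<Rightarrow> bool" where
  "unital_subring R \<longleftrightarrow> 1 \<in> R \<and> (\<forall>x \<in> R. \<forall>y \<in> R. x - y \<in> R \<and> x * y \<in> R)"

lemma unital_subringD:
  assumes "unital_subring R"
  shows "1 \<in> R" "0 \<in> R" "x \<in> R \<Longrightarrow> y \<in> R \<Longrightarrow> x + y \<in> R" "x \<in> R \<Longrightarrow> y \<in> R \<Longrightarrow> x - y \<in> R"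
    "x \<in> R \<Longrightarrow> y \<in> R \<Longrightarrow> x * y \<in> R" "x \<in> R \<Longrightarrow> - x \<in> R"
proof -
  have d: "\<And>x y. x \<in> R \<Longrightarrow> y \<in> R \<Longrightarrow> x - y \<in> R \<and> x * y \<in> R" and "1 \<in> R"
    using assms unfolding unital_subring_def by auto
  show "1 \<in> R" by fact
  then show 0: "0 \<in> R" using d[of 1 1] by simp
  show minus: "x \<in> R \<Longrightarrow> - x \<in> R" for x using d[OF 0, of x] by simp
  show "x \<in> R \<Longrightarrow> y \<in> R \<Longrightarrow> x + y \<in> R" using d[of x "- y"] minus by auto
  show "x \<in> R \<Longrightarrow> y \<in> R \<Longrightarrow> x - y \<in> R" "x \<in> R \<Longrightarrow> y \<in> R \<Longrightarrow> x * y \<in> R" using d by auto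
qed

lemma unital_subring_of_int:
  assumes "unital_subring R"
  shows "of_int n \<in> R"
proof (induction n rule: int_induct[where k = 0])
  case (step1 i)
  then show ?case using unital_subringD(1,3)[OF assms] by simp
next
  case (step2 i)
  then show ?case using unital_subringD(1,4)[OF assms] by simp
qed (simp add: unital_subringD[OF assms])

lemma unital_subring_multiplier_ring:
  assumes "discrete_subgroup \<Lambda>"
  shows "unital_subring (multiplier_ring \<Lambda>)"
  using assms unfolding unital_subring_def multiplier_ring_def discrete_subgroup_def
  by (auto simp: left_diff_distrib mult.assoc)

lemma fraction_fieldI: "x = a / b \<Longrightarrow> a \<in> R \<Longrightarrow> b \<in> R \<Longrightarrow> b \<noteq> 0 \<Longrightarrow> x \<in> fraction_field R"
  unfolding fraction_field_def by blast

text \<open>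
  For an ideal \<open>\<alpha>R + \<beta>R\<close>, invertibility means that \<open>1 = \<alpha>x + \<beta>y\<close> for some \<open>x, y\<close> in the inverse.
  This form makes sense without reference to a fraction field and is invariant under scaling.
\<close>

definition unit_combination :: "complex set \<Rightarrow> complex \<Rightarrow> complex \<Rightarrow> bool" where
  "unit_combination R \<alpha> \<beta> \<longleftrightarrow>
     (\<exists>x y. \<alpha> * x + \<beta> * y = 1 \<and> \<alpha> * x \<in> R \<and> \<beta> * x \<in> R \<and> \<alpha> * y \<in> R \<and> \<beta> * y \<in> R)"

lemma unit_combination_scale:
  assumes "c \<noteq> 0"
  shows "unit_combination R (c * \<alpha>) (c * \<beta>) \<longleftrightarrow> unit_combination R \<alpha> \<beta>"
proof
  assume "unit_combination R (c * \<alpha>) (c * \<beta>)"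
  then obtain x y where "c * \<alpha> * x + c * \<beta> * y = 1" "c * \<alpha> * x \<in> R" "c * \<beta> * x \<in> R"
    "c * \<alpha> * y \<in> R" "c * \<beta> * y \<in> R" unfolding unit_combination_def by blast
  then show "unit_combination R \<alpha> \<beta>"
    unfolding unit_combination_def
    by (intro exI[of _ "c * x"] exI[of _ "c * y"]) (simp add: ac_simps)
next
  assume "unit_combination R \<alpha> \<beta>"
  then obtain x y where "\<alpha> * x + \<beta> * y = 1" "\<alpha> * x \<in> R" "\<beta> * x \<in> R" "\<alpha> * y \<in> R" "\<beta> * y \<in> R"
    unfolding unit_combination_def by blast
  then show "unit_combination R (c * \<alpha>) (c * \<beta>)"
    unfolding unit_combination_def using assms
    by (intro exI[of _ "x / c"] exI[of _ "y / c"]) simp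
qed

text \<open>Write \<open>1 = (\<Sum>i<n. a i * b i)\<close> with
  \<open>a i = \<alpha> * x i + \<beta> * y i\<close> and collect the multiples of \<alpha> and of
  \<beta>: the coefficients are the sums of \<open>x i * b i\<close> and of
  \<open>y i * b i\<close>.\<close>

lemma invertible_imp_unit_combination:
  assumes R: "unital_subring R" and inv: "invertible_fractional_ideal R (two_span \<alpha> \<beta> R)"
  shows "unit_combination R \<alpha> \<beta>"
proof -
  note R' = unital_subringD[OF R]
  have "1 \<in> ideal_product (two_span \<alpha> \<beta> R) (ideal_inverse R (two_span \<alpha> \<beta> R))"
    using inv R'(1) unfolding invertible_fractional_ideal_def by simp
  then obtain n :: nat and a b where ab: "1 = (\<Sum>i<n. a i * b i)"
    "\<And>i. i < n \<Longrightarrow> a i \<in> two_span \<alpha> \<beta> R" "\<And>i. i < n \<Longrightarrow> b i \<in> ideal_inverse R (two_span \<alpha> \<beta> R)"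
    unfolding ideal_product_def by blast
  have "\<exists>x y. x \<in> R \<and> y \<in> R \<and> a i = \<alpha> * x + \<beta> * y" if "i < n" for i
    using ab(2)[OF that] unfolding two_span_def by blast
  then obtain x y where xy: "\<And>i. i < n \<Longrightarrow> x i \<in> R \<and> y i \<in> R \<and> a i = \<alpha> * x i + \<beta> * y i" by metis
  have "\<alpha> * 1 + \<beta> * 0 \<in> two_span \<alpha> \<beta> R" "\<alpha> * 0 + \<beta> * 1 \<in> two_span \<alpha> \<beta> R"
    using R'(1,2) unfolding two_span_def by blast+
  then have b: "b i * \<alpha> \<in> R" "b i * \<beta> \<in> R" if "i < n" for i
    using ab(3)[OF that] unfolding ideal_inverse_def by auto
  have sum: "(\<Sum>i<n. h i) \<in> R" if "\<And>i. i < n \<Longrightarrow> h i \<in> R" for h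
    using that R'(2,3) by (induction n) auto
  have mem: "\<mu> * (\<Sum>i<n. h i * b i) \<in> R" if "\<And>i. i < n \<Longrightarrow> h i \<in> R" "\<mu> = \<alpha> \<or> \<mu> = \<beta>" for h \<mu>
  proof -
    have "\<mu> * (\<Sum>i<n. h i * b i) = (\<Sum>i<n. h i * (b i * \<mu>))"
      by (simp add: sum_distrib_left ac_simps)
    also have "\<dots> \<in> R" using that b R'(5) by (intro sum) blast
    finally show ?thesis .
  qed
  have "1 = (\<Sum>i<n. (\<alpha> * x i + \<beta> * y i) * b i)" unfolding ab(1) using xy by (intro sum.cong) auto
  also have "\<dots> = \<alpha> * (\<Sum>i<n. x i * b i) + \<beta> * (\<Sum>i<n. y i * b i)"
    by (simp add: sum_distrib_left sum.distrib algebra_simps)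
  finally show ?thesis
    unfolding unit_combination_def using mem[of x] mem[of y] xy
    by (intro exI[of _ "\<Sum>i<n. x i * b i"] exI[of _ "\<Sum>i<n. y i * b i"]) simp
qed

text \<open>The coefficients \<open>x\<close> and \<open>y\<close> lie in the inverse ideal, and
  \<open>r = (\<alpha> * r) * x + (\<beta> * r) * y\<close> places every \<open>r\<close> of the
  ring in the product.\<close>

lemma unit_combination_imp_invertible:
  assumes R: "unital_subring R" and frac: "\<alpha> \<in> fraction_field R" "\<beta> \<in> fraction_field R"
    and "\<alpha> \<noteq> 0" and unit: "unit_combination R \<alpha> \<beta>"
  shows "invertible_fractional_ideal R (two_span \<alpha> \<beta> R)"
proof -
  note R' = unital_subringD[OF R]
  let ?J = "two_span \<alpha> \<beta> R"
  obtain a b where ab: "\<alpha> = a / b" "a \<in> R" "b \<in> R" "b \<noteq> 0" using frac(1) unfolding fraction_field_def by blast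
  obtain a' b' where ab': "\<beta> = a' / b'" "a' \<in> R" "b' \<in> R" "b' \<noteq> 0"
    using frac(2) unfolding fraction_field_def by blast
  obtain x y where xy: "\<alpha> * x + \<beta> * y = 1" "\<alpha> * x \<in> R" "\<beta> * x \<in> R" "\<alpha> * y \<in> R" "\<beta> * y \<in> R"
    using unit unfolding unit_combination_def by blast
  \<comment> \<open>The product of the denominators of \<alpha> and \<beta> clears the denominators
    of the whole ideal.\<close>
  have denom: "(b * b') * z \<in> R" if "z \<in> ?J" for z
  proof -
    obtain u v where uv: "u \<in> R" "v \<in> R" "z = \<alpha> * u + \<beta> * v" using \<open>z \<in> ?J\<close> unfolding two_span_def by blast
    have "(b * b') * z = (a * b') * u + (a' * b) * v"
      unfolding uv(3) ab(1) ab'(1) using ab(4) ab'(4) by (simp add: field_simps)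
    then show ?thesis using R'(3,5) uv ab ab' by simp
  qed
  have bb: "b * b' \<in> R" "b * b' \<noteq> 0" using R'(5) ab ab' by auto
  have sub: "z \<in> fraction_field R" if "z \<in> ?J" for z
  proof -
    have "z = ((b * b') * z) / (b * b')" using bb by simp
    then show ?thesis using denom[OF that] bb by (rule fraction_fieldI)
  qed
  have "\<alpha> * 1 + \<beta> * 0 \<in> ?J" "\<alpha> * 0 + \<beta> * 0 \<in> ?J" using R'(1,2) unfolding two_span_def by blast+
  then have zero: "0 \<in> ?J" "?J \<noteq> {0}" using \<open>\<alpha> \<noteq> 0\<close> by auto
  have add: "z + w \<in> ?J" if "z \<in> ?J" "w \<in> ?J" for z w
    using two_span_add[OF _ that] R'(3) by blast
  have mult: "r * z \<in> ?J" if rz: "r \<in> R" "z \<in> ?J" for r z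
  proof -
    obtain u v where uv: "u \<in> R" "v \<in> R" "z = \<alpha> * u + \<beta> * v" using rz unfolding two_span_def by blast
    have "r * z = \<alpha> * (r * u) + \<beta> * (r * v)" unfolding uv(3) by (simp add: algebra_simps)
    then show ?thesis using R'(5) rz uv unfolding two_span_def by blast
  qed
  have ideal: "fractional_ideal R ?J"
    unfolding fractional_ideal_def
  proof (intro conjI ballI)
    show "\<exists>d\<in>R. d \<noteq> 0 \<and> (\<forall>x\<in>?J. d * x \<in> R)" using denom bb by blast
  qed (use sub zero add mult in auto)
  have inverse: "z \<in> ideal_inverse R ?J" if z: "\<alpha> * z \<in> R" "\<beta> * z \<in> R" for z
  proof -
    \<comment> \<open>Elements of \<open>ideal_inverse\<close> must lie in the fraction field; this
      follows from \<open>\<alpha> * z \<in> R\<close> and \<open>\<alpha> = a / b\<close>.\<close>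
    have "z = ((\<alpha> * z) * b) / a" "a \<noteq> 0" using \<open>\<alpha> \<noteq> 0\<close> ab by auto
    then have "z \<in> fraction_field R" using fraction_fieldI R'(5)[OF z(1) ab(3)] ab(2) by blast
    moreover have "z * j \<in> R" if j: "j \<in> ?J" for j
    proof -
      obtain u v where uv: "u \<in> R" "v \<in> R" "j = \<alpha> * u + \<beta> * v" using j unfolding two_span_def by blast
      have "z * j = (\<alpha> * z) * u + (\<beta> * z) * v" unfolding uv(3) by (simp add: algebra_simps)
      then show ?thesis using R'(3,5) z uv by simp
    qed
    ultimately show ?thesis unfolding ideal_inverse_def by blast
  qed
  have "ideal_product ?J (ideal_inverse R ?J) = R"
  proof
    show "ideal_product ?J (ideal_inverse R ?J) \<subseteq> R"
    proof
      fix z assume "z \<in> ideal_product ?J (ideal_inverse R ?J)"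
      then obtain n :: nat and a b where z: "z = (\<Sum>i<n. a i * b i)"
        "\<forall>i<n. a i \<in> ?J \<and> b i \<in> ideal_inverse R ?J" unfolding ideal_product_def by blast
      have "a i * b i \<in> R" if "i < n" for i
        using z(2) that unfolding ideal_inverse_def by (auto simp: mult.commute)
      then have "(\<Sum>i<n. a i * b i) \<in> R" using R'(2,3) by (induction n) auto
      then show "z \<in> R" using z(1) by simp
    qed
    show "R \<subseteq> ideal_product ?J (ideal_inverse R ?J)"
    proof
      fix r assume r: "r \<in> R"
      define a where "a i = (if i = 0 then \<alpha> * r + \<beta> * 0 else \<alpha> * 0 + \<beta> * r)" for i :: nat
      define b where "b i = (if i = 0 then x else y)" for i :: nat
      have "\<alpha> * r + \<beta> * 0 \<in> ?J" "\<alpha> * 0 + \<beta> * r \<in> ?J"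
        using r R'(2) unfolding two_span_def by blast+
      then have "a i \<in> ?J" for i unfolding a_def by simp
      moreover have "b i \<in> ideal_inverse R ?J" for i using inverse xy unfolding b_def by simp
      moreover have "r = r * (\<alpha> * x + \<beta> * y)" using xy(1) by simp
      then have "r = (\<Sum>i<2. a i * b i)"
        by (simp add: numeral_2_eq_2 a_def b_def algebra_simps)
      ultimately show "r \<in> ideal_product ?J (ideal_inverse R ?J)" unfolding ideal_product_def by blast
    qed
  qed
  then show ?thesis using ideal unfolding invertible_fractional_ideal_def by blast
qed

text \<open>
  Every lattice with extra multiplications is an invertible module over its multiplier ring: if
  \<open>\<tau>\<close> is the quotient of the basis and \<open>a\<tau>\<^sup>2 + b\<tau> + c = 0\<close> with \<open>gcd a b c = 1\<close>, then the product
  of \<open>\<int> + \<int>\<tau>\<close> with \<open>\<int>a + \<int>a\<tau>'\<close>, for the conjugate \<open>\<tau>'\<close> of \<open>\<tau>\<close>, contains \<open>a\<close>, \<open>-b = a\<tau> + a\<tau>'\<close>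
  and \<open>c = a\<tau>\<tau>'\<close>.
\<close>

lemma lattice_invertible_over_multiplier_ring:
  assumes \<Lambda>: "complex_lattice \<Lambda>" and CM: "multiplier_ring \<Lambda> \<noteq> \<int>"
  obtains l1 l2 m1 m2 where "l1 \<in> \<Lambda>" "l2 \<in> \<Lambda>" "l1 * m1 + l2 * m2 = 1"
    "\<And>l. l \<in> \<Lambda> \<Longrightarrow> m1 * l \<in> multiplier_ring \<Lambda>" "\<And>l. l \<in> \<Lambda> \<Longrightarrow> m2 * l \<in> multiplier_ring \<Lambda>"
proof -
  let ?R = "multiplier_ring \<Lambda>"
  have disc: "discrete_subgroup \<Lambda>" using complex_lattice_discrete[OF \<Lambda>] .
  have R: "unital_subring ?R" using unital_subring_multiplier_ring[OF disc] .
  note R' = unital_subringD[OF R] and Z = unital_subring_of_int[OF R]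
  obtain w1 w2 where w: "\<Lambda> = {of_int m * w1 + of_int n * w2 |m n. True}" "Im (w2 * cnj w1) \<noteq> 0"
    using complex_lattice_basis[OF \<Lambda>] .
  have w1: "w1 \<noteq> 0" using w(2) by auto
  have "of_int 1 * w1 + of_int 0 * w2 \<in> \<Lambda>" "of_int 0 * w1 + of_int 1 * w2 \<in> \<Lambda>"
    unfolding w(1) by blast+
  then have w\<Lambda>: "w1 \<in> \<Lambda>" "w2 \<in> \<Lambda>" by simp_all
  have int\<Lambda>: "of_int m * l \<in> \<Lambda>" if "l \<in> \<Lambda>" for m l
    using Z[of m] that unfolding multiplier_ring_def by blast
  define \<tau> where "\<tau> = w2 / w1"
  have w2: "w2 = \<tau> * w1" using w1 by (simp add: \<tau>_def)
  have "\<int> \<subseteq> ?R" using Z by (auto simp: Ints_def)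
  then obtain s where s: "s \<in> ?R" "s \<notin> \<int>" using CM by blast
  obtain p q where pq: "s * w1 = of_int p * w1 + of_int q * w2"
    using s(1) w\<Lambda>(1) w(1) unfolding multiplier_ring_def by blast
  obtain r t where rt: "s * w2 = of_int r * w1 + of_int t * w2"
    using s(1) w\<Lambda>(2) w(1) unfolding multiplier_ring_def by blast
  have s_eq: "s = of_int p + of_int q * \<tau>"
  proof -
    have "s * w1 = (of_int p + of_int q * \<tau>) * w1" using pq w2 by (simp add: algebra_simps)
    then show ?thesis using w1 by simp
  qed
  have "q \<noteq> 0" using s(2) s_eq by auto
  have st: "s * \<tau> = of_int r + of_int t * \<tau>"
  proof -
    have "s * \<tau> * w1 = (of_int r + of_int t * \<tau>) * w1" using rt w2 by (simp add: algebra_simps)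
    then show ?thesis using w1 by simp
  qed
  \<comment> \<open>The two expressions for \<open>s * \<tau>\<close> give
    \<open>q * \<tau>\<^sup>2 + (p - t) * \<tau> - r = 0\<close>. The content of this equation is
    \<open>g\<close>, and dividing by it leaves the coprime coefficients \<open>a\<close>,
    \<open>b\<close>, \<open>c\<close>.\<close>
  define g where "g = gcd q (gcd (p - t) (- r))"
  have g: "g \<noteq> 0" using \<open>q \<noteq> 0\<close> by (simp add: g_def)
  have "g dvd q" "g dvd p - t" "g dvd - r"
    unfolding g_def by (meson dvd_trans gcd_dvd1 gcd_dvd2)+
  then obtain a b c where abc: "q = g * a" "p - t = g * b" "- r = g * c" by (meson dvdE)
  obtain u' v' where "u' * (p - t) + v' * (- r) = gcd (p - t) (- r)" using bezout_int by blast
  moreover obtain u v where "u * q + v * gcd (p - t) (- r) = g" using bezout_int unfolding g_def by blast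
  ultimately have "u * q + (v * u') * (p - t) + (v * v') * (- r) = g"
    by (metis distrib_left mult.assoc add.assoc)
  then have "g * (u * a + (v * u') * b + (v * v') * c) = g * 1" unfolding abc by (simp add: algebra_simps)
  then obtain x y z :: int where xyz: "x * a + y * b + z * c = 1" using g by (metis mult_cancel_left)
  have "of_int g * (of_int a * \<tau>\<^sup>2 + of_int b * \<tau> + of_int c) = of_int q * \<tau>\<^sup>2 + of_int (p - t) * \<tau> + of_int (- r)"
    unfolding abc by (simp add: algebra_simps)
  also have "\<dots> = s * \<tau> - (of_int r + of_int t * \<tau>)" unfolding s_eq by (simp add: algebra_simps power2_eq_square)
  also have "\<dots> = 0" using st by simp
  finally have quad: "of_int a * \<tau>\<^sup>2 + of_int b * \<tau> + of_int c = 0" using g by simp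
  have a\<tau>: "of_int a * \<tau> \<in> ?R"
    unfolding multiplier_ring_def
  proof (intro CollectI ballI)
    fix l assume "l \<in> \<Lambda>"
    then obtain m n where l: "l = of_int m * w1 + of_int n * w2" using w(1) by blast
    have "of_int a * \<tau> * l = of_int (m * a) * w2 + of_int n * (of_int a * \<tau>\<^sup>2) * w1"
      unfolding l w2 by (simp add: algebra_simps power2_eq_square)
    also have "of_int a * \<tau>\<^sup>2 = - (of_int b * \<tau> + of_int c)" using quad by (simp add: add_eq_0_iff2 add.assoc)
    also have "of_int (m * a) * w2 + of_int n * - (of_int b * \<tau> + of_int c) * w1 =
      of_int (- n * c) * w1 + of_int (m * a - n * b) * w2"
      unfolding w2 by (simp add: algebra_simps)
    finally show "of_int a * \<tau> * l \<in> \<Lambda>" unfolding w(1) by blast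
  qed
  \<comment> \<open>By the sum of the roots this is \<open>a\<close> times the conjugate of \<tau>;
    the product of the roots then gives \<open>\<tau> * e = c\<close>.\<close>
  define e where "e = - of_int b - of_int a * \<tau>"
  have e: "e \<in> ?R" unfolding e_def using R'(4,6) Z a\<tau> by simp
  have \<tau>e: "\<tau> * e = of_int c"
    using quad unfolding e_def by (simp add: algebra_simps power2_eq_square add_eq_0_iff2)
  have mult_a: "of_int a * (l / w1) \<in> ?R" and mult_e: "e * (l / w1) \<in> ?R" if "l \<in> \<Lambda>" for l
  proof -
    obtain m n where l: "l = of_int m * w1 + of_int n * w2" using \<open>l \<in> \<Lambda>\<close> w(1) by blast
    have lw: "l / w1 = of_int m + of_int n * \<tau>" unfolding l w2 using w1 by (simp add: add_divide_distrib)
    have "of_int a * (l / w1) = of_int (a * m) + of_int n * (of_int a * \<tau>)"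
      unfolding lw by (simp add: algebra_simps)
    then show "of_int a * (l / w1) \<in> ?R" using R'(3,5) Z a\<tau> by simp
    have "e * (l / w1) = e * of_int m + of_int n * (\<tau> * e)" unfolding lw by (simp add: algebra_simps)
    then show "e * (l / w1) \<in> ?R" unfolding \<tau>e using R'(3,5) Z e by simp
  qed
  \<comment> \<open>With \<open>b = - e - a * \<tau>\<close> and \<open>c = \<tau> * e\<close>, the
    relation \<open>x * a + y * b + z * c = 1\<close> is sorted by the factors 1 and \<tau>, which
    belong to \<open>w1\<close> and \<open>w2\<close>.\<close>
  define m1 m2 where "m1 = (of_int x * of_int a - of_int y * e) / w1"
    and "m2 = (of_int z * e - of_int y * of_int a) / w1"
  have "m1 * l = of_int x * (of_int a * (l / w1)) - of_int y * (e * (l / w1))"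
    "m2 * l = of_int z * (e * (l / w1)) - of_int y * (of_int a * (l / w1))" for l
    unfolding m1_def m2_def using w1 by (simp_all add: field_simps)
  then have "m1 * l \<in> ?R" "m2 * l \<in> ?R" if "l \<in> \<Lambda>" for l
    by (simp_all only:) (intro R'(4) R'(5) Z mult_a mult_e that)+
  moreover have "w1 * m1 + w2 * m2 = 1"
  proof -
    have "w1 * m1 + w2 * m2 = of_int x * of_int a + of_int y * (- e - of_int a * \<tau>) + of_int z * (\<tau> * e)"
      unfolding m1_def m2_def w2 using w1 by (simp add: field_simps)
    also have "\<dots> = of_int (x * a + y * b + z * c)" unfolding \<tau>e unfolding e_def by simp
    finally show ?thesis unfolding xyz by simp
  qed
  ultimately show ?thesis using that w\<Lambda> by blast
qed

text \<open>Expressing \<open>l1\<close> and \<open>l2\<close> through the span turns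
  \<open>l1 * m1 + l2 * m2 = 1\<close> into a relation
  \<open>\<alpha> * x + \<beta> * y = 1\<close>. Common preimages are carried into \<Lambda> by
  \<alpha> and \<beta>, and \<open>m1\<close>, \<open>m2\<close> carry \<Lambda> into the
  ring.\<close>

lemma two_span_common_preimage_imp_unit_combination:
  assumes "complex_lattice \<Lambda>" "multiplier_ring \<Lambda> \<noteq> \<int>"
    and "two_span \<alpha> \<beta> (common_preimage \<alpha> \<beta> \<Lambda>) = \<Lambda>"
  shows "unit_combination (multiplier_ring \<Lambda>) \<alpha> \<beta>"
proof -
  let ?R = "multiplier_ring \<Lambda>"
  note R' = unital_subringD[OF unital_subring_multiplier_ring[OF complex_lattice_discrete[OF assms(1)]]]
  obtain l1 l2 m1 m2 where lm: "l1 \<in> \<Lambda>" "l2 \<in> \<Lambda>" "l1 * m1 + l2 * m2 = 1"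
    "\<And>l. l \<in> \<Lambda> \<Longrightarrow> m1 * l \<in> ?R" "\<And>l. l \<in> \<Lambda> \<Longrightarrow> m2 * l \<in> ?R"
    by (rule lattice_invertible_over_multiplier_ring[OF assms(1,2)]) (rule that)
  obtain x1 y1 where 1: "x1 \<in> common_preimage \<alpha> \<beta> \<Lambda>" "y1 \<in> common_preimage \<alpha> \<beta> \<Lambda>" "l1 = \<alpha> * x1 + \<beta> * y1"
    using lm(1) assms(3) two_span_iff by metis
  obtain x2 y2 where 2: "x2 \<in> common_preimage \<alpha> \<beta> \<Lambda>" "y2 \<in> common_preimage \<alpha> \<beta> \<Lambda>" "l2 = \<alpha> * x2 + \<beta> * y2"
    using lm(2) assms(3) two_span_iff by metis
  have mem: "\<mu> * (v1 * m1 + v2 * m2) \<in> ?R" if "\<mu> * v1 \<in> \<Lambda>" "\<mu> * v2 \<in> \<Lambda>" for \<mu> v1 v2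
  proof -
    have "\<mu> * (v1 * m1 + v2 * m2) = m1 * (\<mu> * v1) + m2 * (\<mu> * v2)" by (simp add: algebra_simps)
    then show ?thesis using R'(3) lm(4)[OF that(1)] lm(5)[OF that(2)] by simp
  qed
  have "\<alpha> * (x1 * m1 + x2 * m2) + \<beta> * (y1 * m1 + y2 * m2) = 1"
    using lm(3) unfolding 1(3) 2(3) by (simp add: algebra_simps)
  then show ?thesis
    unfolding unit_combination_def using mem 1 2
    by (intro exI[of _ "x1 * m1 + x2 * m2"] exI[of _ "y1 * m1 + y2 * m2"])
      (auto simp: common_preimage_def)
qed

text \<open>Use \<open>l = \<alpha> * (x * l) + \<beta> * (y * l)\<close>. Only a module
  \<open>M\<close> over \<open>R\<close> is asked for, so one combination over the multiplier ring
  of \<open>\<Lambda>1\<close> serves all later lattices.\<close>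

lemma unit_combination_imp_two_span_common_preimage:
  assumes "unit_combination R \<alpha> \<beta>" "\<And>x y. x \<in> M \<Longrightarrow> y \<in> M \<Longrightarrow> x + y \<in> M"
    "\<And>r x. r \<in> R \<Longrightarrow> x \<in> M \<Longrightarrow> r * x \<in> M"
  shows "two_span \<alpha> \<beta> (common_preimage \<alpha> \<beta> M) = M"
proof
  show "two_span \<alpha> \<beta> (common_preimage \<alpha> \<beta> M) \<subseteq> M"
    using assms(2) unfolding two_span_def common_preimage_def by blast
  obtain x y where xy: "\<alpha> * x + \<beta> * y = 1" "\<alpha> * x \<in> R" "\<beta> * x \<in> R" "\<alpha> * y \<in> R" "\<beta> * y \<in> R"
    using assms(1) unfolding unit_combination_def by blast
  show "M \<subseteq> two_span \<alpha> \<beta> (common_preimage \<alpha> \<beta> M)"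
  proof
    fix l assume l: "l \<in> M"
    have "x * l \<in> common_preimage \<alpha> \<beta> M" "y * l \<in> common_preimage \<alpha> \<beta> M"
      using assms(3)[OF _ l] xy unfolding common_preimage_def by (auto simp: mult.assoc[symmetric])
    moreover have "l = \<alpha> * (x * l) + \<beta> * (y * l)"
      using xy(1) by (simp add: mult.assoc[symmetric] distrib_right[symmetric])
    ultimately show "l \<in> two_span \<alpha> \<beta> (common_preimage \<alpha> \<beta> M)" unfolding two_span_def by blast
  qed
qed

text \<open>\<open>N\<close> is the determinant of multiplication by \<alpha> in the two bases, and
  the adjugate matrix writes \<open>N * l\<close> as \<alpha> times an element of \<Lambda>. If
  \<open>N\<close> were 0, independence of \<open>w1\<close> and \<open>w2\<close> would make the
  adjugate zero, hence also \<open>\<alpha> * w1\<close>.\<close>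

lemma lattice_finite_index:
  assumes "complex_lattice \<Lambda>" "complex_lattice \<Lambda>'" "\<alpha> \<noteq> 0" "\<And>l. l \<in> \<Lambda> \<Longrightarrow> \<alpha> * l \<in> \<Lambda>'"
  obtains N :: int where "N \<noteq> 0" "\<And>l. l \<in> \<Lambda>' \<Longrightarrow> \<exists>m\<in>\<Lambda>. of_int N * l = \<alpha> * m"
proof -
  obtain w1 w2 where w: "\<Lambda> = {of_int m * w1 + of_int n * w2 |m n. True}" "Im (w2 * cnj w1) \<noteq> 0"
    using complex_lattice_basis[OF assms(1)] .
  obtain u1 u2 where u: "\<Lambda>' = {of_int m * u1 + of_int n * u2 |m n. True}" "Im (u2 * cnj u1) \<noteq> 0"
    using complex_lattice_basis[OF assms(2)] .
  have "of_int 1 * w1 + of_int 0 * w2 \<in> \<Lambda>" "of_int 0 * w1 + of_int 1 * w2 \<in> \<Lambda>"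
    unfolding w(1) by blast+
  then have "\<alpha> * w1 \<in> \<Lambda>'" "\<alpha> * w2 \<in> \<Lambda>'" using assms(4) by simp_all
  then obtain a b c d where ab: "\<alpha> * w1 = of_int a * u1 + of_int b * u2"
    and cd: "\<alpha> * w2 = of_int c * u1 + of_int d * u2" unfolding u(1) by blast
  define N where "N = a * d - b * c"
  have 1: "of_int N * u1 = \<alpha> * (of_int d * w1 + of_int (- b) * w2)"
  proof -
    have "\<alpha> * (of_int d * w1 + of_int (- b) * w2) = of_int d * (\<alpha> * w1) - of_int b * (\<alpha> * w2)"
      by (simp add: algebra_simps)
    then show ?thesis unfolding ab cd N_def by (simp add: algebra_simps)
  qed
  have 2: "of_int N * u2 = \<alpha> * (of_int (- c) * w1 + of_int a * w2)"
  proof -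
    have "\<alpha> * (of_int (- c) * w1 + of_int a * w2) = of_int a * (\<alpha> * w2) - of_int c * (\<alpha> * w1)"
      by (simp add: algebra_simps)
    then show ?thesis unfolding ab cd N_def by (simp add: algebra_simps)
  qed
  have "N \<noteq> 0"
  proof
    assume "N = 0"
    then have "of_int d * w1 + of_int (- b) * w2 = 0" "of_int (- c) * w1 + of_int a * w2 = 0"
      using 1 2 assms(3) by simp_all
    from basis_combination_zero[OF this(1) w(2)] basis_combination_zero[OF this(2) w(2)]
    have "\<alpha> * w1 = 0" unfolding ab by simp
    then show False using assms(3) w(2) by simp
  qed
  moreover have "\<exists>m\<in>\<Lambda>. of_int N * l = \<alpha> * m" if l: "l \<in> \<Lambda>'" for l
  proof -
    obtain i j where ij: "l = of_int i * u1 + of_int j * u2" using l u(1) by blast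
    have "of_int N * l = of_int i * (of_int N * u1) + of_int j * (of_int N * u2)"
      unfolding ij by (simp add: algebra_simps)
    also have "\<dots> = \<alpha> * (of_int (i * d - j * c) * w1 + of_int (j * a - i * b) * w2)"
      unfolding 1 2 by (simp add: algebra_simps)
    finally show ?thesis unfolding w(1) by blast
  qed
  ultimately show ?thesis using that by blast
qed

lemma two_span_of_int_coprime:
  assumes "discrete_subgroup \<Lambda>" "coprime a b"
  shows "two_span (of_int a * c) (of_int b * c) \<Lambda> = (\<lambda>z. c * z) ` \<Lambda>"
proof
  note Z = unital_subring_of_int[OF unital_subring_multiplier_ring[OF assms(1)]]
  have Z\<Lambda>: "of_int m * l \<in> \<Lambda>" if "l \<in> \<Lambda>" for m l using Z[of m] that unfolding multiplier_ring_def by blast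
  show "two_span (of_int a * c) (of_int b * c) \<Lambda> \<subseteq> (\<lambda>z. c * z) ` \<Lambda>"
  proof
    fix z assume "z \<in> two_span (of_int a * c) (of_int b * c) \<Lambda>"
    then obtain x y where xy: "x \<in> \<Lambda>" "y \<in> \<Lambda>" "z = of_int a * c * x + of_int b * c * y"
      unfolding two_span_def by blast
    have "z = c * (of_int a * x + of_int b * y)" unfolding xy(3) by (simp add: algebra_simps)
    then show "z \<in> (\<lambda>z. c * z) ` \<Lambda>" using discrete_subgroup_add[OF assms(1)] Z\<Lambda> xy by blast
  qed
  obtain u v where uv: "u * a + v * b = 1" using bezout_int[of a b] assms(2) by auto
  show "(\<lambda>z. c * z) ` \<Lambda> \<subseteq> two_span (of_int a * c) (of_int b * c) \<Lambda>"
  proof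
    fix z assume "z \<in> (\<lambda>z. c * z) ` \<Lambda>"
    then obtain l where l: "l \<in> \<Lambda>" "z = c * l" by blast
    have "z = of_int (u * a + v * b) * c * l" using uv l(2) by simp
    also have "\<dots> = of_int a * c * (of_int u * l) + of_int b * c * (of_int v * l)"
      by (simp add: algebra_simps)
    finally show "z \<in> two_span (of_int a * c) (of_int b * c) \<Lambda>"
      unfolding two_span_def using Z\<Lambda>[OF l(1)] by blast
  qed
qed

text \<open>An order contains a nonzero integral multiple of each element of \<open>K\<close>, in
  particular of the imaginary square root.\<close>

lemma order_not_Ints:
  assumes "imaginary_quadratic_field K" "order_in K R"
  shows "R \<noteq> \<int>"
proof -
  obtain d :: nat where d: "d > 0" "K = {of_rat a + of_rat b * (\<i> * of_real (sqrt (real d))) |a b. True}"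
    using assms(1) unfolding imaginary_quadratic_field_def by blast
  define x where "x = \<i> * of_real (sqrt (real d))"
  have "x = of_rat 0 + of_rat 1 * (\<i> * of_real (sqrt (real d)))" by (simp add: x_def)
  then have "x \<in> K" unfolding d(2) by blast
  then obtain n :: int where n: "n \<noteq> 0" "of_int n * x \<in> R" using assms(2) unfolding order_in_def by blast
  have "Im (of_int n * x) \<noteq> 0" using n(1) d(1) by (simp add: x_def)
  moreover have "Im z = 0" if "z \<in> \<int>" for z using that by (auto elim: Ints_cases)
  ultimately have "of_int n * x \<notin> \<int>" by blast
  then show ?thesis using n(2) by auto
qed

lemma order_fraction_field:
  assumes "order_in K R" "x \<in> K"
  shows "x \<in> fraction_field R"
proof -
  have R: "unital_subring R" using assms(1) unfolding order_in_def unital_subring_def by blast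
  obtain n :: int where n: "n \<noteq> 0" "of_int n * x \<in> R" using assms unfolding order_in_def by blast
  then have "x = (of_int n * x) / of_int n" by simp
  from fraction_fieldI[OF this n(2) unital_subring_of_int[OF R]] n(1) show ?thesis by simp
qed

section \<open>Stability criteria with and without complex multiplication\<close>

context torus_correspondence
begin

lemma isomorphic_iff: "isomorphic_curves (C 1) (C 0) \<longleftrightarrow> (\<exists>c. c \<noteq> 0 \<and> \<Lambda>0 = (\<lambda>z. c * z) ` \<Lambda>1)"
  by (rule isomorphic_curves_iff_homothetic[OF T1.uniformized_axioms T0.uniformized_axioms])

text \<open>Multipliers of \<open>\<Lambda>1\<close> commute with \<alpha> and \<beta>, so they act
  on every later common preimage. Index 0 has its own hypothesis because \<open>\<Lambda>1\<close>
  is not constructed as a common preimage of \<open>\<Lambda>0\<close>.\<close>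

lemma unit_combination_imp_stable:
  assumes "two_span \<alpha> \<beta> \<Lambda>1 = \<Lambda>0" "unit_combination (multiplier_ring \<Lambda>1) \<alpha> \<beta>"
  shows "stable_correspondence C"
proof -
  let ?R = "multiplier_ring \<Lambda>1"
  have "(\<forall>x\<in>L (Suc n). \<forall>y\<in>L (Suc n). x + y \<in> L (Suc n)) \<and> (\<forall>r\<in>?R. \<forall>x\<in>L (Suc n). r * x \<in> L (Suc n))" for n
  proof (induction n)
    case 0
    then show ?case using discrete_subgroup_add[OF discrete1] unfolding multiplier_ring_def by auto
  next
    case (Suc n)
    then show ?case by (auto simp: common_preimage_def distrib_left mult.left_commute)
  qed
  then have "two_span \<alpha> \<beta> (L (Suc (Suc n))) = L (Suc n)" for n
    using unit_combination_imp_two_span_common_preimage[OF assms(2), of "L (Suc n)"] by simp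
  then have "two_span \<alpha> \<beta> (L (Suc n)) = L n" for n using assms(1) by (cases n) auto
  then show ?thesis using stable_iff_two_span by blast
qed

lemma irreducible_2_iff: "irreducible_curve (C 2) \<longleftrightarrow> two_span \<alpha> \<beta> \<Lambda>1 = \<Lambda>0"
  using irreducible_iff_two_span[of 1] by (simp add: numeral_2_eq_2)

lemma irreducible_3_iff:
  "irreducible_curve (C 3) \<longleftrightarrow>
     two_span \<alpha> \<beta> \<Lambda>1 = \<Lambda>0 \<and> two_span \<alpha> \<beta> (common_preimage \<alpha> \<beta> \<Lambda>1) = \<Lambda>1"
  using irreducible_iff_two_span[of 2] by (auto simp: numeral_3_eq_3 numeral_2_eq_2 less_Suc_eq)

lemma irreducible_imp_two_span:
  assumes "irreducible_curve (C n)" "n \<ge> 2"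
  shows "two_span \<alpha> \<beta> \<Lambda>1 = \<Lambda>0"
proof -
  obtain m where "n = Suc (Suc m)" using assms(2) by (metis add_2_eq_Suc le_Suc_ex)
  then show ?thesis using assms(1) irreducible_iff_two_span[of "Suc m"] by (auto dest: spec[of _ 0])
qed

text \<open>From \<open>N\<close> times \<open>\<Lambda>0\<close> inside \<alpha> times
  \<open>\<Lambda>1\<close>, the number \<open>N * \<beta> / \<alpha>\<close> multiplies
  \<open>\<Lambda>0\<close> into itself, so it is an integer. In lowest terms \<alpha> and \<beta>
  are coprime multiples of one \<open>c\<close>, and the span is \<open>c\<close> times
  \<open>\<Lambda>1\<close>.\<close>

lemma no_CM_imp_homothetic:
  assumes "\<not> has_CM \<Lambda>0" "two_span \<alpha> \<beta> \<Lambda>1 = \<Lambda>0"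
  shows "\<exists>c. c \<noteq> 0 \<and> \<Lambda>0 = (\<lambda>z. c * z) ` \<Lambda>1"
proof -
  obtain N :: int where N: "N \<noteq> 0" "\<And>l. l \<in> \<Lambda>0 \<Longrightarrow> \<exists>m\<in>\<Lambda>1. of_int N * l = \<alpha> * m"
    using lattice_finite_index[OF lattice(2,1) slopes_nonzero(1) slopes_lattice(1)] by blast
  have "of_int N * \<beta> / \<alpha> \<in> multiplier_ring \<Lambda>0"
    unfolding multiplier_ring_def
  proof (intro CollectI ballI)
    fix l assume "l \<in> \<Lambda>0"
    then obtain m where m: "m \<in> \<Lambda>1" "of_int N * l = \<alpha> * m" using N(2) by blast
    have "of_int N * \<beta> / \<alpha> * l = \<beta> * (of_int N * l) / \<alpha>" by simp
    also have "\<dots> = \<beta> * m" unfolding m(2) using slopes_nonzero by simp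
    finally show "of_int N * \<beta> / \<alpha> * l \<in> \<Lambda>0" using slopes_lattice(2)[OF m(1)] by simp
  qed
  then have "of_int N * \<beta> / \<alpha> \<in> \<int>" using assms(1) unfolding has_CM_def by simp
  then obtain M :: int where M: "of_int N * \<beta> / \<alpha> = of_int M" by (auto elim: Ints_cases)
  then have NM: "of_int N * \<beta> = of_int M * \<alpha>" using slopes_nonzero by (simp add: field_simps)
  define g where "g = gcd N M"
  have g: "g \<noteq> 0" using N(1) by (simp add: g_def)
  obtain a b where ab: "N = g * a" "M = g * b" "coprime a b"
    using gcd_coprime_exists[of N M] g unfolding g_def by (metis mult.commute)
  have a: "a \<noteq> 0" using ab(1) N(1) by auto
  define c where "c = \<alpha> / of_int a"
  have \<alpha>: "\<alpha> = of_int a * c" using a by (simp add: c_def)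
  have "of_int g * (of_int a * \<beta>) = of_int g * (of_int b * \<alpha>)" using NM unfolding ab by simp
  then have "of_int a * \<beta> = of_int b * \<alpha>" using g by simp
  then have "\<beta> = of_int b * c" using a by (simp add: c_def field_simps)
  then have "\<Lambda>0 = (\<lambda>z. c * z) ` \<Lambda>1"
    using two_span_of_int_coprime[OF discrete1 ab(3), of c] assms(2) \<alpha> by simp
  moreover have "c \<noteq> 0" using \<alpha> slopes_nonzero(1) by auto
  ultimately show ?thesis by blast
qed

text \<open>The numbers \<open>\<alpha> / c\<close> and \<open>\<beta> / c\<close> multiply
  \<open>\<Lambda>0\<close> into itself, hence are integers. Stability gives a Bezout relation by
  comparing the coefficients of \<open>w1\<close> in the span; conversely, a Bezout relation is a
  unit combination with integer coefficients.\<close>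

lemma no_CM_homothetic:
  assumes "\<not> has_CM \<Lambda>0" "c \<noteq> 0" "\<Lambda>0 = (\<lambda>z. c * z) ` \<Lambda>1"
  shows "\<exists>a b :: int. \<alpha> = of_int a * c \<and> \<beta> = of_int b * c \<and> (stable_correspondence C \<longleftrightarrow> gcd a b = 1)"
proof -
  have int: "\<exists>a::int. \<mu> = of_int a * c" if \<mu>: "\<And>l. l \<in> \<Lambda>1 \<Longrightarrow> \<mu> * l \<in> \<Lambda>0" for \<mu>
  proof -
    have "\<mu> / c \<in> multiplier_ring \<Lambda>0"
      unfolding multiplier_ring_def using \<mu> assms(2,3) by auto
    then have "\<mu> / c \<in> \<int>" using assms(1) unfolding has_CM_def by simp
    then obtain a :: int where "\<mu> / c = of_int a" by (auto elim: Ints_cases)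
    then show ?thesis using assms(2) by (auto simp: field_simps)
  qed
  obtain a b :: int where ab: "\<alpha> = of_int a * c" "\<beta> = of_int b * c"
    using int[OF slopes_lattice(1)] int[OF slopes_lattice(2)] by blast
  have 1: "gcd a b = 1" if "stable_correspondence C"
  proof -
    have span: "two_span \<alpha> \<beta> \<Lambda>1 = \<Lambda>0" using that irreducible_2_iff unfolding stable_correspondence_def by blast
    obtain w1 w2 where w: "\<Lambda>1 = {of_int m * w1 + of_int n * w2 |m n. True}" "Im (w2 * cnj w1) \<noteq> 0"
      using complex_lattice_basis[OF lattice(2)] .
    have "of_int 1 * w1 + of_int 0 * w2 \<in> \<Lambda>1" unfolding w(1) by blast
    then have "w1 \<in> \<Lambda>1" by simp
    then have "c * w1 \<in> two_span \<alpha> \<beta> \<Lambda>1" unfolding span assms(3) by (rule imageI)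
    then obtain x y where xy: "x \<in> \<Lambda>1" "y \<in> \<Lambda>1" "c * w1 = \<alpha> * x + \<beta> * y" unfolding two_span_def by blast
    obtain m n m' n' where mn: "x = of_int m * w1 + of_int n * w2" "y = of_int m' * w1 + of_int n' * w2"
      using xy(1,2) w(1) by blast
    have "c * w1 = c * (of_int a * x + of_int b * y)" unfolding xy(3) ab by (simp add: algebra_simps)
    then have "w1 = of_int a * x + of_int b * y" using assms(2) by simp
    then have "of_int (a * m + b * m' - 1) * w1 + of_int (a * n + b * n') * w2 = 0"
      unfolding mn by (simp add: algebra_simps)
    from basis_combination_zero(1)[OF this w(2)] have 2: "a * m + b * m' = 1" by simp
    have "gcd a b dvd a * m + b * m'" by simp
    then show ?thesis unfolding 2 by simp
  qed
  have "stable_correspondence C" if g: "gcd a b = 1"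
  proof (rule unit_combination_imp_stable)
    have "coprime a b" using g by (simp add: coprime_iff_gcd_eq_1)
    then show "two_span \<alpha> \<beta> \<Lambda>1 = \<Lambda>0"
      using two_span_of_int_coprime[OF discrete1, of a b c] ab assms(3) by simp
    obtain u v where uv: "u * a + v * b = 1" using bezout_int[of a b] g by auto
    note Z = unital_subring_of_int[OF unital_subring_multiplier_ring[OF discrete1]]
    have "complex_of_int a * of_int u + of_int b * of_int v = of_int (u * a + v * b)" by simp
    then have "unit_combination (multiplier_ring \<Lambda>1) (of_int a) (of_int b)"
      unfolding unit_combination_def uv
      by (intro exI[of _ "of_int u"] exI[of _ "of_int v"])
        (simp del: of_int_mult add: Z of_int_mult[symmetric])
    then show "unit_combination (multiplier_ring \<Lambda>1) \<alpha> \<beta>"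
      using unit_combination_scale[OF assms(2), of _ "of_int a" "of_int b"] ab by (simp add: mult.commute)
  qed
  then show ?thesis using 1 ab by (intro exI[of _ a] exI[of _ b] conjI iffI)
qed

text \<open>The third iterate is the first to see a common preimage of \<open>\<Lambda>1\<close>,
  and the equation for it is the one to which invertibility of \<open>\<Lambda>1\<close>
  applies.\<close>

lemma CM_irreducible_3_imp:
  assumes "multiplier_ring \<Lambda>1 \<noteq> \<int>" "irreducible_curve (C 3)"
  shows "two_span \<alpha> \<beta> \<Lambda>1 = \<Lambda>0" "unit_combination (multiplier_ring \<Lambda>1) \<alpha> \<beta>"
  using assms irreducible_3_iff two_span_common_preimage_imp_unit_combination[OF lattice(2)] by auto

text \<open>The slopes themselves change when the two lattices are scaled independently and may
  leave the field; their quotient maps \<open>\<Lambda>1\<close> into itself after multiplication by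
  an integer.\<close>

lemma slope_quotient_in_fraction_field: "\<beta> / \<alpha> \<in> fraction_field (multiplier_ring \<Lambda>1)"
proof -
  obtain N :: int where N: "N \<noteq> 0" "\<And>l. l \<in> \<Lambda>0 \<Longrightarrow> \<exists>m\<in>\<Lambda>1. of_int N * l = \<alpha> * m"
    using lattice_finite_index[OF lattice(2,1) slopes_nonzero(1) slopes_lattice(1)] by blast
  have "of_int N * \<beta> / \<alpha> \<in> multiplier_ring \<Lambda>1"
    unfolding multiplier_ring_def
  proof (intro CollectI ballI)
    fix l assume "l \<in> \<Lambda>1"
    then obtain m where m: "m \<in> \<Lambda>1" "of_int N * (\<beta> * l) = \<alpha> * m" using N(2) slopes_lattice(2) by blast
    have "of_int N * \<beta> / \<alpha> * l = (of_int N * (\<beta> * l)) / \<alpha>" by simp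
    then show "of_int N * \<beta> / \<alpha> * l \<in> \<Lambda>1" unfolding m(2) using m(1) slopes_nonzero by simp
  qed
  moreover have eq: "\<beta> / \<alpha> = (of_int N * \<beta> / \<alpha>) / of_int N" using N(1) by simp
  moreover have "of_int N \<in> multiplier_ring \<Lambda>1"
    using unital_subring_of_int[OF unital_subring_multiplier_ring[OF discrete1]] .
  ultimately show ?thesis using fraction_fieldI[OF eq] N(1) by simp
qed

lemma unit_combination_iff_invertible:
  "unit_combination (multiplier_ring \<Lambda>1) \<alpha> \<beta> \<longleftrightarrow>
     (\<exists>c. c \<noteq> 0 \<and> invertible_fractional_ideal (multiplier_ring \<Lambda>1)
        (two_span (c * \<alpha>) (c * \<beta>) (multiplier_ring \<Lambda>1)))"
proof
  note R = unital_subring_multiplier_ring[OF discrete1]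
  {
    assume unit: "unit_combination (multiplier_ring \<Lambda>1) \<alpha> \<beta>"
    \<comment> \<open>Scaling the first generator to 1 makes the second
      \<open>\<beta> / \<alpha>\<close>, so both lie in the fraction field.\<close>
    define c where "c = 1 / \<alpha>"
    have c: "c \<noteq> 0" "c * \<alpha> = 1" "c * \<beta> = \<beta> / \<alpha>" using slopes_nonzero by (auto simp: c_def)
    have "1 \<in> fraction_field (multiplier_ring \<Lambda>1)"
      using unital_subringD(1)[OF R] by (intro fraction_fieldI[of _ 1 1]) simp_all
    moreover have "unit_combination (multiplier_ring \<Lambda>1) (c * \<alpha>) (c * \<beta>)"
      using unit unit_combination_scale[OF c(1)] by blast
    ultimately have "invertible_fractional_ideal (multiplier_ring \<Lambda>1) (two_span (c * \<alpha>) (c * \<beta>) (multiplier_ring \<Lambda>1))"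
      unfolding c(2,3) using slope_quotient_in_fraction_field
      by (intro unit_combination_imp_invertible[OF R]) simp_all
    then show "\<exists>c. c \<noteq> 0 \<and> invertible_fractional_ideal (multiplier_ring \<Lambda>1)
        (two_span (c * \<alpha>) (c * \<beta>) (multiplier_ring \<Lambda>1))" using c(1) by blast
  }
  assume "\<exists>c. c \<noteq> 0 \<and> invertible_fractional_ideal (multiplier_ring \<Lambda>1)
        (two_span (c * \<alpha>) (c * \<beta>) (multiplier_ring \<Lambda>1))"
  then show "unit_combination (multiplier_ring \<Lambda>1) \<alpha> \<beta>"
    using invertible_imp_unit_combination[OF R] unit_combination_scale by blast
qed

end

text \<open>The choice \<open>c = 1\<close> in the first part is the normalization in which the two
  lattices coincide. In the second part \<alpha> and \<beta> generate a fractional ideal only if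
  they lie in \<open>K\<close>, which depends on the scaling of the lattices; the scalar
  \<open>c\<close> covers the other cases, and the literal criterion is given for \<alpha> and
  \<beta> in \<open>K\<close>.\<close>

theorem theorem4p6:
  fixes \<Lambda>0 \<Lambda>1 :: "complex set"
    and C :: "nat \<Rightarrow> complex set surface"
    and f g :: "nat \<Rightarrow> complex set \<Rightarrow> complex set"
    and \<alpha> \<beta> \<gamma> \<delta> :: complex
  assumes "complex_lattice \<Lambda>0" and "complex_lattice \<Lambda>1"
    and "iterates C f g"
    and "C 0 = complex_torus \<Lambda>0" and "C 1 = complex_torus \<Lambda>1"
    and "\<And>z. f 1 (coset \<Lambda>1 z) = coset \<Lambda>0 (\<alpha> * z + \<gamma>)"
    and "\<And>z. g 1 (coset \<Lambda>1 z) = coset \<Lambda>0 (\<beta> * z + \<delta>)"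
  shows
    "(\<not> has_CM \<Lambda>0 \<longrightarrow>
       (\<not> isomorphic_curves (C 1) (C 0) \<longrightarrow> (\<forall>n\<ge>2. \<not> irreducible_curve (C n))) \<and>
       (isomorphic_curves (C 1) (C 0) \<longrightarrow>
          (\<exists>c. c \<noteq> 0 \<and> \<Lambda>0 = (\<lambda>z. c * z) ` \<Lambda>1) \<and>
          (\<forall>c. c \<noteq> 0 \<and> \<Lambda>0 = (\<lambda>z. c * z) ` \<Lambda>1 \<longrightarrow>
             (\<exists>a b :: int. \<alpha> = of_int a * c \<and> \<beta> = of_int b * c \<and>
                (stable_correspondence C \<and> (\<forall>n. genus (C n) = 1) \<longleftrightarrow> gcd a b = 1))))) \<and>
     (\<forall>K. imaginary_quadratic_field K \<and>
         order_in K (multiplier_ring \<Lambda>0) \<and> order_in K (multiplier_ring \<Lambda>1) \<longrightarrow>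
       ((\<forall>n. irreducible_curve (C n) \<and> genus (C n) = 1) \<longleftrightarrow>
          two_span \<alpha> \<beta> \<Lambda>1 = \<Lambda>0 \<and>
          (\<exists>c. c \<noteq> 0 \<and> invertible_fractional_ideal (multiplier_ring \<Lambda>1)
                          (two_span (c * \<alpha>) (c * \<beta>) (multiplier_ring \<Lambda>1)))) \<and>
       (\<alpha> \<in> K \<and> \<beta> \<in> K \<longrightarrow>
          ((\<forall>n. irreducible_curve (C n) \<and> genus (C n) = 1) \<longleftrightarrow>
             two_span \<alpha> \<beta> \<Lambda>1 = \<Lambda>0 \<and>
             invertible_fractional_ideal (multiplier_ring \<Lambda>1)
               (two_span \<alpha> \<beta> (multiplier_ring \<Lambda>1)))) \<and>
       (stable_correspondence C \<longleftrightarrow> irreducible_curve (C 3)))"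
proof -
  interpret torus_correspondence \<Lambda>0 \<Lambda>1 C f g \<alpha> \<beta> \<gamma> \<delta>
    using assms by unfold_locales
  let ?R = "multiplier_ring \<Lambda>1"
  have genus: "stable_correspondence C \<and> (\<forall>n. genus (C n) = 1) \<longleftrightarrow> stable_correspondence C"
    using stable_imp_genus by blast
  then have genus': "(\<forall>n. irreducible_curve (C n) \<and> genus (C n) = 1) \<longleftrightarrow> stable_correspondence C"
    unfolding stable_correspondence_def by blast
  have stable_CM: "stable_correspondence C \<longleftrightarrow> irreducible_curve (C 3)"
    "stable_correspondence C \<longleftrightarrow> two_span \<alpha> \<beta> \<Lambda>1 = \<Lambda>0 \<and> unit_combination ?R \<alpha> \<beta>"
    if "imaginary_quadratic_field K \<and> order_in K (multiplier_ring \<Lambda>0) \<and> order_in K ?R" for K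
  proof -
    have "?R \<noteq> \<int>" using that order_not_Ints by blast
    then show "stable_correspondence C \<longleftrightarrow> irreducible_curve (C 3)"
      "stable_correspondence C \<longleftrightarrow> two_span \<alpha> \<beta> \<Lambda>1 = \<Lambda>0 \<and> unit_combination ?R \<alpha> \<beta>"
      using CM_irreducible_3_imp unit_combination_imp_stable
      unfolding stable_correspondence_def by blast+
  qed
  show ?thesis
    unfolding genus genus'
  proof (intro conjI allI impI)
    show "\<not> irreducible_curve (C n)"
      if "\<not> has_CM \<Lambda>0" "\<not> isomorphic_curves (C 1) (C 0)" "n \<ge> 2" for n
      using that irreducible_imp_two_span no_CM_imp_homothetic isomorphic_iff by blast
    show "\<exists>c. c \<noteq> 0 \<and> \<Lambda>0 = (\<lambda>z. c * z) ` \<Lambda>1" if "isomorphic_curves (C 1) (C 0)"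
      using that isomorphic_iff by blast
    show "\<exists>a b :: int. \<alpha> = of_int a * c \<and> \<beta> = of_int b * c \<and> (stable_correspondence C \<longleftrightarrow> gcd a b = 1)"
      if "\<not> has_CM \<Lambda>0" "c \<noteq> 0 \<and> \<Lambda>0 = (\<lambda>z. c * z) ` \<Lambda>1" for c
      using no_CM_homothetic that by blast
    fix K
    assume K: "imaginary_quadratic_field K \<and> order_in K (multiplier_ring \<Lambda>0) \<and> order_in K ?R"
    show "stable_correspondence C \<longleftrightarrow> irreducible_curve (C 3)" by (rule stable_CM(1)[OF K])
    show "stable_correspondence C \<longleftrightarrow> two_span \<alpha> \<beta> \<Lambda>1 = \<Lambda>0 \<and>
      (\<exists>c. c \<noteq> 0 \<and> invertible_fractional_ideal ?R (two_span (c * \<alpha>) (c * \<beta>) ?R))"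
      unfolding stable_CM(2)[OF K] unit_combination_iff_invertible ..
    assume "\<alpha> \<in> K \<and> \<beta> \<in> K"
    then have "\<alpha> \<in> fraction_field ?R" "\<beta> \<in> fraction_field ?R" using K order_fraction_field by auto
    then have "unit_combination ?R \<alpha> \<beta> \<longleftrightarrow> invertible_fractional_ideal ?R (two_span \<alpha> \<beta> ?R)"
      using slopes_nonzero(1) unital_subring_multiplier_ring[OF discrete1]
        unit_combination_imp_invertible invertible_imp_unit_combination by blast
    then show "stable_correspondence C \<longleftrightarrow> two_span \<alpha> \<beta> \<Lambda>1 = \<Lambda>0 \<and>
      invertible_fractional_ideal ?R (two_span \<alpha> \<beta> ?R)"
      using stable_CM(2)[OF K] by simp
  qed
qed

end
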